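(* Suppose $p_0,p_1\in(0,\infty)$, $q\in[1,\infty)$, $s_0\ne s_1\in\mathbb{R}$ and $\theta\in(0,1)$. Then for any $c_0\in(0,\infty)$ and $c_1\in(1,\infty)$, $(T^{p_0,q}_{s_0}(\mathbb{R}^n),T^{p_1,q}_{s_1}(\mathbb{R}^n))_{\theta,p_\theta}=Z^{p_\theta,q}_{s_\theta}(\mathbb{R}^n;c_0,c_1)$ with equivalent quasi-norms, where $1/p_\theta=(1-\theta)/p_0+\theta/p_1$ and $s_\theta=(1-\theta)s_0+\theta s_1$.
   Context: $\mathbb{R}^n$ carries the Euclidean distance and Lebesgue measure, so $V(x,t)=|B(x,t)|=\omega_nt^n$. $\mathbb{R}^{n+1}_+:=\mathbb{R}^n\times(0,\infty)$ with measure $dy\,dt/t$. $\Gamma(x):=\{(y,t):|x-y|<t\}$. $\mathcal{A}^qf(x):=(\iint_{\Gamma(x)}|f|^q\frac{dy}{V(y,t)}\frac{dt}{t})^{1/q}$; $(V^sf)(y,t):=V(y,t)^sf(y,t)$; $\|f\|_{T^{p,q}_s(\mathbb{R}^n)}:=\|\mathcal{A}^q(V^{-s}f)\|_{L^p(\mathbb{R}^n)}$. For $c_0>0,c_1>1$: $\Omega_{c_0,c_1}(x,t):=B(x,c_0t)\times(t/c_1,c_1t)$, $\mathcal{W}^q_{c_0,c_1}f(x,t):=(\text{average of }|f(\xi,\tau)|^q\text{ over }\Omega_{c_0,c_1}(x,t)\text{ w.r.t. }d\xi\,d\tau)^{1/q}$, and $\|f\|_{Z^{p,q}_s(\mathbb{R}^n;c_0,c_1)}:=\|\mathcal{W}^q_{c_0,c_1}(V^{-s}f)\|_{L^p(\mathbb{R}^{n+1}_+,dx\,dt/t)}$.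 Real interpolation of quasi-normed spaces via the K-method: $K(t,f;A_0,A_1):=\inf_{f=f_0+f_1}(\|f_0\|_{A_0}+t\|f_1\|_{A_1})$, $\|f\|_{(A_0,A_1)_{\theta,p}}:=(\int_0^\infty(t^{-\theta}K(t,f))^pdt/t)^{1/p}$. *)

theory Defs
  imports "HOL-Analysis.Analysis"
begin

text \<open>Real power of an extended nonnegative real (used with positive exponents only):
  infinity stays infinity.\<close>
definition epow :: "ennreal \<Rightarrow> real \<Rightarrow> ennreal" where
  "epow x r = (if x = top then top else ennreal (enn2real x powr r))"

text \<open>Points of the upper half space are pairs (y,t) with y in the Euclidean space 'a
  (playing the role of R^n) and t > 0.  Volume of balls: V(x,t) = |B(x,t)|.\<close>
definition Vol :: "'a::euclidean_space \<Rightarrow> real \<Rightarrow> real" where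
  "Vol x t = measure lborel (ball x t)"

definition Vpow :: "real \<Rightarrow> ('a::euclidean_space \<times> real \<Rightarrow> real) \<Rightarrow> 'a \<times> real \<Rightarrow> real" where
  "Vpow s f = (\<lambda>(y,t). Vol y t powr s * f (y,t))"

definition cone :: "'a::euclidean_space \<Rightarrow> ('a \<times> real) set" where
  "cone x = {(y,t). dist x y < t}"

definition Aq :: "real \<Rightarrow> ('a::euclidean_space \<times> real \<Rightarrow> real) \<Rightarrow> 'a \<Rightarrow> ennreal" where
  "Aq q f x = epow (\<integral>\<^sup>+ z. indicator (cone x) z *
       ennreal (\<bar>f z\<bar> powr q / (Vol (fst z) (snd z) * snd z)) \<partial>(lborel \<Otimes>\<^sub>M lborel)) (1/q)"

definition tent_norm :: "real \<Rightarrow> real \<Rightarrow> real \<Rightarrow> ('a::euclidean_space \<times> real \<Rightarrow> real) \<Rightarrow> ennreal" where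
  "tent_norm p q s f = epow (\<integral>\<^sup>+ x. epow (Aq q (Vpow (-s) f) x) p \<partial>lborel) (1/p)"

definition whitney :: "real \<Rightarrow> real \<Rightarrow> 'a::euclidean_space \<Rightarrow> real \<Rightarrow> ('a \<times> real) set" where
  "whitney c0 c1 x t = ball x (c0 * t) \<times> {t / c1 <..< c1 * t}"

definition Wq :: "real \<Rightarrow> real \<Rightarrow> real \<Rightarrow> ('a::euclidean_space \<times> real \<Rightarrow> real) \<Rightarrow> 'a \<times> real \<Rightarrow> ennreal" where
  "Wq c0 c1 q f = (\<lambda>(x,t). epow
      ((\<integral>\<^sup>+ z. indicator (whitney c0 c1 x t) z * ennreal (\<bar>f z\<bar> powr q) \<partial>(lborel \<Otimes>\<^sub>M lborel))
        / emeasure (lborel \<Otimes>\<^sub>M lborel) (whitney c0 c1 x t)) (1/q))"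

definition Z_norm :: "real \<Rightarrow> real \<Rightarrow> real \<Rightarrow> real \<Rightarrow> real \<Rightarrow> ('a::euclidean_space \<times> real \<Rightarrow> real) \<Rightarrow> ennreal" where
  "Z_norm p q s c0 c1 f = epow (\<integral>\<^sup>+ z. indicator {z. 0 < snd z} z *
       epow (Wq c0 c1 q (Vpow (-s) f) z) p / ennreal (snd z) \<partial>(lborel \<Otimes>\<^sub>M lborel)) (1/p)"

text \<open>K-functional for a pair of quasi-normed function spaces given by their quasi-norms
  (the space being the functions with finite quasi-norm).  Decompositions range over
  measurable functions; if no decomposition with finite terms exists, K = infinity.\<close>
definition K_fun :: "(('a::euclidean_space \<times> real \<Rightarrow> real) \<Rightarrow> ennreal) \<Rightarrow> (('a \<times> real \<Rightarrow> real) \<Rightarrow> ennreal)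
     \<Rightarrow> real \<Rightarrow> ('a \<times> real \<Rightarrow> real) \<Rightarrow> ennreal" where
  "K_fun N0 N1 t f = (INF (f0, f1) \<in> {(f0, f1). f0 \<in> borel_measurable (lborel \<Otimes>\<^sub>M lborel) \<and>
        f1 \<in> borel_measurable (lborel \<Otimes>\<^sub>M lborel) \<and> (\<forall>z. f z = f0 z + f1 z)}.
      N0 f0 + ennreal t * N1 f1)"

definition interp_norm :: "(('a::euclidean_space \<times> real \<Rightarrow> real) \<Rightarrow> ennreal) \<Rightarrow> (('a \<times> real \<Rightarrow> real) \<Rightarrow> ennreal)
     \<Rightarrow> real \<Rightarrow> real \<Rightarrow> ('a \<times> real \<Rightarrow> real) \<Rightarrow> ennreal" where
  "interp_norm N0 N1 \<theta> p f = epow (\<integral>\<^sup>+ t\<in>{0<..}.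
       epow (ennreal (t powr (-\<theta>)) * K_fun N0 N1 t f) p / ennreal t \<partial>lborel) (1/p)"

end

theory Submission
  imports Defs
begin

text \<open>
  Discretise the upper half space into Whitney cells of scales \<open>r\<^sup>k\<close> with \<open>r = c\<^sub>1\<close>, and let \<open>h\<close> be the
  \<open>L\<^sup>q\<close> means over the cells. The \<open>Z\<close>-norm is a weighted \<open>\<ell>\<^sup>p(L\<^sup>p)\<close>-norm of \<open>h\<close>, while a tent norm
  dominates the weighted supremum of \<open>h\<close> along each vertical line.

  Both inequalities pass through the power theorem, which replaces the norms \<open>N\<^sub>i\<close> by their \<open>p\<^sub>i\<close>-th powers;
  these are integrals over the base and can be treated at each base point separately. For nearly optimal
  decompositions of \<open>f\<close>, the lower bound for the interpolation norm is then a statement about sequences.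
  For the upper bound, let \<open>b\<^sub>i\<close> be \<open>h\<close> with the weight of the \<open>i\<close>-th tent space and cut \<open>f\<close> along the level
  sets of \<open>b\<^sub>0\<close> to the \<open>p\<^sub>0\<close> over \<open>b\<^sub>1\<close> to the \<open>p\<^sub>1\<close>. On cells of one vertical line where this quotient has the same
  size, \<open>b\<^sub>i\<close> varies geometrically because \<open>s\<^sub>0 \<noteq> s\<^sub>1\<close>; hence the area functional of each piece is controlled by a
  supremum, whatever the order of \<open>p\<^sub>i\<close> and \<open>q\<close>.
\<close>

section \<open>Powers of extended nonnegative reals\<close>

text \<open>After the power theorem the parameter is \<open>\<eta> = \<theta> * a / p1\<close> and
  the second index is 1. The resulting norm is linear in integrals over the base, which is why an
  estimate proved at one point may simply be integrated. At a fixed point the height itself acts as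
  the parameter of the K-functional: a change of weight multiplies an L^q cell mean by a factor
  geometric in its scale. The upper bound needs decay twice, over the scales above a point and over
  the levels of the cut. The quotient relative to the level, raised to a small power
  \<open>-e\<close>, buys the first at the cost of \<open>e\<close> in the exponents
  \<open>\<eta>\<close> and \<open>1 - \<eta>\<close>; what remains of these exponents gives the
  second. No maximal inequality occurs. Cell means are constant on cells, so near a point any power
  of them is below a local average of the same power, and the integral of that average is explicit.
  This is why small exponents need no separate treatment.\<close>

type_synonym 'a hfun = "'a \<times> real \<Rightarrow> real"

abbreviation ball_vol :: "'a::euclidean_space itself \<Rightarrow> real" where
  "ball_vol _ \<equiv> unit_ball_vol (real DIM('a))"

abbreviation lborel2 :: "('a::euclidean_space \<times> real) measure" where
  "lborel2 \<equiv> lborel \<Otimes>\<^sub>M lborel"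

abbreviation borel2 :: "('a::topological_space \<times> 'b::topological_space) measure" where
  "borel2 \<equiv> borel \<Otimes>\<^sub>M borel"

abbreviation bfun :: "('a::topological_space \<times> 'b::topological_space \<Rightarrow> 'c::topological_space) set" where
  "bfun \<equiv> borel_measurable borel2"

abbreviation isum :: "(int \<Rightarrow> ennreal) \<Rightarrow> ennreal" (binder "\<Sum>\<^sub>\<int>" 10) where
  "isum F \<equiv> nn_integral (count_space UNIV) F"

text \<open>\<open>\<theta> * a / p1\<close> is the parameter that the power theorem assigns to the
  pair of powers: raising the norms to \<open>p0\<close> and \<open>p1\<close> turns the pair
  \<open>\<theta>\<close>, \<open>a\<close> into \<open>\<theta> * a / p1\<close>, 1.\<close>

lemma interpolation_exponent:
  fixes a p0 p1 \<theta> :: real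
  assumes "0 < a" "1 / a = (1 - \<theta>) / p0 + \<theta> / p1"
  shows "(1 - \<theta>) * a / p0 = 1 - \<theta> * a / p1"
proof -
  have "a * (1 / a) = a * ((1 - \<theta>) / p0 + \<theta> / p1)" unfolding assms(2) ..
  then show ?thesis using assms(1) by (simp add: distrib_left) (simp add: algebra_simps)
qed

lemma epow_ennreal: "0 \<le> x \<Longrightarrow> epow (ennreal x) p = ennreal (x powr p)"
  by (simp add: epow_def)

lemma epow_top [simp]: "epow top p = top"
  by (simp add: epow_def)

lemma epow_zero [simp]: "epow 0 p = 0"
  by (simp add: epow_def)

lemma epow_one: "epow x 1 = x"
  by (cases x) (auto simp: epow_def)

lemma epow_mono:
  assumes "0 < p" "x \<le> y" shows "epow x p \<le> epow y p"
  using assms by (cases x; cases y) (auto simp: epow_ennreal top_unique intro!: ennreal_leI powr_mono2)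

lemma epow_epow: "epow (epow x p) p' = epow x (p * p')"
  by (cases x) (auto simp: epow_ennreal powr_powr)

lemma epow_mult: "epow (x * y) p = epow x p * epow y p"
proof (cases x)
  case (real x')
  show ?thesis
  proof (cases y)
    case (real y')
    with \<open>x = ennreal x'\<close> \<open>0 \<le> x'\<close> show ?thesis
      by (simp add: epow_ennreal powr_mult flip: ennreal_mult)
  next
    case top
    with \<open>x = ennreal x'\<close> \<open>0 \<le> x'\<close> show ?thesis
      by (cases "x' = 0") (simp_all add: epow_ennreal ennreal_mult_top ennreal_mult_eq_top_iff)
  qed
next
  case top
  then show ?thesis
    by (cases y rule: ennreal_cases; cases "y = 0")
       (auto simp: epow_ennreal ennreal_top_mult ennreal_mult_eq_top_iff)
qed

lemma epow_inverse:
  assumes "0 < p" shows "epow (epow x p) (1/p) = x" "epow (epow x (1/p)) p = x"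
  using assms by (simp_all add: epow_epow epow_one)

lemma epow_le_iff:
  assumes "0 < p" shows "epow x p \<le> y \<longleftrightarrow> x \<le> epow y (1/p)"
  using assms epow_mono[of "1/p" "epow x p" y] epow_mono[of p x "epow y (1/p)"]
  by (auto simp: epow_inverse)

lemma epow_eq_top_iff [simp]: "epow x p = top \<longleftrightarrow> x = top"
  by (simp add: epow_def)

lemma measurable_epow [measurable]: "(\<lambda>x. epow x p) \<in> borel_measurable borel"
  unfolding epow_def by measurable

lemma epow_add_le:
  assumes "0 < p"
  shows "epow (x + y) p \<le> ennreal (2 powr p) * (epow x p + epow y p)"
proof -
  have *: "epow (x + y) p \<le> ennreal (2 powr p) * (epow x p + epow y p)" if "x \<le> y" for x y
  proof -
    have "x + y \<le> ennreal 2 * y"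
      using add_right_mono[OF that, of y] by (simp add: mult_2)
    then have "epow (x + y) p \<le> epow (ennreal 2 * y) p"
      by (rule epow_mono[OF assms])
    also have "\<dots> = ennreal (2 powr p) * epow y p"
      unfolding epow_mult by (subst epow_ennreal) auto
    also have "\<dots> \<le> ennreal (2 powr p) * (epow x p + epow y p)"
      by (intro mult_left_mono) auto
    finally show ?thesis .
  qed
  show ?thesis
    using *[of x y] *[of y x] by (cases "x \<le> y") (auto simp: add.commute)
qed

text \<open>Uniformity in \<open>l\<close> is essential: the centre of the decay will be a logarithm
  that depends on the base point or on the function.\<close>

abbreviation exp_sums_le :: "real \<Rightarrow> real \<Rightarrow> bool" where
  "exp_sums_le \<kappa> C \<equiv> \<forall>l::real. (\<Sum>\<^sub>\<int>k. ennreal (exp (- \<bar>\<kappa> * real_of_int k - l\<bar>))) \<le> ennreal C"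

lemma epow_sum_le:
  assumes "0 < p" "finite A"
  shows "epow (\<Sum>i\<in>A. x i) p \<le> ennreal (2 powr (p * real (card A))) * (\<Sum>i\<in>A. epow (x i) p)"
  using assms(2)
proof induction
  case (insert i A)
  have "epow (\<Sum>j\<in>insert i A. x j) p \<le> ennreal (2 powr p) * (epow (x i) p + epow (\<Sum>j\<in>A. x j) p)"
    using insert by (simp add: epow_add_le[OF assms(1)])
  also have "\<dots> \<le> ennreal (2 powr p) * (ennreal (2 powr (p * real (card A))) * epow (x i) p +
       ennreal (2 powr (p * real (card A))) * (\<Sum>j\<in>A. epow (x j) p))"
  proof (intro mult_left_mono add_mono insert.IH)
    have "1 * epow (x i) p \<le> ennreal (2 powr (p * real (card A))) * epow (x i) p"
      using assms(1) by (intro mult_right_mono) (auto simp: ge_one_powr_ge_zero)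
    then show "epow (x i) p \<le> ennreal (2 powr (p * real (card A))) * epow (x i) p" by simp
  qed auto
  also have "\<dots> = ennreal (2 powr p * 2 powr (p * real (card A))) * (\<Sum>j\<in>insert i A. epow (x j) p)"
    using insert by (simp add: ennreal_mult distrib_left mult.assoc)
  also have "2 powr p * 2 powr (p * real (card A)) = 2 powr (p * real (card (insert i A)))"
    using insert by (simp add: powr_add[symmetric] algebra_simps)
  finally show ?case .
qed simp

lemma le_ennreal_divide:
  assumes "0 < c" "0 \<le> y" "ennreal c * x \<le> ennreal y"
  shows "x \<le> ennreal (y / c)"
proof -
  have "ennreal (1 / c) * (ennreal c * x) \<le> ennreal (1 / c) * ennreal y"
    using assms(3) by (rule mult_left_mono) simp
  then show ?thesis using assms by (simp add: mult.assoc[symmetric] ennreal_mult[symmetric])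
qed

section \<open>Geometric sums and logarithmic decay\<close>

lemma sum_exp_dist_bounded:
  fixes \<kappa> :: real
  assumes "\<kappa> \<noteq> 0"
  shows "\<exists>C>0. exp_sums_le \<kappa> C"
proof -
  define e where "e = exp (- \<bar>\<kappa>\<bar>)"
  have e: "0 < e" "e < 1" using assms by (auto simp: e_def)
  define S where "S = (\<Sum>n::nat. e ^ n)"
  let ?g = "\<lambda>j::int. e ^ nat \<bar>j\<bar> / e"
  have S: "(\<Sum>n::nat. ennreal (e ^ n)) = ennreal S"
    unfolding S_def using e by (intro suminf_ennreal2) (auto intro: summable_geometric)
  have S0: "S > 0" unfolding S_def using e by (subst suminf_geometric) auto
  have bound: "(\<Sum>\<^sub>\<int>k. ennreal (exp (- \<bar>\<kappa> * k - l\<bar>)))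
      \<le> ennreal (2 * S / e)" for l
  proof -
    \<comment> \<open>Shifting by this integer brings the centre to within one unit of 0; the
      fractional part ignored in \<open>?g\<close> costs one factor \<open>1 / e\<close>.\<close>
    define k0 where "k0 = \<lfloor>l / \<kappa>\<rfloor>"
    have le: "exp (- \<bar>\<kappa> * real_of_int (j + k0) - l\<bar>) \<le> ?g j" for j
    proof -
      define f where "f = l / \<kappa> - real_of_int k0"
      have f: "0 \<le> f" "f < 1" unfolding f_def k0_def by linarith+
      have l: "l = \<kappa> * (f + k0)" using assms by (simp add: f_def)
      have "\<bar>\<kappa> * real_of_int (j + k0) - l\<bar> = \<bar>\<kappa>\<bar> * \<bar>j - f\<bar>"
        unfolding l by (simp add: algebra_simps flip: abs_mult)
      moreover have "\<bar>j - f\<bar> \<ge> real_of_int \<bar>j\<bar> - 1" using f by linarith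
      ultimately have "\<bar>\<kappa> * real_of_int (j + k0) - l\<bar> \<ge> \<bar>\<kappa>\<bar> * (real_of_int \<bar>j\<bar> - 1)"
        by (metis abs_ge_zero mult_left_mono)
      then have "exp (- \<bar>\<kappa> * real_of_int (j + k0) - l\<bar>) \<le> exp (- (\<bar>\<kappa>\<bar> * (real_of_int \<bar>j\<bar> - 1)))"
        by simp
      also have "\<dots> = exp (real (nat \<bar>j\<bar>) * (- \<bar>\<kappa>\<bar>)) / e"
        unfolding e_def exp_diff[symmetric] by (simp add: algebra_simps)
      also have "\<dots> = ?g j"
        unfolding e_def by (subst exp_of_nat_mult) simp
      finally show ?thesis .
    qed
    have nat_sum: "(\<integral>\<^sup>+j. ennreal (?g j) \<partial>count_space (h ` UNIV)) = ennreal (S / e)"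
      if h: "inj h" "\<And>n. nat \<bar>h n\<bar> = n" for h :: "nat \<Rightarrow> int"
    proof -
      have "(\<integral>\<^sup>+j. ennreal (?g j) \<partial>count_space (h ` UNIV))
          = (\<integral>\<^sup>+n. ennreal (e ^ n / e) \<partial>count_space UNIV)"
        using nn_integral_bij_count_space[OF inj_on_imp_bij_betw[OF h(1)], of "\<lambda>j. ennreal (?g j)"] h
        by simp
      also have "\<dots> = (\<Sum>n. ennreal (e ^ n) * ennreal (1 / e))"
        using e by (simp add: nn_integral_count_space_nat flip: ennreal_mult)
      also have "\<dots> = ennreal S * ennreal (1/e)" using S by simp
      finally show ?thesis using e S0 by (simp flip: ennreal_mult)
    qed
    have r1: "(UNIV::int set) = range int \<union> range (\<lambda>n. - int n)"
      by (auto simp: image_iff) (metis int_cases2)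
    have "(\<Sum>\<^sub>\<int>k. ennreal (exp (- \<bar>\<kappa> * k - l\<bar>)))
       = (\<Sum>\<^sub>\<int>j. ennreal (exp (- \<bar>\<kappa> * real_of_int (j + k0) - l\<bar>)))"
      by (rule nn_integral_bij_count_space[symmetric]) (rule bij_betw_byWitness[where f'="\<lambda>k. k - k0"]; auto)
    also have "\<dots> \<le> (\<Sum>\<^sub>\<int>j. ennreal (?g j))"
      by (intro nn_integral_mono ennreal_leI le)
    also have "\<dots> \<le> (\<Sum>\<^sub>\<int>j. ennreal (?g j) * indicator (range int) j
                     + ennreal (?g j) * indicator (range (\<lambda>n. - int n)) j)"
    proof (rule nn_integral_mono)
      fix j :: int
      have "j \<in> range int \<or> j \<in> range (\<lambda>n. - int n)" using r1 by blast
      then show "ennreal (?g j) \<le> ennreal (?g j) * indicator (range int) j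
                     + ennreal (?g j) * indicator (range (\<lambda>n. - int n)) j"
        by (auto split: split_indicator)
    qed
    also have "\<dots> = ennreal (S/e) + ennreal (S/e)"
      using nat_sum[of int] nat_sum[of "\<lambda>n. - int n"]
      by (subst nn_integral_add)
         (auto simp: nn_integral_count_space_indicator inj_def)
    also have "\<dots> = ennreal (2 * S / e)" using e S0 by (simp flip: ennreal_plus)
    finally show ?thesis .
  qed
  then show ?thesis using S0 e by (intro exI[of _ "2*S/e"]) auto
qed

text \<open>Steps bounded below make the sequence unbounded in both directions, so a finite stretch
  of it crosses \<open>x\<close>.\<close>

lemma int_sequence_bracket:
  fixes \<tau> :: "int \<Rightarrow> real"
  assumes A: "0 < A" and step: "\<And>j. \<tau> j + A \<le> \<tau> (j + 1)"
  shows "\<exists>j. \<tau> j \<le> x \<and> x < \<tau> (j + 1)"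
proof -
  have lin: "\<tau> j + real n * A \<le> \<tau> (j + int n)" for j n
  proof (induction n)
    case (Suc n)
    show ?case using Suc step[of "j + int n"] by (simp add: algebra_simps)
  qed simp
  obtain n :: nat where n: "x - \<tau> 0 < real n * A" using A reals_Archimedean3 by blast
  obtain m :: nat where m: "\<tau> 0 - x < real m * A" using A reals_Archimedean3 by blast
  have up: "x < \<tau> (int n)" using lin[of 0 n] n by simp
  have lo: "\<tau> (- int m) \<le> x" using lin[of "- int m" m] m by simp
  have "\<exists>i<n + m. \<tau> (int i - int m) \<le> x \<and> x < \<tau> (int (Suc i) - int m)"
  proof (rule ccontr)
    assume *: "\<not> ?thesis"
    have "i \<le> n + m \<Longrightarrow> \<tau> (int i - int m) \<le> x" for i
      by (induction i) (use lo * in \<open>auto simp: not_less Suc_le_eq\<close>)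
    from this[of "n + m"] up show False by simp
  qed
  then obtain i where "\<tau> (int i - int m) \<le> x" "x < \<tau> (int (Suc i) - int m)" by blast
  then show ?thesis by (intro exI[of _ "int i - int m"]) (simp add: algebra_simps)
qed

text \<open>The subtracted centre is the only value of \<open>ln w\<close> compatible with
  \<open>x = B\<close> and quotient 1. With \<open>Y\<close>, \<open>V\<close>, \<open>M\<close> the
  logarithms of \<open>x / B\<close>, of the quotient, and the distance of \<open>ln w\<close> from
  the centre, one has \<open>V = (p - p') * Y - p' * M\<close>. Since
  \<open>Y \<le> e * V \<le> 0\<close>, a large \<open>M\<close> of either sign must be paid for by
  a very negative \<open>Y\<close>.\<close>

lemma powr_cut_decay:
  fixes p p' e x w u B :: real
  assumes p: "0 < p" "0 < p'" and e: "0 < e" "e * \<bar>p - p'\<bar> \<le> 1/2"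
    and pos: "0 < x" "0 < w" "0 < u" "0 < B"
    and v: "x powr p / (u * (x * w) powr p') \<le> 1"
    and B: "x * (x powr p / (u * (x * w) powr p')) powr (- e) \<le> B"
    and c: "0 < c" "c * \<bar>p - p'\<bar> \<le> p'" "c \<le> e * p' / 2"
  shows "x \<le> B * exp (- c * \<bar>ln w - ((p - p') * ln B - ln u) / p'\<bar>)"
proof -
  define V where "V = p * ln x - ln u - p' * (ln x + ln w)"
  define M where "M = ln w - ((p - p') * ln B - ln u) / p'"
  define Y where "Y = ln x - ln B"
  have lnv: "x powr p / (u * (x * w) powr p') = exp V"
    using pos by (simp add: V_def powr_def ln_mult exp_diff exp_add ring_distribs)
  have V: "V \<le> 0" using v unfolding lnv by simp
  have "x * exp V powr (- e) = exp (ln x - e * V)"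
    using pos by (simp add: powr_def exp_diff exp_minus field_simps)
  then have "exp (ln x - e * V) \<le> exp (ln B)" using B pos unfolding lnv by simp
  then have Y: "Y \<le> e * V" unfolding Y_def by simp
  have rel: "V = (p - p') * Y - p' * M"
    unfolding V_def M_def Y_def using p by (simp add: field_simps)
  have Y0: "Y \<le> 0" using Y V e by (meson mult_nonneg_nonpos order.trans less_imp_le)
  have "Y \<le> - c * \<bar>M\<bar>"
  proof (cases "0 \<le> M")
    case True
    \<comment> \<open>For positive \<open>M\<close> the sign of \<open>V\<close> alone would allow
      \<open>Y = 0\<close>. The negative power of the quotient in \<open>B\<close> supplies the
      decay, and the smallness of \<open>e\<close> lets the term in \<open>p - p'\<close> be
      absorbed into \<open>Y\<close>.\<close>
    have "Y \<le> e * (p - p') * Y - e * p' * M" using Y unfolding rel by (simp add: algebra_simps)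
    moreover have "e * (p - p') * Y \<le> - Y / 2"
    proof -
      have "e * (p - p') * Y \<le> \<bar>e * (p - p') * Y\<bar>" by simp
      also have "\<dots> = (e * \<bar>p - p'\<bar>) * \<bar>Y\<bar>" using e by (simp add: abs_mult)
      also have "\<dots> \<le> 1/2 * \<bar>Y\<bar>" by (intro mult_right_mono e) auto
      finally show ?thesis using Y0 by simp
    qed
    ultimately have "3/2 * Y \<le> - (e * p' * M)" by linarith
    moreover have "c * M \<le> e * p' / 2 * M" by (intro mult_right_mono c True)
    moreover have "0 \<le> e * p' * M" using e p True by simp
    ultimately have "Y \<le> - (c * M)" by (simp add: algebra_simps)
    then show ?thesis using True by simp
  next
    case False
    \<comment> \<open>For negative \<open>M\<close> the inequality \<open>V \<le> 0\<close>
      suffices; it can hold only if \<open>p\<close> exceeds \<open>p'\<close>.\<close>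
    have *: "(p - p') * Y \<le> p' * M" using V rel by simp
    have "p' * M < 0" using False p by (simp add: mult_pos_neg)
    then have "p > p'" using * Y0
      by (smt (verit) mult_nonpos_nonpos)
    have "(p - p') * Y \<le> (p - p') * (c * M)"
    proof -
      have "p' * M \<le> (c * (p - p')) * M"
        using False c(2) \<open>p > p'\<close> by (intro mult_right_mono_neg) auto
      then show ?thesis using * by (simp add: algebra_simps)
    qed
    then have "Y \<le> c * M" using \<open>p > p'\<close> by simp
    then show ?thesis using False by simp
  qed
  then have "exp (ln x) \<le> exp (ln B + - c * \<bar>M\<bar>)" unfolding Y_def exp_le_cancel_iff by linarith
  then show ?thesis using pos unfolding exp_add M_def by simp
qed

section \<open>The discrete power theorem\<close>

text \<open>Regularising \<open>D\<close> to \<open>D' j = inf\<^sub>i D i * max 1 (u j / u i)\<close> keeps the hypothesis and makes the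
  balancing points of the two summands grow geometrically in \<open>j\<close>.\<close>
lemma power_theorem_pointwise:
  fixes G D u :: "int \<Rightarrow> real"
  assumes p: "0 < p0" "0 < p1" and th: "0 < \<theta>" "\<theta> < 1" and a: "0 < a" "1 / a = (1 - \<theta>) / p0 + \<theta> / p1"
    and rho: "1 < R0"
    and G0: "\<And>k. 0 \<le> G k" and D0: "\<And>j. 0 \<le> D j" and u0: "\<And>j. 0 < u j"
    and ul: "\<And>j. R0 * u j \<le> u (j + 1)" and uu: "\<And>j. u (j + 1) \<le> R1 * u j"
    and GD: "\<And>k j. G k \<le> D j powr (1/p0) + exp (\<kappa> * k) * (D j / u j) powr (1/p1)"
  defines "B \<equiv> ln R1 / min p0 p1"
  shows "\<exists>\<tau>::int \<Rightarrow> real. \<forall>k. \<exists>j. (exp (- \<theta> * \<kappa> * k) * G k) powr a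
       \<le> (1 + exp B) powr a * exp B * exp (- \<bar>\<kappa> * k - \<tau> j\<bar>) * (u j powr (- (\<theta> * a / p1)) * D j)" (is "\<exists>\<tau>. \<forall>k. \<exists>j. ?P \<tau> k j")
proof -
  define D' where "D' j = (INF i. D i * max 1 (u j / u i))" for j
  have bdd: "bdd_below (range (\<lambda>i. D i * max 1 (u j / u i)))" for j
    by (rule bdd_belowI2[where m=0]) (use D0 in \<open>auto intro!: mult_nonneg_nonneg\<close>)
  have D'D: "D' j \<le> D j" for j
    unfolding D'_def using cINF_lower[OF bdd, of j j] u0[of j] by simp
  have D'0: "0 \<le> D' j" for j
    unfolding D'_def by (rule cINF_greatest) (use D0 in \<open>auto intro!: mult_nonneg_nonneg\<close>)
  have uinc: "u j \<le> u (j + 1)" for j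
    using ul[of j] u0[of j] rho by (smt (verit) mult_le_cancel_right1)
  have D'inc: "D' j \<le> D' (j + 1)" for j
    unfolding D'_def
  proof (rule cINF_mono)
    fix i :: int
    have "u j / u i \<le> u (j + 1) / u i" using uinc[of j] u0[of i] by (simp add: divide_right_mono)
    then show "\<exists>n\<in>UNIV. D n * max 1 (u j / u n) \<le> D i * max 1 (u (j + 1) / u i)"
      using D0[of i] by (intro bexI[of _ i] mult_left_mono) auto
  qed (use bdd in auto)
  have D'up: "D' (j + 1) \<le> (u (j + 1) / u j) * D' j" for j
  proof -
    have "D' (j + 1) / (u (j + 1) / u j) \<le> D' j"
      unfolding D'_def[of j]
    proof (rule cINF_greatest)
      fix i :: int
      have "D' (j + 1) \<le> D i * max 1 (u (j + 1) / u i)"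
        unfolding D'_def by (rule cINF_lower[OF bdd]) simp
      also have "\<dots> \<le> D i * (u (j + 1) / u j * max 1 (u j / u i))"
      proof (rule mult_left_mono[OF _ D0])
        have "1 \<le> u (j + 1) / u j" using uinc[of j] u0[of j] by simp
        moreover have "u (j + 1) / u j * (u j / u i) = u (j + 1) / u i" using u0[of j] by simp
        ultimately show "max 1 (u (j + 1) / u i) \<le> u (j + 1) / u j * max 1 (u j / u i)"
          by (smt (verit) mult_left_mono mult_cancel_left1)
      qed
      finally show "D' (j + 1) / (u (j + 1) / u j) \<le> D i * max 1 (u j / u i)"
        using u0[of j] u0[of "j+1"] by (simp add: field_simps)
    qed simp
    then show ?thesis using u0[of j] u0[of "j+1"] by (simp add: field_simps)
  qed
  \<comment> \<open>The infimum in \<open>D'\<close> need not be attained. A nearly optimal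
    \<open>i\<close> bounds both summands, because the maximum dominates 1 and
    \<open>u j / u i\<close>; letting \<open>E\<close> decrease to \<open>D' j\<close> gives
    \<open>GD'\<close>.\<close>
  have GE: "G k \<le> E powr (1/p0) + exp (\<kappa> * k) * (E / u j) powr (1/p1)" if E: "D' j < E" for E k j
  proof -
    obtain i where i: "D i * max 1 (u j / u i) < E"
      using E unfolding D'_def by (subst (asm) cINF_less_iff) (use bdd in auto)
    have "D i \<le> D i * max 1 (u j / u i)" using D0[of i] by (simp add: mult_le_cancel_left1)
    then have 1: "D i \<le> E" using i by simp
    have "D i * (u j / u i) \<le> D i * max 1 (u j / u i)" using D0[of i] by (intro mult_left_mono) auto
    with i have "D i * (u j / u i) \<le> E" by linarith
    then have 2: "D i / u i \<le> E / u j" using u0[of i] u0[of j] by (simp add: field_simps)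
    have "G k \<le> D i powr (1/p0) + exp (\<kappa> * k) * (D i / u i) powr (1/p1)" by (rule GD)
    also have "\<dots> \<le> E powr (1/p0) + exp (\<kappa> * k) * (E / u j) powr (1/p1)"
      by (intro add_mono mult_left_mono powr_mono2 1 2) (use p D0[of i] u0[of i] in \<open>auto intro: divide_nonneg_pos\<close>)
    finally show ?thesis .
  qed
  have GD': "G k \<le> D' j powr (1/p0) + exp (\<kappa> * k) * (D' j / u j) powr (1/p1)" for k j
  proof (rule tendsto_lowerbound)
    have "((\<lambda>E. E) \<longlongrightarrow> D' j) (at_right (D' j))" by (rule tendsto_ident_at)
    then show "((\<lambda>E. E powr (1/p0) + exp (\<kappa> * k) * (E / u j) powr (1/p1)) \<longlongrightarrow>
           D' j powr (1/p0) + exp (\<kappa> * k) * (D' j / u j) powr (1/p1)) (at_right (D' j))"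
      using p D'0[of j] u0[of j]
      by (intro tendsto_intros tendsto_powr2 tendsto_divide)
         (auto simp: eventually_at_right_less intro!: eventually_at_rightI[of _ "D' j + 1"] divide_nonneg_pos)
    show "\<forall>\<^sub>F E in at_right (D' j). G k \<le> E powr (1/p0) + exp (\<kappa> * k) * (E / u j) powr (1/p1)"
      by (rule eventually_at_rightI[of _ "D' j + 1"]) (auto intro: GE)
  qed auto
  show ?thesis
  proof (cases "\<exists>j. D' j = 0")
    case True
    then obtain j where "D' j = 0" by blast
    then have "G k = 0" for k using GD'[of k j] G0[of k] by simp
    then show ?thesis using u0 D0 by (auto intro!: mult_nonneg_nonneg)
  next
    case False
    then have Dp: "0 < D' j" for j using D'0[of j] by (metis less_eq_real_def)
    define l where "l j = ln (D' j)" for j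
    define m where "m j = ln (u j)" for j
    \<comment> \<open>The two summands in \<open>GD'\<close> are equal exactly when
      \<open>\<kappa> * k = \<tau> j\<close>.\<close>
    define \<tau> where "\<tau> j = (1/p0 - 1/p1) * l j + m j / p1" for j
    have R1: "0 < R1" using uu[of 0] u0[of 0] u0[of 1] by (smt (verit) mult_nonpos_nonneg)
    have l1: "0 \<le> l (j + 1) - l j" for j unfolding l_def using D'inc[of j] Dp[of j] by simp
    have l2: "l (j + 1) - l j \<le> m (j + 1) - m j" for j
    proof -
      have "ln (D' (j + 1)) \<le> ln ((u (j + 1) / u j) * D' j)" using D'up[of j] Dp[of "j+1"] by simp
      also have "\<dots> = ln (u (j+1)) - ln (u j) + ln (D' j)"
        using u0[of j] u0[of "j+1"] Dp[of j] by (simp add: ln_mult ln_div)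
      finally show ?thesis unfolding l_def m_def by simp
    qed
    have m1: "ln R0 \<le> m (j + 1) - m j" for j
    proof -
      have "ln (R0 * u j) \<le> ln (u (j + 1))" using ul[of j] u0[of j] u0[of "j+1"] rho by (subst ln_le_cancel_iff) auto
      then show ?thesis unfolding m_def using u0[of j] rho by (simp add: ln_mult)
    qed
    have m2: "m (j + 1) - m j \<le> ln R1" for j
    proof -
      have "ln (u (j + 1)) \<le> ln (R1 * u j)" using uu[of j] u0[of j] u0[of "j+1"] R1 by (subst ln_le_cancel_iff) auto
      then show ?thesis unfolding m_def using u0[of j] R1 by (simp add: ln_mult)
    qed
    \<comment> \<open>The regularisation makes both \<open>l\<close> and \<open>m - l\<close>
      nondecreasing, so the increment of \<open>\<tau>\<close> is a combination of nonnegative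
      terms. It lies between \<open>ln R0 / max p0 p1\<close> and
      \<open>ln R1 / min p0 p1\<close>.\<close>
    have step: "\<tau> (j + 1) - \<tau> j = (l (j + 1) - l j) / p0 + ((m (j + 1) - m j) - (l (j + 1) - l j)) / p1" for j
      unfolding \<tau>_def by (simp add: algebra_simps add_divide_distrib diff_divide_distrib)
    have \<tau>1: "\<tau> j + ln R0 / max p0 p1 \<le> \<tau> (j + 1)" for j
    proof -
      have "ln R0 / max p0 p1 \<le> (m (j + 1) - m j) / max p0 p1"
        by (rule divide_right_mono[OF m1]) (use p in auto)
      also have "\<dots> = (l (j + 1) - l j) / max p0 p1 + ((m (j + 1) - m j) - (l (j + 1) - l j)) / max p0 p1"
        by (simp add: diff_divide_distrib)
      also have "\<dots> \<le> (l (j + 1) - l j) / p0 + ((m (j + 1) - m j) - (l (j + 1) - l j)) / p1"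
        by (intro add_mono divide_left_mono) (use l1[of j] l2[of j] p in auto)
      finally show ?thesis using step[of j] by linarith
    qed
    have \<tau>2: "\<tau> (j + 1) \<le> \<tau> j + B" for j
    proof -
      have "(l (j + 1) - l j) / p0 + ((m (j + 1) - m j) - (l (j + 1) - l j)) / p1
         \<le> (l (j + 1) - l j) / min p0 p1 + ((m (j + 1) - m j) - (l (j + 1) - l j)) / min p0 p1"
        by (intro add_mono divide_left_mono) (use l1[of j] l2[of j] p in auto)
      also have "\<dots> = (m (j + 1) - m j) / min p0 p1" by (simp add: diff_divide_distrib)
      also have "\<dots> \<le> B" unfolding B_def by (rule divide_right_mono[OF m2]) (use p in auto)
      finally show ?thesis using step[of j] by linarith
    qed
    have "\<exists>j. ?P \<tau> k j" for k
    proof -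
      have "0 < ln R0 / max p0 p1" using p rho by simp
      from int_sequence_bracket[of _ \<tau> "\<kappa> * k", OF this \<tau>1]
      obtain j where j: "\<tau> j \<le> \<kappa> * k" "\<kappa> * k < \<tau> (j + 1)" by auto
      then have jB: "\<kappa> * k \<le> \<tau> j + B" using \<tau>2[of j] by simp
      have e1: "D' j powr (1/p0) = exp (l j / p0)"
        using Dp[of j] by (simp add: powr_def l_def)
      have e2: "(D' j / u j) powr (1/p1) = exp ((l j - m j) / p1)"
        using Dp[of j] u0[of j] by (simp add: powr_def l_def m_def ln_div)
      have "G k \<le> exp (l j / p0) + exp (\<tau> j + B) * exp ((l j - m j) / p1)"
        using GD'[of k j] jB unfolding e1 e2
        by (smt (verit, best) exp_ge_zero exp_le_cancel_iff mult_right_mono)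
      also have "exp (\<tau> j + B) * exp ((l j - m j) / p1) = exp B * exp (l j / p0)"
        unfolding \<tau>_def mult_exp_exp by (simp add: algebra_simps diff_divide_distrib)
      finally have G: "G k \<le> (1 + exp B) * exp (l j / p0)" by (simp add: algebra_simps)
      have "exp (- \<theta> * \<kappa> * k) \<le> exp (- \<theta> * \<tau> j)"
        using j(1) th by (simp add: mult_left_mono mult.assoc)
      then have "exp (- \<theta> * \<kappa> * k) * G k \<le> exp (- \<theta> * \<tau> j) * ((1 + exp B) * exp (l j / p0))"
        by (intro mult_mono G) (use G0 in auto)
      also have "\<dots> = (1 + exp B) * exp (l j / p0 - \<theta> * \<tau> j)" by (simp add: exp_diff exp_minus field_simps)
      finally have "(exp (- \<theta> * \<kappa> * k) * G k) powr a
         \<le> ((1 + exp B) * exp (l j / p0 - \<theta> * \<tau> j)) powr a"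
        by (intro powr_mono2) (use a G0 in auto)
      also have "\<dots> = (1 + exp B) powr a * exp (a * (l j / p0 - \<theta> * \<tau> j))"
        by (subst powr_mult) (auto simp: powr_def add_pos_pos)
      \<comment> \<open>The formula for \<open>1 / a\<close> makes the exponent of \<open>D'\<close>
        exactly 1. This linearity later allows integration over the base.\<close>
      also have "a * (l j / p0 - \<theta> * \<tau> j) = a * ((1 - \<theta>) / p0 + \<theta> / p1) * l j - \<theta> * a / p1 * m j"
        unfolding \<tau>_def using p by (simp add: field_simps)
      also have "\<dots> = l j - \<theta> * a / p1 * m j" unfolding a(2)[symmetric] using a(1) by simp
      also have "exp (l j - \<theta> * a / p1 * m j) = u j powr (- (\<theta> * a / p1)) * D' j"
        unfolding l_def m_def using Dp[of j] u0[of j] by (simp add: powr_def exp_diff exp_minus field_simps)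
      finally have 1: "(exp (- \<theta> * \<kappa> * k) * G k) powr a
         \<le> (1 + exp B) powr a * (u j powr (- (\<theta> * a / p1)) * D' j)" .
      \<comment> \<open>\<open>\<kappa> * k\<close> lies within \<open>B\<close> of
        \<open>\<tau> j\<close>, so the exponential is bounded below; it is inserted to make the sum
        over all pairs of \<open>k\<close> and \<open>j\<close> converge in
        \<open>k\<close>.\<close>
      have "0 \<le> B + - \<bar>\<kappa> * k - \<tau> j\<bar>" using j jB by simp
      then have 2: "1 \<le> exp B * exp (- \<bar>\<kappa> * k - \<tau> j\<bar>)"
        unfolding mult_exp_exp by simp
      have "(1 + exp B) powr a * (u j powr (- (\<theta> * a / p1)) * D' j)
         \<le> (exp B * exp (- \<bar>\<kappa> * k - \<tau> j\<bar>)) * ((1 + exp B) powr a * (u j powr (- (\<theta> * a / p1)) * D j))"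
        using D'D[of j] D'0[of j] D0[of j]
        by (intro order.trans[OF _ mult_right_mono[OF 2]]) (auto intro!: mult_left_mono)
      with 1 show ?thesis by (intro exI[of _ j]) (simp add: mult_ac)
    qed
    then show ?thesis by blast
  qed
qed

text \<open>\<open>G k\<close> models the K-functional at \<open>exp (\<kappa> * k)\<close>, and
  \<open>D j\<close> that of the powers at \<open>u j\<close>: parts with
  \<open>N0 powr p0 \<le> D j\<close> and \<open>N1 powr p1 \<le> D j / u j\<close> give the last
  hypothesis. A general sequence \<open>u\<close> can be adapted to the function that is
  decomposed.\<close>

abbreviation power_bound :: "real \<Rightarrow> real \<Rightarrow> real \<Rightarrow> real \<Rightarrow> real \<Rightarrow> real \<Rightarrow> real \<Rightarrow> real \<Rightarrow> bool" where
  "power_bound p0 p1 \<theta> a \<kappa> R0 R1 C \<equiv> \<forall>(G::int \<Rightarrow> real) (D::int \<Rightarrow> real) (u::int \<Rightarrow> real). (\<forall>k. 0 \<le> G k) \<longrightarrow> (\<forall>j. 0 \<le> D j) \<longrightarrow> (\<forall>j. 0 < u j) \<longrightarrow>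
     (\<forall>j. R0 * u j \<le> u (j + 1) \<and> u (j + 1) \<le> R1 * u j) \<longrightarrow>
     (\<forall>k j. G k \<le> D j powr (1/p0) + exp (\<kappa> * real_of_int k) * (D j / u j) powr (1/p1)) \<longrightarrow>
     (\<Sum>\<^sub>\<int>k. ennreal ((exp (- \<theta> * \<kappa> * real_of_int k) * G k) powr a))
       \<le> ennreal C * (\<Sum>\<^sub>\<int>j. ennreal (u j powr (- (\<theta> * a / p1)) * D j))"

text \<open>Each \<open>k\<close> is dominated by the term of a single \<open>j\<close>. After
  enlarging to the sum over all \<open>j\<close> and interchanging, the decay in
  \<open>\<kappa> * k - \<tau> j\<close> bounds the sum over \<open>k\<close> uniformly in
  \<open>\<tau> j\<close>.\<close>

lemma power_theorem_discrete:
  fixes p0 p1 \<theta> a \<kappa> R0 R1 :: real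
  assumes p: "0 < p0" "0 < p1" and th: "0 < \<theta>" "\<theta> < 1" and a: "0 < a" "1 / a = (1 - \<theta>) / p0 + \<theta> / p1"
    and rho: "1 < R0" and kap: "\<kappa> \<noteq> 0"
  shows "\<exists>C>0. power_bound p0 p1 \<theta> a \<kappa> R0 R1 C"
proof -
  obtain C1 where C1: "C1 > 0"
    "exp_sums_le (\<kappa>) C1"
    using sum_exp_dist_bounded[OF kap] by blast
  define A where "A = (1 + exp (ln R1 / min p0 p1)) powr a * exp (ln R1 / min p0 p1)"
  have A: "A > 0" unfolding A_def by (auto intro!: mult_pos_pos add_pos_pos simp: powr_gt_zero) (smt (verit) exp_gt_zero)
  show ?thesis
  proof (intro exI[of _ "A * C1"] conjI allI impI)
    show "0 < A * C1" using A C1 by simp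
    fix G D u :: "int \<Rightarrow> real"
    assume H: "\<forall>k. 0 \<le> G k" "\<forall>j. 0 \<le> D j" "\<forall>j. 0 < u j"
      "\<forall>j. R0 * u j \<le> u (j + 1) \<and> u (j + 1) \<le> R1 * u j"
      "\<forall>k j. G k \<le> D j powr (1/p0) + exp (\<kappa> * k) * (D j / u j) powr (1/p1)"
    define W where "W j = u j powr (- (\<theta> * a / p1)) * D j" for j
    have W0: "0 \<le> W j" for j unfolding W_def using H by simp
    obtain \<tau> :: "int \<Rightarrow> real" where \<tau>: "\<And>k. \<exists>j. (exp (- \<theta> * \<kappa> * k) * G k) powr a
       \<le> A * exp (- \<bar>\<kappa> * k - \<tau> j\<bar>) * W j"
      using power_theorem_pointwise[OF p th a rho, of G D u R1 \<kappa>] H unfolding W_def A_def by blast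
    let ?g = "\<lambda>(k::int) (j::int). A * exp (- \<bar>\<kappa> * k - \<tau> j\<bar>) * W j"
    let ?x = "\<lambda>k::int. (exp (- \<theta> * \<kappa> * k) * G k) powr a"
    have "(\<Sum>\<^sub>\<int>k. ennreal (?x k))
      \<le> (\<Sum>\<^sub>\<int>k. (\<Sum>\<^sub>\<int>j. ennreal (?g k j)))"
    proof (rule nn_integral_mono)
      fix k
      obtain j where j: "?x k
       \<le> ?g k j" using \<tau> by blast
      have "ennreal (?x k)
          \<le> ennreal (?g k j)"
        by (rule ennreal_leI[OF j])
      also have "\<dots> \<le> (\<Sum>\<^sub>\<int>j. ennreal (?g k j))"
        by (rule nn_integral_ge_point) simp
      finally show "ennreal (?x k)
          \<le> (\<Sum>\<^sub>\<int>j. ennreal (?g k j))" .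
    qed
    also have "\<dots> = (\<Sum>\<^sub>\<int>j. (\<Sum>\<^sub>\<int>k. ennreal (?g k j)))"
      by (rule nn_integral_count_space_nn_integral) auto
    also have "\<dots> \<le> (\<Sum>\<^sub>\<int>j. ennreal (A * C1) * ennreal (W j))"
    proof (rule nn_integral_mono)
      fix j
      have "(\<Sum>\<^sub>\<int>k. ennreal (?g k j))
         = (\<Sum>\<^sub>\<int>k. ennreal (A * W j) * ennreal (exp (- \<bar>\<kappa> * k - \<tau> j\<bar>)))"
        using A W0[of j] by (simp add: mult_ac flip: ennreal_mult)
      also have "\<dots> = ennreal (A * W j) * (\<Sum>\<^sub>\<int>k. ennreal (exp (- \<bar>\<kappa> * k - \<tau> j\<bar>)))"
        by (rule nn_integral_cmult) simp
      also have "\<dots> \<le> ennreal (A * W j) * ennreal C1" by (intro mult_left_mono C1(2)[rule_format]) simp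
      also have "\<dots> = ennreal (A * C1) * ennreal (W j)"
        using A C1 W0[of j] by (simp add: mult_ac flip: ennreal_mult)
      finally show "(\<Sum>\<^sub>\<int>k. ennreal (?g k j))
         \<le> ennreal (A * C1) * ennreal (W j)" .
    qed
    also have "\<dots> = ennreal (A * C1) * (\<Sum>\<^sub>\<int>j. ennreal (W j))"
      by (rule nn_integral_cmult) simp
    finally show "(\<Sum>\<^sub>\<int>k. ennreal (?x k))
       \<le> ennreal (A * C1) * (\<Sum>\<^sub>\<int>j. ennreal (u j powr (- (\<theta> * a / p1)) * D j))"
      unfolding W_def .
  qed
qed

section \<open>Cells and slabs\<close>

text \<open>The grid is encoded as an equivalence relation rather than as a family of cubes:
  membership is measurable in both points jointly, and no centres have to be chosen.\<close>

definition same_cell :: "real \<Rightarrow> 'a::euclidean_space \<Rightarrow> 'a \<Rightarrow> bool" where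
  "same_cell d x y \<longleftrightarrow> (\<forall>b\<in>Basis. \<lfloor>(x \<bullet> b) / d\<rfloor> = \<lfloor>(y \<bullet> b) / d\<rfloor>)"

definition slab :: "real \<Rightarrow> int \<Rightarrow> real set" where
  "slab r k = {r powr k ..< r powr (real_of_int k + 1)}"

lemma same_cell_refl [simp]: "same_cell d x x"
  by (simp add: same_cell_def)

lemma same_cell_sym: "same_cell d x y \<longleftrightarrow> same_cell d y x"
  by (auto simp: same_cell_def)

lemma same_cell_trans: "same_cell d x y \<Longrightarrow> same_cell d y z \<Longrightarrow> same_cell d x z"
  by (auto simp: same_cell_def)

lemma pred_same_cell [measurable (raw)]:
  fixes f g :: "'b \<Rightarrow> 'a::euclidean_space"
  assumes [measurable]: "f \<in> borel_measurable M" "g \<in> borel_measurable M"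
  shows "Measurable.pred M (\<lambda>x. same_cell d (f x) (g x))"
  unfolding same_cell_def by measurable

lemma dist_same_cell:
  fixes x y :: "'a::euclidean_space"
  assumes "0 < d" "same_cell d x y"
  shows "dist x y < d * DIM('a)"
proof -
  have *: "\<bar>(x - y) \<bullet> b\<bar> < d" if b: "b \<in> Basis" for b
  proof -
    have "\<lfloor>(x \<bullet> b) / d\<rfloor> = \<lfloor>(y \<bullet> b) / d\<rfloor>" using assms b by (simp add: same_cell_def)
    then have "\<bar>(x \<bullet> b) / d - (y \<bullet> b) / d\<bar> < 1" by linarith
    then have "\<bar>((x - y) \<bullet> b) / d\<bar> < 1" by (simp add: inner_diff_left diff_divide_distrib)
    then show ?thesis using assms(1) by (simp add: abs_divide)
  qed
  have "dist x y \<le> (\<Sum>b\<in>Basis. \<bar>(x - y) \<bullet> b\<bar>)" unfolding dist_norm by (rule norm_le_l1)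
  also have "\<dots> < (\<Sum>b\<in>(Basis::'a set). d)" by (rule sum_strict_mono) (use * in auto)
  finally show ?thesis by (simp add: mult.commute)
qed

text \<open>The half-open cube lies between an open and a closed box of the same volume.\<close>

lemma emeasure_same_cell:
  fixes x :: "'a::euclidean_space"
  assumes d: "0 < d"
  shows "emeasure lborel {y. same_cell d x y} = ennreal (d ^ DIM('a))"
proof -
  define lo where "lo = (\<Sum>b\<in>Basis. (d * \<lfloor>(x \<bullet> b) / d\<rfloor>) *\<^sub>R b)"
  define hi where "hi = (\<Sum>b\<in>Basis. (d * \<lfloor>(x \<bullet> b) / d\<rfloor> + d) *\<^sub>R b)"
  have lo: "lo \<bullet> b = d * \<lfloor>(x \<bullet> b) / d\<rfloor>" if "b \<in> Basis" for b
    unfolding lo_def using that by (subst inner_sum_left_Basis) auto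
  have hi: "hi \<bullet> b = d * \<lfloor>(x \<bullet> b) / d\<rfloor> + d" if "b \<in> Basis" for b
    unfolding hi_def using that by (subst inner_sum_left_Basis) auto
  have iff: "\<lfloor>(x \<bullet> b) / d\<rfloor> = \<lfloor>(y \<bullet> b) / d\<rfloor> \<longleftrightarrow> lo \<bullet> b \<le> y \<bullet> b \<and> y \<bullet> b < hi \<bullet> b" if "b \<in> Basis" for b y
  proof -
    have "\<lfloor>(y \<bullet> b) / d\<rfloor> = \<lfloor>(x \<bullet> b) / d\<rfloor> \<longleftrightarrow>
        \<lfloor>(x \<bullet> b) / d\<rfloor> \<le> (y \<bullet> b) / d \<and> (y \<bullet> b) / d < \<lfloor>(x \<bullet> b) / d\<rfloor> + 1"
      by linarith
    then show ?thesis unfolding lo[OF that] hi[OF that] using d by (auto simp: field_simps)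
  qed
  have set: "{y. same_cell d x y} = {y. \<forall>b\<in>Basis. lo \<bullet> b \<le> y \<bullet> b \<and> y \<bullet> b < hi \<bullet> b}"
    using iff by (auto simp: same_cell_def)
  have le: "lo \<bullet> b \<le> hi \<bullet> b" if "b \<in> Basis" for b using lo hi that d by simp
  have pr: "(\<Prod>b\<in>Basis. (hi - lo) \<bullet> b) = d ^ DIM('a)"
  proof -
    have "(\<Prod>b\<in>Basis. (hi - lo) \<bullet> b) = (\<Prod>b\<in>(Basis::'a set). d)"
      by (rule prod.cong) (auto simp: lo hi inner_diff_left)
    then show ?thesis by simp
  qed
  have sets: "{y. same_cell d x y} \<in> sets lborel"
    by (auto simp: same_cell_def)
  have "ennreal (d ^ DIM('a)) = emeasure lborel (box lo hi)"
    using le pr by (simp add: emeasure_lborel_box)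
  also have "\<dots> \<le> emeasure lborel {y. same_cell d x y}"
    by (rule emeasure_mono) (use sets in \<open>auto simp: set mem_box less_imp_le\<close>)
  finally have 1: "ennreal (d ^ DIM('a)) \<le> emeasure lborel {y. same_cell d x y}" .
  have "emeasure lborel {y. same_cell d x y} \<le> emeasure lborel (cbox lo hi)"
    by (rule emeasure_mono) (auto simp: set mem_box less_imp_le)
  also have "\<dots> = ennreal (d ^ DIM('a))" using le pr by (simp add: emeasure_lborel_cbox)
  finally show ?thesis using 1 by (rule antisym)
qed

lemma Vol_eq: "0 \<le> t \<Longrightarrow> Vol (y::'a::euclidean_space) t = ball_vol TYPE('a) * t ^ DIM('a)"
  unfolding Vol_def using content_ball[of t y] by simp

lemma slab_pos: "1 < r \<Longrightarrow> t \<in> slab r k \<Longrightarrow> 0 < t"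
  by (auto simp: slab_def) (smt (verit) powr_gt_zero)

lemma slab_ex1:
  assumes "1 < r" "0 < t"
  shows "\<exists>k. \<forall>j. t \<in> slab r j \<longleftrightarrow> j = k"
proof (intro exI[of _ "\<lfloor>log r t\<rfloor>"] allI)
  fix j
  have "t \<in> slab r j \<longleftrightarrow> real_of_int j \<le> log r t \<and> log r t < real_of_int j + 1"
    using assms by (simp add: slab_def le_log_iff log_less_iff)
  then show "t \<in> slab r j \<longleftrightarrow> j = \<lfloor>log r t\<rfloor>" by linarith
qed

lemma slab_sets [measurable]: "slab r k \<in> sets borel"
  by (simp add: slab_def)

text \<open>With \<open>t = r powr l\<close> and \<open>k \<le> l \<le> k + 1\<close>, the exponents
  \<open>l * e\<close> and \<open>k * e\<close> differ by at most \<open>\<bar>e\<bar>\<close>,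
  whatever the sign of \<open>e\<close>.\<close>

lemma powr_slab_bounds:
  fixes e :: real
  assumes "1 < r" "t \<in> slab r k"
  shows "t powr e \<le> r powr \<bar>e\<bar> * r powr (k * e)"
    and "r powr (- \<bar>e\<bar>) * r powr (k * e) \<le> t powr e"
proof -
  have t: "r powr k \<le> t" "t < r powr (real_of_int k + 1)" "0 < t"
    using assms slab_pos by (auto simp: slab_def)
  define l where "l = log r t"
  have l: "t = r powr l" "real_of_int k \<le> l" "l \<le> real_of_int k + 1"
    using t assms by (auto simp: l_def le_log_iff log_le_iff)
  have "\<bar>l * e - real_of_int k * e\<bar> \<le> \<bar>e\<bar>"
    using l(2,3) unfolding left_diff_distrib[symmetric] abs_mult
    by (simp add: mult_left_le_one_le)
  then have "l * e \<le> \<bar>e\<bar> + real_of_int k * e" "- \<bar>e\<bar> + real_of_int k * e \<le> l * e" by linarith+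
  then show "t powr e \<le> r powr \<bar>e\<bar> * r powr (k * e)"
    "r powr (- \<bar>e\<bar>) * r powr (k * e) \<le> t powr e"
    using assms(1) unfolding l(1) powr_powr powr_add[symmetric] by auto
qed

lemma powr_slab_bounds':
  fixes e :: real
  assumes "1 < r" "t \<in> slab r k"
  shows "r powr (k * e) \<le> r powr \<bar>e\<bar> * t powr e"
proof -
  have "r powr \<bar>e\<bar> * (r powr (- \<bar>e\<bar>) * r powr (k * e)) \<le> r powr \<bar>e\<bar> * t powr e"
    by (intro mult_left_mono powr_slab_bounds(2) assms) simp
  then show ?thesis using assms(1) by (simp flip: powr_add mult.assoc)
qed

lemma nn_integral_slab:
  assumes r: "1 < r"
  shows "(\<integral>\<^sup>+t. indicator (slab r k) t / ennreal t \<partial>lborel) = ennreal (ln r)"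
proof -
  let ?a = "r powr k" and ?b = "r powr (real_of_int k + 1)"
  have ab: "0 < ?a" "?a \<le> ?b" using r by auto
  have "(\<integral>\<^sup>+t. indicator (slab r k) t / ennreal t \<partial>lborel) = (\<integral>\<^sup>+t. ennreal (1 / t) * indicator {?a .. ?b} t \<partial>lborel)"
  proof (rule nn_integral_cong_AE)
    have "AE t in lborel. t \<noteq> ?b" by (rule AE_lborel_singleton)
    then show "AE t in lborel. indicator (slab r k) t / ennreal t = ennreal (1 / t) * indicator {?a .. ?b} t"
    proof (rule AE_mp, intro AE_I2 impI)
      fix t :: real assume "t \<noteq> ?b"
      then show "indicator (slab r k) t / ennreal t = ennreal (1 / t) * indicator {?a .. ?b} t"
        using slab_pos[OF r, of t k] by (auto simp: slab_def divide_ennreal[of 1, simplified] split: split_indicator)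
    qed
  qed
  also have "\<dots> = ennreal (ln ?b - ln ?a)"
    by (rule nn_integral_FTC_Icc) (use ab less_le_trans[OF ab(1)] in \<open>auto intro!: derivative_eq_intros simp: less_imp_le\<close>)
  also have "ln ?b - ln ?a = ln r" using r by (simp add: ln_powr algebra_simps)
  finally show ?thesis .
qed

lemma isum_single:
  assumes "\<And>j. j \<noteq> k \<Longrightarrow> F j = 0"
  shows "(\<Sum>\<^sub>\<int>j. F j) = F k"
proof -
  have "(\<Sum>\<^sub>\<int>j. F j) = (\<Sum>\<^sub>\<int>j. F k * indicator {k} j)"
    by (rule nn_integral_cong) (use assms in \<open>auto split: split_indicator\<close>)
  then show ?thesis by (simp add: nn_integral_cmult_indicator)
qed

lemma measurable_isum [measurable]:
  fixes F :: "int \<Rightarrow> 'a \<Rightarrow> ennreal"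
  assumes [measurable]: "\<And>k. F k \<in> borel_measurable M"
  shows "(\<lambda>x. \<Sum>\<^sub>\<int>k. F k x) \<in> borel_measurable M"
proof -
  have "(\<Sum>\<^sub>\<int>k. F k x) = (\<Sum>n. F (int_decode n) x)" for x
    using nn_integral_bij_count_space[OF bij_int_decode, of "\<lambda>k. F k x"] by (simp add: nn_integral_count_space_nat)
  then show ?thesis by simp
qed

lemma nn_integral_slabs:
  fixes H :: "int \<Rightarrow> 'a::euclidean_space \<Rightarrow> ennreal"
  assumes r: "1 < r" and [measurable]: "\<And>k. H k \<in> borel_measurable borel"
  shows "(\<integral>\<^sup>+z. (\<Sum>\<^sub>\<int>k. indicator (slab r k) (snd z) * H k (fst z) / ennreal (snd z))
       \<partial>lborel2) = ennreal (ln r) * (\<Sum>\<^sub>\<int>k. (\<integral>\<^sup>+x. H k x \<partial>lborel))"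
proof -
  let ?F = "\<lambda>k (z::'a \<times> real). indicator (slab r k) (snd z) * H k (fst z) / ennreal (snd z)"
  have "(\<integral>\<^sup>+z. (\<Sum>\<^sub>\<int>k. ?F k z)
       \<partial>lborel2)
     = (\<Sum>\<^sub>\<int>k. (\<integral>\<^sup>+z. ?F k z
       \<partial>lborel2))"
    by (rule nn_integral_count_space_nn_integral) auto
  also have "\<dots> = (\<Sum>\<^sub>\<int>k. ennreal (ln r) * (\<integral>\<^sup>+x. H k x \<partial>lborel))"
  proof (rule nn_integral_cong)
    fix k
    have "(\<integral>\<^sup>+z. ?F k z \<partial>lborel2)
      = (\<integral>\<^sup>+x. (\<integral>\<^sup>+t. H k x * (indicator (slab r k) t / ennreal t) \<partial>lborel) \<partial>lborel)"
      by (subst lborel.nn_integral_fst[symmetric]) (auto simp: ennreal_times_divide mult.commute)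
    also have "\<dots> = (\<integral>\<^sup>+x. H k x * ennreal (ln r) \<partial>lborel)"
      by (intro nn_integral_cong, subst nn_integral_cmult) (auto simp: nn_integral_slab[OF r])
    also have "\<dots> = ennreal (ln r) * (\<integral>\<^sup>+x. H k x \<partial>lborel)"
      by (subst nn_integral_multc) (auto simp: mult.commute)
    finally show "(\<integral>\<^sup>+z. ?F k z \<partial>lborel2)
      = ennreal (ln r) * (\<integral>\<^sup>+x. H k x \<partial>lborel)" .
  qed
  also have "\<dots> = ennreal (ln r) * (\<Sum>\<^sub>\<int>k. (\<integral>\<^sup>+x. H k x \<partial>lborel))"
    by (rule nn_integral_cmult) simp
  finally show ?thesis .
qed

section \<open>Whitney cells and local means\<close>

text \<open>\<open>r\<close> is the ratio of consecutive scales, and cells of scale \<open>k\<close>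
  have side \<open>d * r powr k\<close>. Smallness of \<open>d\<close> is assumed where cells must
  fit into balls, cones or Whitney regions.\<close>

locale whitney_grid =
  fixes r d q :: real
  assumes r: "1 < r" and d: "0 < d" and q: "0 < q"
begin

definition cyl :: "int \<Rightarrow> 'a::euclidean_space \<Rightarrow> ('a \<times> real) set" where
  "cyl k y = {z. same_cell (d * r powr k) y (fst z) \<and> snd z \<in> slab r k}"

text \<open>With \<open>n\<close> the dimension, the weight \<open>V powr (-s)\<close> to the power
  \<open>q\<close> contributes \<open>n * s * q\<close>; normalising by the volume of a cell, whose
  width and height are of order \<open>r powr k\<close>, contributes \<open>n + 1\<close>. The same
  exponent arises in the area functional from dividing by \<open>V * t\<close>.\<close>

definition wexp :: "'a::euclidean_space itself \<Rightarrow> real \<Rightarrow> real" where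
  "wexp _ s = real DIM('a) * (s * q + 1) + 1"

text \<open>Up to constants the \<open>q\<close>-th power of the mean of \<open>V\<^sup>-\<^sup>s f\<close> over the Whitney cell of scale \<open>k\<close> above \<open>y\<close>.\<close>
definition psi :: "real \<Rightarrow> 'a::euclidean_space hfun \<Rightarrow> int \<Rightarrow> 'a \<Rightarrow> ennreal" where
  "psi s f k y = (\<integral>\<^sup>+z. indicator (cyl k y) z *
      ennreal (r powr (- (k * wexp TYPE('a) s)) * \<bar>f z\<bar> powr q) \<partial>lborel2)"

definition areaq :: "real \<Rightarrow> 'a::euclidean_space hfun \<Rightarrow> 'a \<Rightarrow> ennreal" where
  "areaq s f x = (\<integral>\<^sup>+ z. indicator (cone x) z *
       ennreal (\<bar>Vpow (-s) f z\<bar> powr q / (Vol (fst z) (snd z) * snd z)) \<partial>lborel2)"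

abbreviation tentq :: "real \<Rightarrow> real \<Rightarrow> 'a::euclidean_space hfun \<Rightarrow> ennreal" where
  "tentq p s f \<equiv> \<integral>\<^sup>+x. epow (areaq s f x) (p/q) \<partial>lborel"

definition cellconst :: "int \<Rightarrow> ('a::euclidean_space \<Rightarrow> 'b) \<Rightarrow> bool" where
  "cellconst k F \<longleftrightarrow> (\<forall>x y. same_cell (d * r powr k) x y \<longrightarrow> F x = F y)"

text \<open>The normalisation is the volume of a cell, not of the ball, so that
  \<open>le_lmean\<close> has constant 1; the ratio of the volumes reappears in
  \<open>nn_integral_lmean\<close>, independent of \<open>k\<close>.\<close>

definition lmean :: "real \<Rightarrow> int \<Rightarrow> ('a::euclidean_space \<Rightarrow> ennreal) \<Rightarrow> 'a \<Rightarrow> ennreal" where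
  "lmean R k F x = ennreal (1 / (d * r powr k) ^ DIM('a)) *
      (\<integral>\<^sup>+y. indicator (ball x (R * r powr k)) y * F y \<partial>lborel)"

lemma side_pos: "0 < d * r powr k"
  using d r by simp

lemma indicator_cyl_measurable [measurable]:
  "(\<lambda>(y::'a::euclidean_space, z). indicator (cyl k y) z :: ennreal) \<in> borel_measurable (borel \<Otimes>\<^sub>M borel2)"
proof -
  have "(\<lambda>(y::'a, z). indicator (cyl k y) z :: ennreal) =
     (\<lambda>p. if same_cell (d * r powr k) (fst p) (fst (snd p)) \<and> snd (snd p) \<in> slab r k then 1 else 0)"
    by (auto simp: fun_eq_iff cyl_def)
  then show ?thesis by simp
qed

lemma cyl_sets [measurable]: "cyl k (y::'a::euclidean_space) \<in> sets borel2"
proof -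
  have "Measurable.pred borel2
     (\<lambda>z::'a\<times>real. same_cell (d * r powr k) y (fst z) \<and> snd z \<in> slab r k)"
    by measurable
  then show ?thesis by (simp add: cyl_def pred_def space_pair_measure)
qed

lemma psi_measurable [measurable]:
  fixes f :: "'a::euclidean_space hfun"
  assumes [measurable]: "f \<in> bfun"
  shows "psi s f k \<in> borel_measurable borel"
proof -
  interpret pair_sigma_finite "lborel :: 'a measure" "lborel :: real measure" ..
  show ?thesis
    unfolding psi_def by measurable
qed

lemma cellconst_psi: "cellconst k (psi s f k)"
  unfolding cellconst_def psi_def
proof (intro allI impI)
  fix x y :: 'a assume "same_cell (d * r powr k) x y"
  then have "cyl k x = cyl k y"
    unfolding cyl_def by (metis same_cell_sym same_cell_trans)
  then show "(\<integral>\<^sup>+z. indicator (cyl k x) z * ennreal (r powr - (k * wexp TYPE('a) s) * \<bar>f z\<bar> powr q) \<partial>lborel2)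
    = (\<integral>\<^sup>+z. indicator (cyl k y) z * ennreal (r powr - (k * wexp TYPE('a) s) * \<bar>f z\<bar> powr q) \<partial>lborel2)"
    by simp
qed

text \<open>In \<open>psi\<close> the weight is frozen at the height \<open>r powr k\<close>. A
  change of \<open>s\<close> is therefore an exact factor depending on \<open>k\<close> alone, not a
  two-sided estimate.\<close>

lemma psi_change_weight:
  fixes f :: "'a::euclidean_space hfun"
  assumes [measurable]: "f \<in> bfun"
  shows "psi s f k y = ennreal (r powr (k * (real DIM('a) * (s' - s) * q))) * psi s' f k y"
proof -
  have e: "- (k * wexp TYPE('a) s) =
      k * (real DIM('a) * (s' - s) * q) + - (k * wexp TYPE('a) s')"
    by (simp add: wexp_def algebra_simps)
  have "psi s f k y = (\<integral>\<^sup>+z. ennreal (r powr (k * (real DIM('a) * (s' - s) * q))) *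
     (indicator (cyl k y) z * ennreal (r powr - (k * wexp TYPE('a) s') * \<bar>f z\<bar> powr q)) \<partial>lborel2)"
    unfolding psi_def e powr_add
    by (intro nn_integral_cong) (simp add: ennreal_mult mult_ac)
  also have "\<dots> = ennreal (r powr (k * (real DIM('a) * (s' - s) * q))) * psi s' f k y"
    unfolding psi_def by (rule nn_integral_cmult) measurable
  finally show ?thesis .
qed

lemma same_cell_ball:
  fixes x y y' :: "'a::euclidean_space"
  assumes dn: "d * DIM('a) \<le> 1" and "y \<in> ball x (R * r powr k)"
    and "same_cell (d * r powr k) y y'"
  shows "y' \<in> ball x ((R + 1) * r powr k)"
proof -
  have "dist y y' < d * r powr k * DIM('a)" by (rule dist_same_cell[OF side_pos assms(3)])
  also have "\<dots> = (d * DIM('a)) * r powr k" by simp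
  also have "\<dots> \<le> 1 * r powr k" by (intro mult_right_mono dn) simp
  finally show ?thesis using assms(2) dist_triangle[of x y' y] by (simp add: algebra_simps)
qed

text \<open>The whole cell of \<open>y\<close> lies in the enlarged ball and \<open>F\<close> is
  constant on it. This takes the place of a maximal function and applies equally to every power of a
  cell-constant function.\<close>

lemma le_lmean:
  fixes F :: "'a::euclidean_space \<Rightarrow> ennreal"
  assumes dn: "d * DIM('a) \<le> 1" and F: "cellconst k F" and y: "y \<in> ball x (R * r powr k)"
  shows "F y \<le> lmean (R + 1) k F x"
proof -
  define D where "D = (d * r powr k) ^ DIM('a)"
  let ?S = "{y'. same_cell (d * r powr k) y y'}"
  have D: "0 < D" unfolding D_def by (intro zero_less_power side_pos)
  have [measurable]: "?S \<in> sets borel"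
    by (auto simp: same_cell_def)
  have "F y = ennreal (1 / D) * (ennreal D * F y)"
    using D by (simp flip: ennreal_mult mult.assoc)
  also have "ennreal D * F y = (\<integral>\<^sup>+y'. F y * indicator ?S y' \<partial>lborel)"
    by (subst nn_integral_cmult_indicator) (auto simp: emeasure_same_cell[OF side_pos] D_def mult.commute)
  also have "\<dots> \<le> (\<integral>\<^sup>+y'. indicator (ball x ((R + 1) * r powr k)) y' * F y' \<partial>lborel)"
  proof (rule nn_integral_mono)
    fix y' show "F y * indicator ?S y'
        \<le> indicator (ball x ((R + 1) * r powr k)) y' * F y'"
      using F same_cell_ball[OF dn y, of y'] by (auto simp: cellconst_def split: split_indicator)
  qed
  finally show ?thesis unfolding lmean_def D_def by (simp add: mult_left_mono)
qed

lemma measurable_ball_indicator [measurable]: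
  "(\<lambda>(x::'a::euclidean_space, y). indicator (ball x \<rho>) y :: ennreal) \<in> bfun"
proof -
  have "(\<lambda>(x::'a, y). indicator (ball x \<rho>) y :: ennreal) = (\<lambda>p. if dist (fst p) (snd p) < \<rho> then 1 else 0)"
    by (auto simp: fun_eq_iff split: split_indicator)
  then show ?thesis by simp
qed

lemma lmean_measurable [measurable]:
  fixes F :: "'a::euclidean_space \<Rightarrow> ennreal"
  assumes [measurable]: "F \<in> borel_measurable borel"
  shows "lmean R k F \<in> borel_measurable borel"
  unfolding lmean_def by measurable

lemma emeasure_ball_scale:
  assumes "0 < R"
  shows "emeasure lborel (ball (x::'a::euclidean_space) (R * r powr k))
    = ennreal (ball_vol TYPE('a) * (R / d) ^ DIM('a) * (d * r powr k) ^ DIM('a))"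
  using assms d emeasure_ball[of "R * r powr k" x]
  by (simp add: power_mult_distrib power_divide)

text \<open>Tonelli and the symmetry of the distance. The constant does not depend on
  \<open>k\<close>, so local means of all scales can be summed.\<close>

lemma nn_integral_lmean:
  fixes F :: "'a::euclidean_space \<Rightarrow> ennreal"
  assumes [measurable]: "F \<in> borel_measurable borel" and R: "0 < R"
  shows "(\<integral>\<^sup>+x. lmean R k F x \<partial>lborel) = ennreal (ball_vol TYPE('a) * (R / d) ^ DIM('a)) * (\<integral>\<^sup>+x. F x \<partial>lborel)"
proof -
  define D where "D = (d * r powr k) ^ DIM('a)"
  have D: "0 < D" unfolding D_def by (intro zero_less_power side_pos)
  define B where "B = ball_vol TYPE('a) * (R / d) ^ DIM('a)"
  have B: "0 \<le> B" using R d by (simp add: B_def)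
  have "(\<integral>\<^sup>+x. lmean R k F x \<partial>lborel) = ennreal (1 / D) *
      (\<integral>\<^sup>+x. \<integral>\<^sup>+y. indicator (ball x (R * r powr k)) y * F y \<partial>lborel \<partial>lborel)"
    unfolding lmean_def D_def by (rule nn_integral_cmult) measurable
  also have "(\<integral>\<^sup>+x. \<integral>\<^sup>+y. indicator (ball x (R * r powr k)) y * F y \<partial>lborel \<partial>lborel)
     = (\<integral>\<^sup>+y. \<integral>\<^sup>+x. indicator (ball x (R * r powr k)) y * F y \<partial>lborel \<partial>lborel)"
    by (rule lborel_pair.Fubini'[symmetric]) simp
  also have "\<dots> = (\<integral>\<^sup>+y. ennreal (B * D) * F y \<partial>lborel)"
  proof (rule nn_integral_cong)
    fix y :: 'a
    have "(\<integral>\<^sup>+x. indicator (ball x (R * r powr k)) y * F y \<partial>lborel)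
      = (\<integral>\<^sup>+x. F y * indicator (ball y (R * r powr k)) x \<partial>lborel)"
      by (intro nn_integral_cong) (auto simp: dist_commute split: split_indicator)
    also have "\<dots> = F y * emeasure lborel (ball y (R * r powr k))"
      by (rule nn_integral_cmult_indicator) simp
    finally show "(\<integral>\<^sup>+x. indicator (ball x (R * r powr k)) y * F y \<partial>lborel) = ennreal (B * D) * F y"
      unfolding emeasure_ball_scale[OF R] B_def D_def by (simp add: mult.commute)
  qed
  also have "\<dots> = ennreal (B * D) * (\<integral>\<^sup>+y. F y \<partial>lborel)" by (rule nn_integral_cmult) simp
  finally show ?thesis using D B unfolding B_def[symmetric] by (simp flip: ennreal_mult mult.assoc)
qed

text \<open>Covers the ball by cells without counting them: the points \<open>y\<close> with
  \<open>z\<close> in \<open>cyl k y\<close> form the cell of \<open>fst z\<close>, which has volume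
  \<open>D\<close> and lies in the enlarged ball. After interchanging integrals, \<open>D\<close>
  times the left side is at most the integral of \<open>psi\<close> over that ball.\<close>

lemma cylinder_le:
  fixes f :: "'a::euclidean_space hfun"
  assumes f[measurable]: "f \<in> bfun"
    and dn: "d * DIM('a) \<le> 1" and R: "0 < R"
    and S: "\<And>y. y \<in> ball x ((R + 1) * r powr k) \<Longrightarrow> psi s f k y \<le> S"
  shows "(\<integral>\<^sup>+z. indicator (ball x (R * r powr k) \<times> slab r k) z *
      ennreal (r powr (- (k * wexp TYPE('a) s)) * \<bar>f z\<bar> powr q) \<partial>lborel2)
    \<le> ennreal (ball_vol TYPE('a) * ((R + 1) / d) ^ DIM('a)) * S"
proof -
  define D where "D = (d * r powr k) ^ DIM('a)"
  have D: "0 < D" unfolding D_def by (intro zero_less_power side_pos)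
  define B where "B = ball_vol TYPE('a) * ((R + 1) / d) ^ DIM('a)"
  have B: "0 \<le> B" using R d by (simp add: B_def)
  define w where "w z = ennreal (r powr (- (k * wexp TYPE('a) s)) * \<bar>f z\<bar> powr q)" for z
  have w[measurable]: "w \<in> bfun" unfolding w_def by measurable
  interpret L: pair_sigma_finite "lborel :: 'a measure" "lborel :: real measure" ..
  interpret P: pair_sigma_finite "lborel :: 'a measure" "lborel2 :: ('a \<times> real) measure" ..
  let ?B = "ball x ((R + 1) * r powr k)"
  let ?A = "ball x (R * r powr k) \<times> slab r k"
  have "ennreal D * (\<integral>\<^sup>+z. indicator (?A) z * w z \<partial>lborel2)
     = (\<integral>\<^sup>+z. ennreal D * (indicator (?A) z * w z) \<partial>lborel2)"
    by (rule nn_integral_cmult[symmetric]) measurable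
  also have "\<dots> \<le> (\<integral>\<^sup>+z. (\<integral>\<^sup>+y. indicator ?B y * (indicator (cyl k y) z * w z) \<partial>lborel) \<partial>lborel2)"
  proof (rule nn_integral_mono)
    fix z :: "'a \<times> real"
    show "ennreal D * (indicator (?A) z * w z)
        \<le> (\<integral>\<^sup>+y. indicator ?B y * (indicator (cyl k y) z * w z) \<partial>lborel)"
    proof (cases "z \<in> ?A")
      case True
      have [measurable]: "{y'. same_cell (d * r powr k) (fst z) y'} \<in> sets borel"
        by (auto simp: same_cell_def)
      have "ennreal D * (indicator (?A) z * w z)
         = (\<integral>\<^sup>+y. w z * indicator {y'. same_cell (d * r powr k) (fst z) y'} y \<partial>lborel)"
        using True by (subst nn_integral_cmult_indicator) (auto simp: emeasure_same_cell[OF side_pos] D_def mult.commute)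
      also have "\<dots> \<le> (\<integral>\<^sup>+y. indicator ?B y * (indicator (cyl k y) z * w z) \<partial>lborel)"
        using True same_cell_ball[OF dn, of "fst z" x R k]
        by (intro nn_integral_mono) (auto simp: cyl_def same_cell_sym split: split_indicator)
      finally show ?thesis .
    qed simp
  qed
  also have "\<dots> = (\<integral>\<^sup>+y. (\<integral>\<^sup>+z. indicator ?B y * (indicator (cyl k y) z * w z) \<partial>lborel2) \<partial>lborel)"
    by (rule P.Fubini') measurable
  also have "\<dots> = (\<integral>\<^sup>+y. indicator ?B y * psi s f k y \<partial>lborel)"
    unfolding psi_def w_def[symmetric] by (intro nn_integral_cong nn_integral_cmult) measurable
  also have "\<dots> \<le> (\<integral>\<^sup>+y. S * indicator ?B y \<partial>lborel)"
    by (intro nn_integral_mono) (auto simp: S split: split_indicator)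
  also have "\<dots> = ennreal D * (ennreal B * S)"
  proof -
    have "emeasure lborel ?B = ennreal (B * D)"
      using R emeasure_ball_scale[of "R + 1" x k] by (simp add: B_def D_def)
    then show ?thesis using B D by (simp add: nn_integral_cmult_indicator ennreal_mult mult_ac)
  qed
  finally show ?thesis using D unfolding w_def B_def[symmetric] by (simp add: ennreal_mult_le_mult_iff)
qed

end

section \<open>Area functionals and cell means\<close>

lemma nn_integral_split_slabs:
  fixes F :: "'a::euclidean_space \<times> real \<Rightarrow> ennreal"
  assumes r: "1 < r" and [measurable]: "F \<in> bfun"
    and F0: "\<And>z. snd z \<le> 0 \<Longrightarrow> F z = 0"
  shows "(\<integral>\<^sup>+z. F z \<partial>lborel2) =
     (\<Sum>\<^sub>\<int>k. (\<integral>\<^sup>+z. indicator (slab r k) (snd z) * F z \<partial>lborel2))"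
proof -
  have "(\<integral>\<^sup>+z. F z \<partial>lborel2) =
     (\<integral>\<^sup>+z. (\<Sum>\<^sub>\<int>k. indicator (slab r k) (snd z) * F z) \<partial>lborel2)"
  proof (rule nn_integral_cong)
    fix z :: "'a \<times> real"
    show "F z = (\<Sum>\<^sub>\<int>k. indicator (slab r k) (snd z) * F z)"
    proof (cases "0 < snd z")
      case True
      from slab_ex1[OF r this] obtain k where k: "\<And>j. snd z \<in> slab r j \<longleftrightarrow> j = k" by blast
      show ?thesis by (subst isum_single[of k]) (use k in \<open>auto simp: indicator_def\<close>)
    next
      case False
      then show ?thesis using F0[of z] by simp
    qed
  qed
  also have "\<dots> = (\<Sum>\<^sub>\<int>k. (\<integral>\<^sup>+z. indicator (slab r k) (snd z) * F z \<partial>lborel2))"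
    by (rule nn_integral_count_space_nn_integral) auto
  finally show ?thesis .
qed

lemma Vol_powr:
  assumes "0 < t"
  shows "Vol (y::'a::euclidean_space) t powr e = ball_vol TYPE('a) powr e * t powr (real DIM('a) * e)"
proof -
  have "t ^ DIM('a) = t powr real DIM('a)" using assms by (simp add: powr_realpow)
  then show ?thesis using assms by (simp add: Vol_eq powr_mult powr_powr)
qed

lemma Vpow_powr:
  assumes "0 < t"
  shows "\<bar>Vpow (-s) f (y::'a::euclidean_space, t)\<bar> powr q =
    ball_vol TYPE('a) powr (- (s * q)) * t powr (- (real DIM('a) * (s * q))) * \<bar>f (y, t)\<bar> powr q"
proof -
  have "\<bar>Vpow (-s) f (y, t)\<bar> = Vol y t powr (-s) * \<bar>f (y, t)\<bar>"
    by (simp add: Vpow_def abs_mult)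
  then have "\<bar>Vpow (-s) f (y, t)\<bar> powr q = Vol y t powr (- (s * q)) * \<bar>f (y, t)\<bar> powr q"
    by (simp add: powr_mult powr_powr)
  then show ?thesis unfolding Vol_powr[OF assms] by simp
qed

lemma Vpow_area:
  assumes "0 < t"
  shows "\<bar>Vpow (-s) f (y::'a::euclidean_space, t)\<bar> powr q / (Vol y t * t) =
    ball_vol TYPE('a) powr (- (s * q + 1)) * t powr (- (real DIM('a) * (s * q + 1) + 1)) * \<bar>f (y, t)\<bar> powr q"
proof -
  have V: "Vol y t * t = ball_vol TYPE('a) * t powr (real DIM('a) + 1)"
    using assms by (simp add: Vol_eq powr_add powr_realpow)
  have "t powr (- (real DIM('a) * (s * q))) / t powr (real DIM('a) + 1) = t powr (- (real DIM('a) * (s * q + 1) + 1))"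
  proof -
    have "- (real DIM('a) * (s * q)) - (real DIM('a) + 1) = - (real DIM('a) * (s * q + 1) + 1)"
      by (simp add: algebra_simps)
    then show ?thesis by (metis powr_diff)
  qed
  moreover have "ball_vol TYPE('a) powr (- (s * q)) / ball_vol TYPE('a)
      = ball_vol TYPE('a) powr (- (s * q + 1))"
  proof -
    have "- (s * q) - 1 = - (s * q + 1)" by simp
    then show ?thesis
      using powr_diff[of "ball_vol TYPE('a)" "- (s * q)" 1] unit_ball_vol_nonneg[of "real DIM('a)"]
      by (metis of_nat_0_le_iff powr_one)
  qed
  ultimately show ?thesis unfolding V Vpow_powr[OF assms]
    by (metis (no_types, lifting) times_divide_eq_left times_divide_times_eq)
qed

context whitney_grid
begin

lemma unit_ball_vol_gt0 [simp]: "0 < unit_ball_vol (real DIM('a::euclidean_space))"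
  by (rule unit_ball_vol_pos) simp

lemma unit_ball_vol_neq0 [simp]: "ball_vol TYPE('a::euclidean_space) \<noteq> 0"
  using unit_ball_vol_gt0[where 'a='a] by linarith

lemma area_integrand:
  "indicator (cone x) z * ennreal (\<bar>Vpow (-s) f z\<bar> powr q / (Vol (fst z) (snd z) * snd z))
   = indicator (cone x) z * ennreal (ball_vol TYPE('a) powr (- (s * q + 1)) *
       snd z powr (- wexp TYPE('a) s) * \<bar>f (z::'a::euclidean_space \<times> real)\<bar> powr q)"
proof (cases "z \<in> cone x")
  case True
  then have "0 < snd z" using zero_le_dist[of x "fst z"] by (auto simp: cone_def simp del: zero_le_dist)
  then show ?thesis using Vpow_area[of "snd z" s f "fst z"] by (simp add: wexp_def)
qed simp

lemma cone_measurable [measurable]: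
  "(\<lambda>(x::'a::euclidean_space, z). indicator (cone x) z :: ennreal) \<in> borel_measurable (borel \<Otimes>\<^sub>M borel2)"
proof -
  have "(\<lambda>(x::'a, z). indicator (cone x) z :: ennreal) = (\<lambda>p. if dist (fst p) (fst (snd p)) < snd (snd p) then 1 else 0)"
    by (auto simp: fun_eq_iff cone_def split: split_indicator)
  then show ?thesis by simp
qed

lemma areaq_eq: "areaq s f x = (\<integral>\<^sup>+ z. indicator (cone x) z * ennreal (ball_vol TYPE('a) powr (- (s * q + 1)) *
       snd z powr (- wexp TYPE('a) s) * \<bar>f (z::'a::euclidean_space \<times> real)\<bar> powr q) \<partial>lborel2)"
  unfolding areaq_def area_integrand ..

lemma areaq_measurable [measurable]:
  fixes f :: "'a::euclidean_space hfun"
  assumes [measurable]: "f \<in> bfun"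
  shows "areaq s f \<in> borel_measurable borel"
proof -
  interpret pair_sigma_finite "lborel :: 'a measure" "lborel :: real measure" ..
  show ?thesis unfolding areaq_eq by measurable
qed

lemma Aq_areaq: "Aq q (Vpow (-s) f) x = epow (areaq s f x) (1/q)"
  by (simp add: Aq_def areaq_def)

text \<open>The cell of scale \<open>k\<close> above \<open>x\<close> lies in the cone at
  \<open>x\<close>: its base stays within \<open>r powr k\<close> of \<open>x\<close>, and that is
  the lowest height in the slab. The constant is independent of \<open>k\<close>, so one area
  functional dominates all scales.\<close>

lemma psi_le_areaq:
  fixes f :: "'a::euclidean_space hfun"
  assumes f[measurable]: "f \<in> bfun" and dn: "d * DIM('a) \<le> 1"
  shows "psi s f k x \<le> ennreal (r powr \<bar>wexp TYPE('a) s\<bar> * ball_vol TYPE('a) powr (s * q + 1)) * areaq s f x"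
proof -
  let ?w = "wexp TYPE('a) s" and ?v = "ball_vol TYPE('a)"
  let ?C = "r powr \<bar>?w\<bar> * ?v powr (s * q + 1)"
  let ?F = "\<lambda>z::'a \<times> real. indicator (cone x) z * ennreal (?v powr (- (s * q + 1)) * snd z powr (- ?w) * \<bar>f z\<bar> powr q)"
  have "psi s f k x \<le> (\<integral>\<^sup>+ z. ennreal ?C * (?F z) \<partial>lborel2)"
    unfolding psi_def
  proof (rule nn_integral_mono)
    fix z :: "'a \<times> real"
    show "indicator (cyl k x) z * ennreal (r powr - (k * ?w) * \<bar>f z\<bar> powr q)
      \<le> ennreal ?C * (?F z)"
    proof (cases "z \<in> cyl k x")
      case True
      then have z: "same_cell (d * r powr k) x (fst z)" "snd z \<in> slab r k" by (auto simp: cyl_def)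
      have "fst z \<in> ball x ((0 + 1) * r powr k) \<or> fst z = x"
        using dist_same_cell[OF side_pos z(1)] mult_right_mono[OF dn, of "r powr k"]
        by (simp add: mult_ac)
      then have "dist x (fst z) < snd z" using z(2) slab_pos[OF r z(2)] by (auto simp: slab_def)
      then have cone: "z \<in> cone x" by (auto simp: cone_def)
      have "r powr (- (k * ?w)) \<le> r powr \<bar>?w\<bar> * snd z powr (- ?w)"
        using powr_slab_bounds(2)[OF r z(2), of "- ?w"] r by (simp add: powr_minus field_simps)
      then have "r powr (- (k * ?w)) * \<bar>f z\<bar> powr q \<le> (r powr \<bar>?w\<bar> * snd z powr (- ?w)) * \<bar>f z\<bar> powr q"
        by (rule mult_right_mono) simp
      also have "\<dots> = ?C * (?v powr (- (s * q + 1)) * snd z powr (- ?w) * \<bar>f z\<bar> powr q)"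
      proof -
        have "?v powr (s * q + 1) * ?v powr (- (s * q + 1)) = 1"
          unfolding powr_add[symmetric] by simp
        then show ?thesis by (simp add: mult_ac)
      qed
      finally show ?thesis using True cone by (simp add: ennreal_leI flip: ennreal_mult)
    qed simp
  qed
  also have "\<dots> = ennreal ?C * areaq s f x"
    unfolding areaq_eq by (rule nn_integral_cmult) measurable
  finally show ?thesis .
qed

text \<open>Inside slab \<open>k\<close> the cone stays over a ball of radius
  \<open>r * r powr k\<close>, where \<open>cylinder_le\<close> applies. The full sum over scales
  remains; it becomes comparable to a supremum only after decay in \<open>k\<close> has been
  arranged.\<close>

lemma areaq_le_sum:
  fixes f :: "'a::euclidean_space hfun"
  assumes f[measurable]: "f \<in> bfun" and dn: "d * DIM('a) \<le> 1"
    and S: "\<And>k y. y \<in> ball x ((r + 1) * r powr k) \<Longrightarrow> psi s f k y \<le> S k"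
  shows "areaq s f x \<le> ennreal (r powr \<bar>wexp TYPE('a) s\<bar> * ball_vol TYPE('a) powr (- (s * q + 1)) *
     (ball_vol TYPE('a) * ((r + 1) / d) ^ DIM('a))) * (\<Sum>\<^sub>\<int>k. S k)"
proof -
  let ?w = "wexp TYPE('a) s" and ?v = "ball_vol TYPE('a)"
  let ?C = "r powr \<bar>?w\<bar> * ?v powr (- (s * q + 1))"
  let ?D = "?v * ((r + 1) / d) ^ DIM('a)"
  let ?F = "\<lambda>z::'a \<times> real. indicator (cone x) z * ennreal (?v powr (- (s * q + 1)) * snd z powr (- ?w) * \<bar>f z\<bar> powr q)"
  have "areaq s f x = (\<Sum>\<^sub>\<int>k. (\<integral>\<^sup>+z. indicator (slab r k) (snd z) * (?F z) \<partial>lborel2))"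
    unfolding areaq_eq
  proof (rule nn_integral_split_slabs[OF r])
    fix z :: "'a \<times> real" assume "snd z \<le> 0"
    then have "z \<notin> cone x" using zero_le_dist[of x "fst z"] by (auto simp: cone_def simp del: zero_le_dist)
    then show "?F z = 0" by simp
  qed measurable
  also have "\<dots> \<le> (\<Sum>\<^sub>\<int>k. ennreal (?C * ?D) * S k)"
  proof (rule nn_integral_mono)
    fix k
    have "(\<integral>\<^sup>+z. indicator (slab r k) (snd z) * (?F z) \<partial>lborel2)
      \<le> (\<integral>\<^sup>+z. ennreal ?C * (indicator (ball x (r * r powr k) \<times> slab r k) z *
          ennreal (r powr (- (k * ?w)) * \<bar>f z\<bar> powr q)) \<partial>lborel2)"
    proof (rule nn_integral_mono)
      fix z :: "'a \<times> real"
      show "indicator (slab r k) (snd z) * (?F z) \<le> ennreal ?C * (indicator (ball x (r * r powr k) \<times> slab r k) z *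
          ennreal (r powr (- (k * ?w)) * \<bar>f z\<bar> powr q))"
      proof (cases "snd z \<in> slab r k \<and> z \<in> cone x")
        case True
        then have "dist x (fst z) < r * r powr k"
          using r by (auto simp: cone_def slab_def powr_add mult.commute[of r])
        then have mem: "z \<in> ball x (r * r powr k) \<times> slab r k" using True by (cases z) auto
        have "snd z powr (- ?w) \<le> r powr \<bar>?w\<bar> * r powr (- (k * ?w))"
          using powr_slab_bounds(1)[OF r, of "snd z" k "- ?w"] True by simp
        then have "?v powr (- (s * q + 1)) * snd z powr (- ?w) * \<bar>f z\<bar> powr q
            \<le> ?v powr (- (s * q + 1)) * (r powr \<bar>?w\<bar> * r powr (- (k * ?w))) * \<bar>f z\<bar> powr q"
          by (intro mult_right_mono mult_left_mono) auto
        then show ?thesis using True mem by (simp add: ennreal_leI mult_ac flip: ennreal_mult)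
      qed auto
    qed
    also have "\<dots> = ennreal ?C * (\<integral>\<^sup>+z. indicator (ball x (r * r powr k) \<times> slab r k) z *
          ennreal (r powr (- (k * ?w)) * \<bar>f z\<bar> powr q) \<partial>lborel2)"
      by (rule nn_integral_cmult) measurable
    also have "\<dots> \<le> ennreal ?C * (ennreal ?D * S k)"
      by (intro mult_left_mono cylinder_le[OF f dn] S) (use r in auto)
    also have "\<dots> = ennreal (?C * ?D) * S k"
      using r d by (simp add: ennreal_mult mult.assoc)
    finally show "(\<integral>\<^sup>+z. indicator (slab r k) (snd z) * (?F z) \<partial>lborel2) \<le> ennreal (?C * ?D) * S k" .
  qed
  also have "\<dots> = ennreal (?C * ?D) * (\<Sum>\<^sub>\<int>k. S k)"
    by (rule nn_integral_cmult) simp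
  finally show ?thesis .
qed

end

section \<open>Whitney averages and cell means\<close>

context whitney_grid
begin

definition wavg :: "real \<Rightarrow> real \<Rightarrow> 'a::euclidean_space hfun \<Rightarrow> 'a \<Rightarrow> real \<Rightarrow> ennreal" where
  "wavg c0 s f x t = (\<integral>\<^sup>+ z. indicator (whitney c0 r x t) z * ennreal (\<bar>Vpow (-s) f z\<bar> powr q) \<partial>lborel2)
        / emeasure lborel2 (whitney c0 r x t)"

text \<open>Volume of the Whitney region at height 1.\<close>

definition wvol :: "'a::euclidean_space itself \<Rightarrow> real \<Rightarrow> real" where
  "wvol _ c0 = ball_vol TYPE('a) * c0 ^ DIM('a) * (r - 1 / r)"

lemma Wq_wavg: "Wq c0 r q (Vpow (-s) f) (x, t) = epow (wavg c0 s f x t) (1/q)"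
  by (simp add: Wq_def wavg_def)

lemma wvol_pos: "0 < c0 \<Longrightarrow> 0 < wvol TYPE('a::euclidean_space) c0"
proof -
  assume "0 < c0"
  moreover have "1 / r < r" using r by (simp add: field_simps) (smt (verit) mult_less_cancel_left2)
  ultimately show ?thesis unfolding wvol_def by (intro mult_pos_pos) auto
qed

lemma whitney_sets [measurable]: "whitney c0 r (x::'a::euclidean_space) t \<in> sets borel2"
  unfolding whitney_def by measurable

lemma emeasure_whitney:
  assumes c0: "0 < c0" and t: "0 < t"
  shows "emeasure lborel2 (whitney c0 r (x::'a::euclidean_space) t) =
     ennreal (wvol TYPE('a) c0 * t powr (real DIM('a) + 1))"
proof -
  have "t / r \<le> r * t"
  proof -
    have "t * 1 \<le> t * (r * r)" using r t by (intro mult_left_mono) (auto simp: less_1_mult less_imp_le)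
    then show ?thesis using r by (simp add: field_simps)
  qed
  then have "emeasure lborel2 (whitney c0 r x t) =
      ennreal (ball_vol TYPE('a) * (c0 * t) ^ DIM('a)) * ennreal (r * t - t / r)"
    unfolding whitney_def using c0 t
    by (subst lborel.emeasure_pair_measure_Times) (auto simp: emeasure_ball)
  also have "\<dots> = ennreal (ball_vol TYPE('a) * (c0 * t) ^ DIM('a) * (r * t - t / r))"
    using c0 t by (subst ennreal_mult') auto
  also have "ball_vol TYPE('a) * (c0 * t) ^ DIM('a) * (r * t - t / r) =
      wvol TYPE('a) c0 * t powr (real DIM('a) + 1)"
    using t r by (simp add: wvol_def powr_add powr_realpow power_mult_distrib field_simps)
  finally show ?thesis .
qed

lemma wavg_eq:
  fixes f :: "'a::euclidean_space hfun"
  assumes c0: "0 < c0" and t: "0 < t" and f[measurable]: "f \<in> bfun"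
  shows "wavg c0 s f x t = (\<integral>\<^sup>+ z. indicator (whitney c0 r x t) z *
     ennreal ((ball_vol TYPE('a) powr (- (s * q)) / wvol TYPE('a) c0) * t powr (- (real DIM('a) + 1)) *
        snd z powr (- (real DIM('a) * (s * q))) * \<bar>f z\<bar> powr q) \<partial>lborel2)"
proof -
  let ?v = "ball_vol TYPE('a)" and ?W = "wvol TYPE('a) c0"
  let ?e = "?W * t powr (real DIM('a) + 1)"
  have e: "0 < ?e" using wvol_pos[OF c0, where 'a='a] t by simp
  let ?F = "\<lambda>z::'a \<times> real. ?v powr (- (s * q)) * snd z powr (- (real DIM('a) * (s * q))) * \<bar>f z\<bar> powr q"
  have "(\<integral>\<^sup>+ z. indicator (whitney c0 r x t) z * ennreal (\<bar>Vpow (-s) f z\<bar> powr q) \<partial>lborel2)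
    = (\<integral>\<^sup>+ z. indicator (whitney c0 r x t) z * ennreal (?F z) \<partial>lborel2)"
  proof (rule nn_integral_cong)
    fix z :: "'a \<times> real"
    show "indicator (whitney c0 r x t) z * ennreal (\<bar>Vpow (-s) f z\<bar> powr q) =
      indicator (whitney c0 r x t) z * ennreal (?F z)"
    proof (cases "z \<in> whitney c0 r x t")
      case True
      then have "t / r < snd z" by (auto simp: whitney_def)
      moreover have "0 < t / r" using t r by simp
      ultimately have "0 < snd z" by linarith
      then show ?thesis using Vpow_powr[of "snd z" s f "fst z"] by simp
    qed simp
  qed
  then have "wavg c0 s f x t = ennreal (1 / ?e) * (\<integral>\<^sup>+ z. indicator (whitney c0 r x t) z * ennreal (?F z) \<partial>lborel2)"
    unfolding wavg_def emeasure_whitney[OF c0 t] using e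
    by (simp add: divide_ennreal_def inverse_ennreal inverse_eq_divide mult.commute)
  also have "\<dots> = (\<integral>\<^sup>+ z. ennreal (1 / ?e) * (indicator (whitney c0 r x t) z * ennreal (?F z)) \<partial>lborel2)"
    by (rule nn_integral_cmult[symmetric]) measurable
  also have "\<dots> = (\<integral>\<^sup>+ z. indicator (whitney c0 r x t) z *
     ennreal ((?v powr (- (s * q)) / ?W) * t powr (- (real DIM('a) + 1)) *
        snd z powr (- (real DIM('a) * (s * q))) * \<bar>f z\<bar> powr q) \<partial>lborel2)"
  proof (rule nn_integral_cong)
    fix z :: "'a \<times> real"
    have "1 / ?e * (?F z)
      = (?v powr (- (s * q)) / ?W) * t powr (- (real DIM('a) + 1)) * snd z powr (- (real DIM('a) * (s * q))) * \<bar>f z\<bar> powr q"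
      unfolding powr_minus[of t] by (simp add: field_simps)
    then show "ennreal (1 / ?e) * (indicator (whitney c0 r x t) z * ennreal (?F z)) = indicator (whitney c0 r x t) z *
     ennreal ((?v powr (- (s * q)) / ?W) * t powr (- (real DIM('a) + 1)) *
        snd z powr (- (real DIM('a) * (s * q))) * \<bar>f z\<bar> powr q)"
      using e by (simp add: ennreal_mult[symmetric] less_imp_le split: split_indicator del: divide_eq_eq)
  qed
  finally show ?thesis .
qed

text \<open>Two heights in one half-open slab have ratio below \<open>r\<close>, and points of one
  cell are closer than \<open>c0 * r powr k\<close>. Because the scale ratio is also the ratio of
  the Whitney region, the cell of scale \<open>k\<close> above \<open>x\<close> lies in the region
  of every \<open>(x, t)\<close> with \<open>t\<close> in slab \<open>k\<close>.\<close>

lemma psi_le_wavg: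
  assumes c0: "0 < c0" and dn: "d * DIM('a::euclidean_space) \<le> c0"
  shows "\<exists>C>0. \<forall>f::'a hfun. f \<in> bfun \<longrightarrow>
    (\<forall>k x t. t \<in> slab r k \<longrightarrow> psi s f k x \<le> ennreal C * wavg c0 s f x t)"
proof -
  let ?N = "real DIM('a)"
  let ?w = "wexp TYPE('a) s"
  let ?e1 = "?N * (s * q)" and ?e2 = "?N + 1"
  let ?A = "unit_ball_vol ?N powr (- (s * q)) / wvol TYPE('a) c0"
  have A: "0 < ?A" using wvol_pos[OF c0, where 'a='a] by simp
  define C where "C = r powr \<bar>?e1\<bar> * r powr \<bar>?e2\<bar> / ?A"
  have C: "0 < C" unfolding C_def by (intro mult_pos_pos divide_pos_pos A) (use r in auto)
  have "psi s f k x \<le> ennreal C * wavg c0 s f x t" if f[measurable]: "f \<in> bfun" and t: "t \<in> slab r k"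
    for f :: "'a hfun" and k x t
  proof -
    have t0: "0 < t" by (rule slab_pos[OF r t])
    let ?F = "\<lambda>z::'a \<times> real. ?A * t powr (- ?e2) * snd z powr (- ?e1) * \<bar>f z\<bar> powr q"
    have "psi s f k x \<le> (\<integral>\<^sup>+ z. ennreal C * (indicator (whitney c0 r x t) z *
       ennreal (?F z)) \<partial>lborel2)"
      unfolding psi_def
    proof (rule nn_integral_mono)
      fix z :: "'a \<times> real"
      show "indicator (cyl k x) z * ennreal (r powr - (k * ?w) * \<bar>f z\<bar> powr q)
        \<le> ennreal C * (indicator (whitney c0 r x t) z * ennreal (?F z))"
      proof (cases "z \<in> cyl k x")
        case True
        then have z: "same_cell (d * r powr k) x (fst z)" "snd z \<in> slab r k" by (auto simp: cyl_def)
        have "dist x (fst z) < (d * DIM('a)) * r powr k"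
          using dist_same_cell[OF side_pos z(1)] by (simp add: mult_ac)
        also have "\<dots> \<le> c0 * r powr k" by (intro mult_right_mono dn) simp
        also have "\<dots> \<le> c0 * t" using c0 t by (auto simp: slab_def)
        finally have 1: "dist x (fst z) < c0 * t" .
        have "t < r * r powr k" using t r by (simp add: slab_def powr_add mult.commute)
        moreover have "r powr k \<le> snd z" using z by (simp add: slab_def)
        ultimately have "t < r * snd z" using r by (smt (verit) mult_left_mono)
        then have 2: "t / r < snd z" using r by (simp add: field_simps)
        have "snd z < r * r powr k" using z r by (simp add: slab_def powr_add mult.commute)
        moreover have "r powr k \<le> t" using t by (simp add: slab_def)
        ultimately have 3: "snd z < r * t" using r by (smt (verit) mult_left_mono)
        have mem: "z \<in> whitney c0 r x t" using 1 2 3 by (cases z) (auto simp: whitney_def)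
        have e: "- (k * ?w) = k * (- ?e1) + k * (- ?e2)"
          by (simp add: wexp_def algebra_simps)
        have "r powr (k * (- ?e1)) \<le> r powr \<bar>?e1\<bar> * snd z powr (- ?e1)"
          using powr_slab_bounds'[OF r z(2), of "- ?e1"] by (simp only: abs_minus_cancel)
        moreover have "r powr (k * (- ?e2)) \<le> r powr \<bar>?e2\<bar> * t powr (- ?e2)"
          using powr_slab_bounds'[OF r t, of "- ?e2"] by (simp only: abs_minus_cancel)
        ultimately have "r powr (- (k * ?w))
           \<le> (r powr \<bar>?e1\<bar> * snd z powr (- ?e1)) * (r powr \<bar>?e2\<bar> * t powr (- ?e2))"
          unfolding e powr_add by (rule mult_mono) auto
        also have "\<dots> = C * (?A * t powr (- ?e2) * snd z powr (- ?e1))"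
        proof -
          have CA: "C * ?A = r powr \<bar>?e1\<bar> * r powr \<bar>?e2\<bar>" 
            by (rule nonzero_eq_divide_eq[THEN iffD1, OF less_imp_neq[OF A, symmetric]]) (rule C_def)
          have "C * (?A * t powr (- ?e2) * snd z powr (- ?e1)) = (C * ?A) * (t powr (- ?e2) * snd z powr (- ?e1))"
            by (simp only: mult.assoc)
          then show ?thesis unfolding CA by (simp only: mult_ac)
        qed
        finally have "r powr (- (k * ?w)) * \<bar>f z\<bar> powr q
           \<le> C * (?A * t powr (- ?e2) * snd z powr (- ?e1)) * \<bar>f z\<bar> powr q"
          by (rule mult_right_mono) simp
        also have "\<dots> = C * (?F z)" by (simp only: mult.assoc)
        finally have le: "ennreal (r powr (- (k * ?w)) * \<bar>f z\<bar> powr q)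
          \<le> ennreal C * ennreal (?F z)"
          by (subst ennreal_mult'[OF less_imp_le[OF C], symmetric]) (rule ennreal_leI)
        then show ?thesis using True mem by simp
      qed simp
    qed
    also have "\<dots> = ennreal C * wavg c0 s f x t"
      unfolding wavg_eq[OF c0 t0 f] by (rule nn_integral_cmult) measurable
    finally show ?thesis .
  qed
  then show ?thesis using C by blast
qed

text \<open>For \<open>t\<close> in slab \<open>k\<close> the region meets only the slabs
  \<open>k - 1\<close>, \<open>k\<close>, \<open>k + 1\<close>. Its radius \<open>c0 * t\<close> is
  below \<open>c0 * r powr (k + 1)\<close>, which for the lowest of these slabs,
  \<open>l = k - 1\<close>, is \<open>c0\<close> times the square of \<open>r\<close> times
  \<open>r powr l\<close>.\<close>

lemma wavg_le_sum:
  assumes c0: "0 < c0" and dn: "d * DIM('a::euclidean_space) \<le> 1"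
  shows "\<exists>C>0. \<forall>f::'a hfun. f \<in> bfun \<longrightarrow>
    (\<forall>k x t S. t \<in> slab r k \<longrightarrow>
     (\<forall>l. \<forall>y\<in>ball x ((c0 * r\<^sup>2 + 1) * r powr l). psi s f l y \<le> S l) \<longrightarrow>
     wavg c0 s f x t \<le> ennreal C * (\<Sum>l\<in>{k-1,k,k+1}. S l))"
proof -
  let ?N = "real DIM('a)"
  let ?w = "wexp TYPE('a) s"
  let ?e1 = "?N * (s * q)" and ?e2 = "?N + 1"
  let ?A = "unit_ball_vol ?N powr (- (s * q)) / wvol TYPE('a) c0"
  let ?R = "c0 * r\<^sup>2"
  let ?D = "unit_ball_vol ?N * ((?R + 1) / d) ^ DIM('a)"
  have A: "0 < ?A" using wvol_pos[OF c0, where 'a='a] by simp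
  have R: "0 < ?R" using c0 r by simp
  have D: "0 < ?D" using R d by simp
  define C where "C = ?A * (r powr ?e2 * r powr ?e2) * r powr \<bar>?e1\<bar>"
  have C: "0 < C" unfolding C_def by (intro mult_pos_pos divide_pos_pos A) (use r in auto)
  have "wavg c0 s f x t \<le> ennreal (C * ?D) * (\<Sum>l\<in>{k-1,k,k+1}. S l)"
    if f[measurable]: "f \<in> bfun" and t: "t \<in> slab r k" and S: "\<forall>l. \<forall>y\<in>ball x ((?R + 1) * r powr l). psi s f l y \<le> S l"
    for f :: "'a hfun" and k x t S
  proof -
    have t0: "0 < t" by (rule slab_pos[OF r t])
    have tb: "r powr k \<le> t" "t < r powr (real_of_int k + 1)" using t by (auto simp: slab_def)
    let ?g = "\<lambda>l z. ennreal C * (indicator (ball x (?R * r powr l) \<times> slab r l) z *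
        ennreal (r powr (- (l * ?w)) * \<bar>f z\<bar> powr q))"
    have "wavg c0 s f x t \<le> (\<integral>\<^sup>+ z. (\<Sum>l\<in>{k-1,k,k+1}. ?g l z) \<partial>lborel2)"
      unfolding wavg_eq[OF c0 t0 f]
    proof (rule nn_integral_mono)
      fix z :: "'a \<times> real"
      show "indicator (whitney c0 r x t) z * ennreal (?A * t powr (- ?e2) * snd z powr (- ?e1) * \<bar>f z\<bar> powr q)
         \<le> (\<Sum>l\<in>{k-1,k,k+1}. ?g l z)"
      proof (cases "z \<in> whitney c0 r x t")
        case True
        then have z: "dist x (fst z) < c0 * t" "t / r < snd z" "snd z < r * t" by (auto simp: whitney_def)
        have z0: "0 < snd z" using z(2) t0 r by (smt (verit) divide_pos_pos)
        from slab_ex1[OF r z0] obtain l where l: "snd z \<in> slab r l" by blast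
        have lb: "r powr l \<le> snd z" "snd z < r powr (real_of_int l + 1)" using l by (auto simp: slab_def)
        have "r powr (real_of_int k - 1) \<le> t / r" using tb(1) r by (simp add: powr_diff divide_right_mono)
        then have "r powr (real_of_int k - 1) < r powr (real_of_int l + 1)" using z(2) lb(2) by linarith
        then have 1: "k - 1 \<le> l" using r by simp
        have "r * t < r powr (real_of_int k + 2)"
        proof -
          have "r powr (real_of_int k + 2) = r * r powr (real_of_int k + 1)"
            using powr_add[of r 1 "real_of_int k + 1"] r by (simp add: add.commute)
          then show ?thesis using tb(2) r by simp
        qed
        then have "r powr l < r powr (real_of_int k + 2)" using lb(1) z(3) by linarith
        then have 2: "l \<le> k + 1" using r by simp
        have "c0 * t \<le> c0 * (r\<^sup>2 * r powr l)"
        proof -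
          have "r powr (real_of_int k + 1) \<le> r powr (2 + real_of_int l)" using 1 r by simp
          also have "\<dots> = r\<^sup>2 * r powr l" using r by (simp add: powr_add powr_numeral)
          finally show ?thesis using tb(2) c0 by simp
        qed
        then have mem: "z \<in> ball x (?R * r powr l) \<times> slab r l" using z(1) l by (cases z) (auto simp: mult.assoc)
        have e: "- (l * ?w) = l * (- ?e2) + l * (- ?e1)"
          by (simp add: wexp_def algebra_simps)
        have "snd z powr (- ?e1) \<le> r powr \<bar>?e1\<bar> * r powr (l * (- ?e1))"
          using powr_slab_bounds(1)[OF r l, of "- ?e1"] by simp
        moreover have "t powr (- ?e2) \<le> (r powr ?e2 * r powr ?e2) * r powr (l * (- ?e2))"
        proof -
          have "\<bar>- ?e2\<bar> = ?e2" by simp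
          then have "t powr (- ?e2) \<le> r powr ?e2 * r powr (k * (- ?e2))"
            using powr_slab_bounds(1)[OF r t, of "- ?e2"] by (simp only:)
          also have "r powr (k * (- ?e2)) \<le> r powr (?e2 + l * (- ?e2))"
          proof -
            have "0 \<le> (1 + real_of_int k - real_of_int l) * ?e2" using 2 by (intro mult_nonneg_nonneg) auto
            then show ?thesis using r by (simp add: algebra_simps)
          qed
          finally show ?thesis using r by (simp add: powr_add mult_ac)
        qed
        ultimately have "t powr (- ?e2) * snd z powr (- ?e1) \<le>
           ((r powr ?e2 * r powr ?e2) * r powr (l * (- ?e2))) * (r powr \<bar>?e1\<bar> * r powr (l * (- ?e1)))"
          by (intro mult_mono) auto
        also have "\<dots> = (r powr ?e2 * r powr ?e2) * r powr \<bar>?e1\<bar> * r powr (- (l * ?w))"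
          unfolding e powr_add by (simp only: mult_ac)
        finally have "?A * (t powr (- ?e2) * snd z powr (- ?e1)) * \<bar>f z\<bar> powr q \<le>
           ?A * ((r powr ?e2 * r powr ?e2) * r powr \<bar>?e1\<bar> * r powr (- (l * ?w))) * \<bar>f z\<bar> powr q"
          by (intro mult_right_mono mult_left_mono less_imp_le[OF A]) auto
        also have "\<dots> = C * (r powr (- (l * ?w)) * \<bar>f z\<bar> powr q)"
          unfolding C_def by (simp only: mult_ac)
        finally have "ennreal (?A * t powr (- ?e2) * snd z powr (- ?e1) * \<bar>f z\<bar> powr q)
           \<le> ennreal C * ennreal (r powr (- (l * ?w)) * \<bar>f z\<bar> powr q)"
          by (subst ennreal_mult'[OF less_imp_le[OF C], symmetric]) (rule ennreal_leI, simp only: mult.assoc)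
        also have "\<dots> = ?g l z" using mem by simp
        also have "\<dots> \<le> (\<Sum>l\<in>{k-1,k,k+1}. ?g l z)"
          by (rule member_le_sum) (use 1 2 in auto)
        finally show ?thesis using True by simp
      qed simp
    qed
    also have "\<dots> = (\<Sum>l\<in>{k-1,k,k+1}. (\<integral>\<^sup>+ z. ?g l z \<partial>lborel2))"
      by (rule nn_integral_sum) measurable
    also have "\<dots> \<le> (\<Sum>l\<in>{k-1,k,k+1}. ennreal (C * ?D) * S l)"
    proof (rule sum_mono)
      fix l
      have "(\<integral>\<^sup>+ z. ?g l z \<partial>lborel2) = ennreal C * (\<integral>\<^sup>+ z. indicator (ball x (?R * r powr l) \<times> slab r l) z *
        ennreal (r powr (- (l * ?w)) * \<bar>f z\<bar> powr q) \<partial>lborel2)"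
        by (rule nn_integral_cmult) measurable
      also have "\<dots> \<le> ennreal C * (ennreal ?D * S l)"
        by (intro mult_left_mono cylinder_le[OF f dn R]) (use S in auto)
      finally show "(\<integral>\<^sup>+ z. ?g l z \<partial>lborel2) \<le> ennreal (C * ?D) * S l"
        using C D by (simp only: ennreal_mult[OF less_imp_le[OF C] less_imp_le[OF D]] mult.assoc)
    qed
    also have "\<dots> = ennreal (C * ?D) * (\<Sum>l\<in>{k-1,k,k+1}. S l)"
      by (rule sum_distrib_left[symmetric])
    finally show ?thesis .
  qed
  then show ?thesis using C D by (intro exI[of _ "C * ?D"] conjI) auto
qed


section \<open>Discrete form of the Z-norm\<close>

definition Zint :: "real \<Rightarrow> real \<Rightarrow> real \<Rightarrow> 'a::euclidean_space hfun \<Rightarrow> ennreal" where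
  "Zint p s c0 f = (\<integral>\<^sup>+ z. indicator {z. 0 < snd z} z *
       epow (Wq c0 r q (Vpow (-s) f) z) p / ennreal (snd z) \<partial>lborel2)"

definition Zsum :: "real \<Rightarrow> real \<Rightarrow> 'a::euclidean_space hfun \<Rightarrow> ennreal" where
  "Zsum p s f = (\<Sum>\<^sub>\<int>k. (\<integral>\<^sup>+x. epow (psi s f k x) (p/q) \<partial>lborel))"

lemma epow_psi_measurable [measurable]:
  fixes f :: "'a::euclidean_space hfun"
  assumes [measurable]: "f \<in> bfun"
  shows "(\<lambda>x. epow (psi s f k x) e) \<in> borel_measurable borel"
  by (rule measurable_compose[OF psi_measurable measurable_epow]) fact

lemma Zsum_le_Zint:
  assumes p: "0 < p" and c0: "0 < c0" and dn: "d * DIM('a::euclidean_space) \<le> c0"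
  shows "\<exists>C>0. \<forall>f::'a hfun. f \<in> bfun \<longrightarrow>
    Zsum p s f \<le> ennreal C * Zint p s c0 f"
proof -
  obtain C where C: "0 < C" and W: "\<And>f::'a hfun. \<And>k x t. f \<in> bfun \<Longrightarrow>
      t \<in> slab r k \<Longrightarrow> psi s f k x \<le> ennreal C * wavg c0 s f x t"
    using psi_le_wavg[OF c0 dn, of s] by blast
  let ?C = "C powr (p/q)"
  have lr: "0 < ln r" using r by simp
  have C': "0 < ?C" using C by simp
  have "Zsum p s f \<le> ennreal (?C / ln r) * Zint p s c0 f"
    if f[measurable]: "f \<in> bfun" for f :: "'a hfun"
  proof -
    let ?S = "\<lambda>z::'a \<times> real. (\<Sum>\<^sub>\<int>k. indicator (slab r k) (snd z) * epow (psi s f k (fst z)) (p/q) / ennreal (snd z))"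
    \<comment> \<open>With \<open>1 / ?C\<close> on the left no constant has to be pulled out of
      \<open>Zint\<close>, so measurability of its integrand does not enter.\<close>
    have "ennreal (1 / ?C) * (ennreal (ln r) * Zsum p s f) = ennreal (1 / ?C) *
       (\<integral>\<^sup>+z. ?S z
       \<partial>lborel2)"
      unfolding Zsum_def by (subst nn_integral_slabs[OF r]) auto
    also have "\<dots> = (\<integral>\<^sup>+z. ennreal (1 / ?C) * ?S z
       \<partial>lborel2)"
      by (rule nn_integral_cmult[symmetric], rule measurable_isum) auto
    also have "\<dots> \<le> Zint p s c0 f"
      unfolding Zint_def
    proof (rule nn_integral_mono)
      fix z :: "'a \<times> real"
      obtain x t where z: "z = (x, t)" by (cases z)
      show "ennreal (1 / ?C) * ?S z
         \<le> indicator {z. 0 < snd z} z * epow (Wq c0 r q (Vpow (-s) f) z) p / ennreal (snd z)"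
      proof (cases "0 < t")
        case True
        from slab_ex1[OF r this] obtain k where k: "\<And>j. t \<in> slab r j \<longleftrightarrow> j = k" by blast
        have "?S z
           = epow (psi s f k x) (p/q) / ennreal t"
          by (subst isum_single[of k]) (use k in \<open>auto simp: indicator_def z\<close>)
        also have "\<dots> \<le> epow (ennreal C * wavg c0 s f x t) (p/q) / ennreal t"
          by (intro divide_right_mono_ennreal epow_mono W f) (use k p q in auto)
        also have "\<dots> = ennreal ?C * (epow (Wq c0 r q (Vpow (-s) f) z) p / ennreal t)"
          using C by (simp add: epow_mult epow_ennreal z Wq_wavg epow_epow ennreal_times_divide)
        finally have "ennreal (1 / ?C) * ?S z
           \<le> ennreal (1 / ?C) * (ennreal ?C * (epow (Wq c0 r q (Vpow (-s) f) z) p / ennreal t))"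
          by (rule mult_left_mono) simp
        also have "\<dots> = epow (Wq c0 r q (Vpow (-s) f) z) p / ennreal t"
          using C by (simp flip: ennreal_mult mult.assoc)
        finally show ?thesis using True by (simp add: z)
      next
        case False
        then have "t \<notin> slab r k" for k using slab_pos[OF r] by blast
        then show ?thesis by (simp add: z)
      qed
    qed
    finally have "ennreal (?C / ln r) * (ennreal (1 / ?C) * (ennreal (ln r) * Zsum p s f)) \<le> ennreal (?C / ln r) * Zint p s c0 f"
      by (rule mult_left_mono) simp
    moreover have "ennreal (?C / ln r) * (ennreal (1 / ?C) * (ennreal (ln r) * Zsum p s f)) = Zsum p s f"
      using C lr by (simp flip: ennreal_mult mult.assoc)
    ultimately show ?thesis by simp
  qed
  then show ?thesis using C' lr by (intro exI[of _ "?C / ln r"]) auto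
qed

text \<open>A Whitney average at \<open>(x, t)\<close> involves cell means near \<open>x\<close> at
  three scales. Each is constant on cells, so its power \<open>p / q\<close> is below a local mean
  of that same power; integrating in \<open>x\<close> loses only a constant, for
  \<open>p < q\<close> as well.\<close>

lemma Zint_le_Zsum:
  assumes p: "0 < p" and c0: "0 < c0" and dn: "d * DIM('a::euclidean_space) \<le> 1"
  shows "\<exists>C>0. \<forall>f::'a hfun. f \<in> bfun \<longrightarrow>
    Zint p s c0 f \<le> ennreal C * Zsum p s f"
proof -
  obtain C where C: "0 < C" and W: "\<And>f::'a hfun. \<And>k x t S. f \<in> bfun \<Longrightarrow>
      t \<in> slab r k \<Longrightarrow> (\<And>l y. y\<in>ball x ((c0 * r\<^sup>2 + 1) * r powr l) \<Longrightarrow> psi s f l y \<le> S l) \<Longrightarrow>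
     wavg c0 s f x t \<le> ennreal C * (\<Sum>l\<in>{k-1,k,k+1}. S l)"
    using wavg_le_sum[OF c0 dn, of s] by blast
  let ?R = "c0 * r\<^sup>2 + 1 + 1"
  let ?C = "C powr (p/q) * 2 powr ((p/q) * 3)"
  let ?B = "ball_vol TYPE('a) * (?R / d) ^ DIM('a)"
  have lr: "0 < ln r" using r by simp
  have C': "0 < ?C" using C by simp
  have R: "0 < ?R" using c0 r by (simp add: add_pos_pos)
  have B: "0 < ?B" using R d by simp
  have "Zint p s c0 f \<le> ennreal (?C * ln r * ?B * 3) * Zsum p s f"
    if f[measurable]: "f \<in> bfun" for f :: "'a hfun"
  proof -
    define h where "h l = lmean ?R l (\<lambda>y. epow (psi s f l y) (p/q))" for l
    let ?h = "(\<Sum>\<^sub>\<int>k. (\<integral>\<^sup>+x. h k x \<partial>lborel))"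
    have h[measurable]: "h l \<in> borel_measurable borel" for l unfolding h_def by measurable
    define H where "H k x = (\<Sum>l\<in>{k-1,k,k+1}. h l x)" for k x
    have H[measurable]: "H k \<in> borel_measurable borel" for k unfolding H_def by measurable
    let ?S = "\<lambda>z::'a \<times> real. (\<Sum>\<^sub>\<int>k. indicator (slab r k) (snd z) * H k (fst z) / ennreal (snd z))"
    have key: "epow (wavg c0 s f x t) (p/q) \<le> ennreal ?C * H k x" if t: "t \<in> slab r k" for x t k
    proof -
      have "wavg c0 s f x t \<le> ennreal C * (\<Sum>l\<in>{k-1,k,k+1}. epow (h l x) (q/p))"
      proof (rule W[OF f t])
        fix l :: int and y assume y: "y \<in> ball x ((c0 * r\<^sup>2 + 1) * r powr l)"
        have cc: "cellconst l (\<lambda>y. epow (psi s f l y) (p/q))"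
          using cellconst_psi[of l s f] unfolding cellconst_def by metis
        have "epow (psi s f l y) (p/q) \<le> h l x"
          unfolding h_def by (rule le_lmean[OF dn cc y])
        then show "psi s f l y \<le> epow (h l x) (q/p)"
          using epow_le_iff[of "p/q" "psi s f l y" "h l x"] p q by simp
      qed
      then have "epow (wavg c0 s f x t) (p/q) \<le> epow (ennreal C * (\<Sum>l\<in>{k-1,k,k+1}. epow (h l x) (q/p))) (p/q)"
        by (rule epow_mono[rotated]) (use p q in auto)
      also have "\<dots> = ennreal (C powr (p/q)) * epow (\<Sum>l\<in>{k-1,k,k+1}. epow (h l x) (q/p)) (p/q)"
        using C unfolding epow_mult by (simp add: epow_ennreal)
      also have "\<dots> \<le> ennreal (C powr (p/q)) * (ennreal (2 powr ((p/q) * real (card {k-1,k,k+1}))) *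
          (\<Sum>l\<in>{k-1,k,k+1}. epow (epow (h l x) (q/p)) (p/q)))"
        by (intro mult_left_mono epow_sum_le) (use p q in auto)
      also have "\<dots> = ennreal ?C * H k x"
        using p q C by (simp add: H_def epow_epow epow_one ennreal_mult mult.assoc)
      finally show ?thesis .
    qed
    have "Zint p s c0 f \<le> (\<integral>\<^sup>+z. ennreal ?C * ?S z
       \<partial>lborel2)"
      unfolding Zint_def
    proof (rule nn_integral_mono)
      fix z :: "'a \<times> real"
      obtain x t where z: "z = (x, t)" by (cases z)
      show "indicator {z. 0 < snd z} z * epow (Wq c0 r q (Vpow (-s) f) z) p / ennreal (snd z)
        \<le> ennreal ?C * ?S z"
      proof (cases "0 < t")
        case True
        from slab_ex1[OF r this] obtain k where k: "\<And>j. t \<in> slab r j \<longleftrightarrow> j = k" by blast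
        have "epow (Wq c0 r q (Vpow (-s) f) z) p / ennreal (snd z) = epow (wavg c0 s f x t) (p/q) / ennreal t"
          by (simp add: z Wq_wavg epow_epow)
        also have "\<dots> \<le> ennreal ?C * H k x / ennreal t"
          by (intro divide_right_mono_ennreal key) (use k in auto)
        also have "\<dots> = ennreal ?C * ?S z"
          by (subst isum_single[of k]) (use k in \<open>auto simp: indicator_def z ennreal_times_divide\<close>)
        finally show ?thesis using True by (simp add: z)
      qed (simp add: z)
    qed
    also have "\<dots> = ennreal ?C * (\<integral>\<^sup>+z. ?S z
       \<partial>lborel2)"
      by (rule nn_integral_cmult, rule measurable_isum) auto
    also have "\<dots> = ennreal ?C * (ennreal (ln r) * (\<Sum>\<^sub>\<int>k. (\<integral>\<^sup>+x. H k x \<partial>lborel)))"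
      by (subst nn_integral_slabs[OF r H]) auto
    also have "(\<Sum>\<^sub>\<int>k. (\<integral>\<^sup>+x. H k x \<partial>lborel))
       = (\<Sum>\<^sub>\<int>k. (\<Sum>i\<in>{-1,0,1}. (\<integral>\<^sup>+x. h (k + i) x \<partial>lborel)))"
      unfolding H_def by (intro nn_integral_cong) (simp add: nn_integral_add)
    also have "\<dots> = (\<Sum>i\<in>{-1,0,1::int}. (\<Sum>\<^sub>\<int>k. (\<integral>\<^sup>+x. h (k + i) x \<partial>lborel)))"
      by (rule nn_integral_sum) simp
    also have "\<dots> = (\<Sum>i\<in>{-1,0,1::int}. ?h)"
    proof (rule sum.cong[OF refl])
      fix i :: int
      have "bij_betw (\<lambda>k. k + i) UNIV UNIV" by (rule bij_betw_byWitness[where f'="\<lambda>k. k - i"]) auto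
      then show "(\<Sum>\<^sub>\<int>k. (\<integral>\<^sup>+x. h (k + i) x \<partial>lborel)) = ?h"
        by (rule nn_integral_bij_count_space)
    qed
    also have "\<dots> = 3 * ?h" by simp
    also have "?h = ennreal ?B * Zsum p s f"
      unfolding h_def Zsum_def
      by (subst nn_integral_cmult[symmetric], simp) (intro nn_integral_cong nn_integral_lmean[OF _ R] epow_psi_measurable f)
    also have "ennreal ?C * (ennreal (ln r) * (3 * (ennreal ?B * Zsum p s f))) = ennreal (?C * ln r * ?B * 3) * Zsum p s f"
    proof -
      have "ennreal (?C * ln r * ?B * 3) = ennreal ?C * ennreal (ln r) * ennreal ?B * ennreal 3"
        using C' lr B by (simp only: ennreal_mult' mult_pos_pos less_imp_le)
      then show ?thesis by (simp add: mult_ac)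
    qed
    finally show ?thesis .
  qed
  then show ?thesis using C' lr B by (intro exI[of _ "?C * ln r * ?B * 3"]) auto
qed

end

section \<open>Area functionals of truncations\<close>

text \<open>The power \<open>b powr p\<close>, enlarged by a negative power of the cut quotient,
  which is at most 1 on the cells that the cut keeps. For \<open>b = 0\<close> the value is 0, so
  discarded cells do not contribute.\<close>

abbreviation cutw :: "real \<Rightarrow> real \<Rightarrow> real \<Rightarrow> real \<Rightarrow> real \<Rightarrow> real \<Rightarrow> real" where
  "cutw e p p' x u b \<equiv> b powr p * (b powr p / (u * (b * exp x) powr p')) powr (-e)"

context whitney_grid
begin

text \<open>\<open>b\<close> bounds the L^q cell means in one weight,
  \<open>b * exp (\<kappa> * k)\<close> stands for the same function in the other weight, and
  \<open>u\<close> is the level of the cut. Both orders of the exponents occur later, the second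
  with \<open>-\<kappa>\<close> and the inverse level.\<close>

abbreviation cut_bound :: "'a::euclidean_space itself \<Rightarrow> real \<Rightarrow> real \<Rightarrow> real \<Rightarrow> real \<Rightarrow> real \<Rightarrow> real \<Rightarrow> bool" where
  "cut_bound _ e p p' \<kappa> s C \<equiv> \<forall>(f::'a hfun) (b::int \<Rightarrow> 'a \<Rightarrow> real) u.
     f \<in> bfun \<longrightarrow> (\<forall>k. b k \<in> borel_measurable borel) \<longrightarrow>
     (\<forall>k. cellconst k (b k)) \<longrightarrow> 0 < u \<longrightarrow> (\<forall>k y. 0 \<le> b k y) \<longrightarrow>
     (\<forall>k y. psi s f k y \<le> ennreal (b k y powr q)) \<longrightarrow>
     (\<forall>k y. b k y powr p \<le> u * (b k y * exp (\<kappa> * real_of_int k)) powr p') \<longrightarrow>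
     tentq p s f \<le> ennreal C *
       (\<Sum>\<^sub>\<int>k. (\<integral>\<^sup>+y. ennreal (cutw e p p' (\<kappa> * real_of_int k) u (b k y)) \<partial>lborel))"

text \<open>At each \<open>x\<close> the sum \<open>J x\<close> of local means bounds the cut weight
  on all cells near \<open>x\<close>. If \<open>J x = B powr p\<close>, then
  \<open>powr_cut_decay\<close> turns this into a bound of \<open>b\<close> by \<open>B\<close>
  times geometric decay away from one scale, so the q-th powers sum to a multiple of
  \<open>B powr q\<close>. Hence \<open>epow (areaq s f x) (p/q)\<close> is at most a multiple of
  \<open>J x\<close>, whose integral is known.\<close>

lemma areaq_cut_le:
  fixes p p' e \<kappa> s :: real
  assumes p: "0 < p" "0 < p'" and e: "0 < e" "e * \<bar>p - p'\<bar> \<le> p / 2" and kap: "\<kappa> \<noteq> 0"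
    and dn: "d * DIM('a::euclidean_space) \<le> 1"
  shows "\<exists>C>0. cut_bound TYPE('a) e p p' \<kappa> s C"
proof -
  \<comment> \<open>The bound on \<open>b powr p * V powr (-e)\<close> is used through its p-th
    root, which replaces \<open>e\<close> by \<open>e / p\<close>.\<close>
  define e' where "e' = e / p"
  have e': "0 < e'" "e' * \<bar>p - p'\<bar> \<le> 1/2" using e p unfolding e'_def by (auto simp: field_simps)
  \<comment> \<open>The two upper bounds required by \<open>powr_cut_decay\<close>; the added 1
    covers \<open>p = p'\<close>.\<close>
  define c where "c = min (e' * p' / 2) (p' / (\<bar>p - p'\<bar> + 1))"
  have c: "0 < c" "c * \<bar>p - p'\<bar> \<le> p'" "c \<le> e' * p' / 2"
  proof -
    show "0 < c" unfolding c_def using e' p by simp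
    show "c \<le> e' * p' / 2" unfolding c_def by (rule min.cobounded1)
    have "c * \<bar>p - p'\<bar> \<le> (p' / (\<bar>p - p'\<bar> + 1)) * (\<bar>p - p'\<bar> + 1)"
      by (intro mult_mono) (use p in \<open>auto simp: c_def\<close>)
    also have "\<dots> = p'" by simp
    finally show "c * \<bar>p - p'\<bar> \<le> p'" .
  qed
  have "c * q * \<kappa> \<noteq> 0" using c q kap by simp
  from sum_exp_dist_bounded[OF this] obtain C1 where C1: "0 < C1"
    "exp_sums_le (c * q * \<kappa>) C1" by blast
  let ?v = "ball_vol TYPE('a)"
  define C2 where "C2 = r powr \<bar>wexp TYPE('a) s\<bar> * ?v powr (- (s * q + 1)) * (?v * ((r + 1) / d) ^ DIM('a))"
  have C2: "0 < C2" unfolding C2_def using r d by (intro mult_pos_pos) auto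
  define C3 where "C3 = (C2 * C1) powr (p/q)"
  have C3: "0 < C3" unfolding C3_def using C1 C2 by simp
  define C4 where "C4 = ?v * ((r + 1 + 1) / d) ^ DIM('a)"
  have C4: "0 < C4" unfolding C4_def using r d by (intro mult_pos_pos) auto
  have main: "tentq p s f \<le> ennreal (C3 * C4) *
       (\<Sum>\<^sub>\<int>k. (\<integral>\<^sup>+y. ennreal (cutw e p p' (\<kappa> * k) u (b k y)) \<partial>lborel))"
    if f[measurable]: "f \<in> bfun"
      and b[measurable]: "\<And>k. b k \<in> borel_measurable borel" and bc: "\<And>k. cellconst k (b k)"
      and u: "0 < u" and b0: "\<And>k y. 0 \<le> b k y"
      and psi: "\<And>k y. psi s f k y \<le> ennreal (b k y powr q)"
      and cut: "\<And>k y. b k y powr p \<le> u * (b k y * exp (\<kappa> * k)) powr p'"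
    for f :: "'a hfun" and b :: "int \<Rightarrow> 'a \<Rightarrow> real" and u
  proof -
    define V where "V k y = b k y powr p / (u * (b k y * exp (\<kappa> * k)) powr p')" for k y
    define F where "F k y = ennreal (b k y powr p * V k y powr (-e))" for k y
    have [measurable]: "F k \<in> borel_measurable borel" for k unfolding F_def V_def by measurable
    have Fc: "cellconst k (F k)" for k
      unfolding cellconst_def
    proof (intro allI impI)
      fix x y :: 'a assume "same_cell (d * r powr k) x y"
      then have "b k x = b k y" using bc[of k] by (simp add: cellconst_def)
      then show "F k x = F k y" by (simp only: F_def V_def)
    qed
    \<comment> \<open>A sum over scales dominates the supremum and still has an explicit
      integral.\<close>
    define J where "J x = (\<Sum>\<^sub>\<int>k. lmean (r + 1 + 1) k (F k) x)" for x
    have FJ: "F k y \<le> J x" if "y \<in> ball x ((r + 1) * r powr k)" for x y k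
    proof -
      have "F k y \<le> lmean (r + 1 + 1) k (F k) x" by (rule le_lmean[OF dn Fc that])
      also have "\<dots> \<le> J x" unfolding J_def by (rule nn_integral_ge_point) simp
      finally show ?thesis .
    qed
    have Vp: "0 < V k y" "V k y \<le> 1" if "0 < b k y" for k y
      unfolding V_def using that u cut[of k y] by auto
    have "epow (areaq s f x) (p/q) \<le> ennreal C3 * J x" for x
    proof (cases "J x")
      case top
      then show ?thesis using C3 by (simp add: ennreal_mult_top)
    next
      case (real B')
      show ?thesis
      proof (cases "B' = 0")
        case True
        \<comment> \<open>No logarithm of \<open>B\<close> is available here, but
          \<open>J x = 0\<close> makes all cell means near \<open>x\<close> vanish.\<close>
        have "psi s f k y \<le> 0" if "y \<in> ball x ((r + 1) * r powr k)" for k y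
        proof -
          have "F k y = 0" using FJ[OF that] real True by simp
          then have le: "b k y powr p * V k y powr (-e) \<le> 0" unfolding F_def by (simp add: ennreal_eq_0_iff)
          have "b k y = 0"
          proof (rule ccontr)
            assume "b k y \<noteq> 0"
            then have bp: "0 < b k y" using b0[of k y] by simp
            then have "0 < b k y powr p * V k y powr (-e)" using Vp[OF bp] by (intro mult_pos_pos) auto
            then show False using le by simp
          qed
          then show ?thesis using psi[of k y] q by simp
        qed
        then have "areaq s f x \<le> ennreal C2 * (\<integral>\<^sup>+k. 0 \<partial>count_space (UNIV::int set))"
          unfolding C2_def by (rule areaq_le_sum[OF f dn])
        then show ?thesis by simp
      next
        case False
        then have B': "0 < B'" using real by simp
        define B where "B = B' powr (1/p)"
        have B: "0 < B" unfolding B_def using B' by simp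
        \<comment> \<open>The centre from \<open>powr_cut_decay\<close>. It varies with
          \<open>x\<close> through \<open>B\<close>, hence the need for a sum bound uniform in the
          centre.\<close>
        define l where "l = ((p - p') * ln B - ln u) / p'"
        let ?x = "\<lambda>k::int. exp (- \<bar>c * q * \<kappa> * k - c * q * l\<bar>)"
        have "psi s f k y \<le> ennreal (B powr q) * ennreal (?x k)"
          if y: "y \<in> ball x ((r + 1) * r powr k)" for k y
        proof (cases "b k y = 0")
          case True
          then show ?thesis using psi[of k y] q by simp
        next
          case False
          then have bp: "0 < b k y" using b0[of k y] by simp
          have "b k y powr p * V k y powr (-e) \<le> B'"
            using FJ[OF y] real B' unfolding F_def by simp
          then have "(b k y powr p * V k y powr (-e)) powr (1/p) \<le> B"
            unfolding B_def by (rule powr_mono2[rotated -1]) (use p bp Vp[OF bp] in auto)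
          moreover have "(b k y powr p * V k y powr (-e)) powr (1/p) = b k y * V k y powr (- e')"
            using p bp b0 Vp[OF bp] by (simp add: powr_mult powr_powr e'_def)
          ultimately have "b k y * V k y powr (- e') \<le> B" by simp
          then have "b k y \<le> B * exp (- c * \<bar>ln (exp (\<kappa> * k)) - l\<bar>)"
            unfolding l_def using Vp[OF bp] unfolding V_def
            by (intro powr_cut_decay[OF p e' _ _ u B _ _ c]) (use bp in auto)
          then have "b k y powr q \<le> (B * exp (- c * \<bar>\<kappa> * k - l\<bar>)) powr q"
            by (intro powr_mono2) (use q b0 in auto)
          also have "\<dots> = B powr q * exp (q * (- c * \<bar>\<kappa> * k - l\<bar>))"
            using B by (simp add: powr_mult) (simp add: powr_def)
          also have "q * (- c * \<bar>\<kappa> * k - l\<bar>) = - \<bar>c * q * \<kappa> * k - c * q * l\<bar>"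
          proof -
            have "c * q * \<kappa> * k - c * q * l = (c * q) * (\<kappa> * k - l)"
              by (simp add: algebra_simps)
            then show ?thesis using c q by (simp add: abs_mult)
          qed
          finally have "ennreal (b k y powr q) \<le> ennreal (B powr q * ?x k)"
            by (rule ennreal_leI)
          with psi[of k y] have "psi s f k y \<le> ennreal (B powr q * ?x k)"
            by (rule order.trans)
          then show ?thesis by (simp add: ennreal_mult')
        qed
        then have "areaq s f x \<le> ennreal C2 * (\<Sum>\<^sub>\<int>k. ennreal (B powr q) * ennreal (?x k))"
          unfolding C2_def by (rule areaq_le_sum[OF f dn])
        also have "\<dots> = ennreal C2 * (ennreal (B powr q) * (\<Sum>\<^sub>\<int>k. ennreal (?x k)))"
          by (subst nn_integral_cmult) auto
        also have "\<dots> \<le> ennreal C2 * (ennreal (B powr q) * ennreal C1)"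
          by (intro mult_left_mono C1(2)[rule_format]) auto
        also have "\<dots> = ennreal (C2 * C1 * B powr q)"
          using C1 C2 by (simp add: ennreal_mult mult_ac)
        finally have "epow (areaq s f x) (p/q) \<le> epow (ennreal (C2 * C1 * B powr q)) (p/q)"
          by (rule epow_mono[rotated]) (use p q in auto)
        also have "\<dots> = ennreal ((C2 * C1 * B powr q) powr (p/q))"
          using C1 C2 by (intro epow_ennreal) auto
        also have "(C2 * C1 * B powr q) powr (p/q) = C3 * B'"
          using C1 C2 B' p q by (simp add: powr_mult powr_powr B_def C3_def)
        finally show ?thesis using C3 real by (simp add: ennreal_mult)
      qed
    qed
    then have "tentq p s f \<le> (\<integral>\<^sup>+x. ennreal C3 * J x \<partial>lborel)"
      by (intro nn_integral_mono)
    also have "\<dots> = ennreal C3 * (\<integral>\<^sup>+x. J x \<partial>lborel)"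
      unfolding J_def by (rule nn_integral_cmult) measurable
    also have "(\<integral>\<^sup>+x. J x \<partial>lborel) = (\<Sum>\<^sub>\<int>k. (\<integral>\<^sup>+x. lmean (r + 1 + 1) k (F k) x \<partial>lborel))"
      unfolding J_def by (rule nn_integral_count_space_nn_integral) auto
    also have "\<dots> = (\<Sum>\<^sub>\<int>k. ennreal C4 * (\<integral>\<^sup>+x. F k x \<partial>lborel))"
      unfolding C4_def using r by (intro nn_integral_cong nn_integral_lmean) auto
    also have "\<dots> = ennreal C4 * (\<Sum>\<^sub>\<int>k. (\<integral>\<^sup>+x. F k x \<partial>lborel))"
      by (rule nn_integral_cmult) simp
    finally show ?thesis using C3 C4 unfolding F_def V_def by (simp add: ennreal_mult mult.assoc)
  qed
  show ?thesis
    by (intro exI[of _ "C3 * C4"] conjI allI impI main) (use C3 C4 in auto)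
qed

end

section \<open>Dyadic form of the interpolation norm\<close>

lemma borel_measurable_lborel_pair:
  "borel_measurable lborel2 = borel_measurable borel2"
  by (rule measurable_cong_sets[OF sets_pair_measure_cong]) auto

lemma nn_integral_slabs_real:
  fixes H :: "int \<Rightarrow> ennreal"
  assumes r: "1 < r"
  shows "(\<integral>\<^sup>+t. (\<Sum>\<^sub>\<int>k. indicator (slab r k) t * H k / ennreal t) \<partial>lborel)
     = ennreal (ln r) * (\<Sum>\<^sub>\<int>k. H k)"
proof -
  have "(\<integral>\<^sup>+t. (\<Sum>\<^sub>\<int>k. indicator (slab r k) t * H k / ennreal t) \<partial>lborel)
    = (\<Sum>\<^sub>\<int>k. (\<integral>\<^sup>+t. H k * (indicator (slab r k) t / ennreal t) \<partial>lborel))"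
    by (subst nn_integral_count_space_nn_integral) (auto simp: ennreal_times_divide mult.commute)
  also have "\<dots> = (\<Sum>\<^sub>\<int>k. H k * ennreal (ln r))"
    by (intro nn_integral_cong, subst nn_integral_cmult) (auto simp: nn_integral_slab[OF r])
  also have "\<dots> = ennreal (ln r) * (\<Sum>\<^sub>\<int>k. H k)"
    by (subst nn_integral_multc) (auto simp: mult.commute)
  finally show ?thesis .
qed

text \<open>On a slab \<open>K t\<close> is at most its value at the right end, while
  \<open>t powr (-\<theta>)\<close> is largest at the left end. Moving the weight to the right end
  costs \<open>2 powr \<theta>\<close>, and the index \<open>k + 1\<close> is shifted back in the
  sum.\<close>

lemma log_integral_le_dyadic_sum:
  fixes K :: "real \<Rightarrow> ennreal"
  assumes K: "\<And>t t'. 0 < t \<Longrightarrow> t \<le> t' \<Longrightarrow> K t \<le> K t'" and a: "0 < a" and th: "0 < \<theta>"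
  shows "(\<integral>\<^sup>+ t\<in>{0<..}. epow (ennreal (t powr (-\<theta>)) * K t) a / ennreal t \<partial>lborel)
    \<le> ennreal (2 powr (\<theta> * a) * ln 2) *
      (\<Sum>\<^sub>\<int>k. epow (ennreal (2 powr (- \<theta> * k)) * K (2 powr k)) a)"
proof -
  define S where "S k = epow (ennreal (2 powr (- \<theta> * k)) * K (2 powr k)) a" for k :: int
  let ?c = "ennreal (2 powr (\<theta> * a))"
  let ?F = "\<lambda>t. epow (ennreal (t powr (-\<theta>)) * K t) a"
  let ?G = "\<lambda>t. (\<Sum>\<^sub>\<int>k. indicator (slab 2 k) t * (?c * S (k + 1)) / ennreal t)"
  have "(\<integral>\<^sup>+ t\<in>{0<..}. ?F t / ennreal t \<partial>lborel)
    \<le> (\<integral>\<^sup>+t. ?G t \<partial>lborel)"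
  proof (rule nn_integral_mono)
    fix t :: real
    show "?F t / ennreal t * indicator {0<..} t \<le>
      ?G t"
    proof (cases "0 < t")
      case True
      from slab_ex1[OF _ this, of 2] obtain k where k: "\<And>j. t \<in> slab 2 j \<longleftrightarrow> j = k" by auto
      have "t \<in> slab 2 k" using k by blast
      then have tk: "2 powr k \<le> t" "t \<le> 2 powr real_of_int (k + 1)"
        by (simp_all add: slab_def)
      have "t powr (-\<theta>) \<le> 2 powr \<theta> * 2 powr (- \<theta> * real_of_int (k + 1))"
      proof -
        have "t powr (-\<theta>) \<le> (2 powr k) powr (-\<theta>)"
          by (rule powr_mono2') (use tk th in auto)
        also have "\<dots> = 2 powr \<theta> * 2 powr (- \<theta> * real_of_int (k + 1))"
          by (simp add: powr_powr powr_add[symmetric] algebra_simps)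
        finally show ?thesis .
      qed
      then have "?F t
         \<le> epow (ennreal (2 powr \<theta> * 2 powr (- \<theta> * real_of_int (k + 1))) * K (2 powr real_of_int (k + 1))) a"
        by (intro epow_mono a mult_mono K True tk ennreal_leI) auto
      also have "\<dots> = ?c * S (k + 1)"
        unfolding S_def by (simp add: ennreal_mult epow_mult epow_ennreal powr_powr mult.assoc)
      finally have "?F t / ennreal t \<le> ?c * S (k + 1) / ennreal t"
        by (rule divide_right_mono_ennreal)
      also have "\<dots> = ?G t"
        by (subst isum_single[of k]) (use k in \<open>auto simp: indicator_def\<close>)
      finally show ?thesis using True by simp
    qed simp
  qed
  also have "\<dots> = ennreal (ln 2) * (\<Sum>\<^sub>\<int>k. ?c * S (k + 1))"
    by (rule nn_integral_slabs_real) simp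
  also have "(\<Sum>\<^sub>\<int>k. ?c * S (k + 1))
     = ?c * (\<Sum>\<^sub>\<int>k. S (k + 1))"
    by (rule nn_integral_cmult) simp
  also have "(\<Sum>\<^sub>\<int>k. S (k + 1)) = (\<Sum>\<^sub>\<int>k. S k)"
    by (rule nn_integral_bij_count_space) (rule bij_betw_byWitness[where f'="\<lambda>k. k - 1"]; auto)
  finally show ?thesis unfolding S_def by (simp add: ennreal_mult mult_ac)
qed

text \<open>The opposite choice: \<open>K t\<close> is at least its value at the left end and the
  weight is at least its value at the right end, again at the cost of
  \<open>2 powr \<theta>\<close>.\<close>

lemma dyadic_sum_le_log_integral:
  fixes K :: "real \<Rightarrow> ennreal"
  assumes K: "\<And>t t'. 0 < t \<Longrightarrow> t \<le> t' \<Longrightarrow> K t \<le> K t'" and a: "0 < a" and th: "0 < \<theta>"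
  shows "(\<Sum>\<^sub>\<int>k. epow (ennreal (2 powr (- \<theta> * k)) * K (2 powr k)) a)
    \<le> ennreal (2 powr (\<theta> * a) / ln 2) *
     (\<integral>\<^sup>+ t\<in>{0<..}. epow (ennreal (t powr (-\<theta>)) * K t) a / ennreal t \<partial>lborel)"
proof -
  define S where "S k = epow (ennreal (2 powr (- \<theta> * k)) * K (2 powr k)) a" for k :: int
  let ?c = "2 powr (- (\<theta> * a))"
  let ?F = "\<lambda>t. epow (ennreal (t powr (-\<theta>)) * K t) a"
  let ?G = "\<lambda>t. (\<Sum>\<^sub>\<int>k. indicator (slab 2 k) t * (ennreal ?c * S k) / ennreal t)"
  have "(\<integral>\<^sup>+t. ?G t \<partial>lborel)
    \<le> (\<integral>\<^sup>+ t\<in>{0<..}. ?F t / ennreal t \<partial>lborel)"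
  proof (rule nn_integral_mono)
    fix t :: real
    show "?G t
      \<le> ?F t / ennreal t * indicator {0<..} t"
    proof (cases "0 < t")
      case True
      from slab_ex1[OF _ this, of 2] obtain k where k: "\<And>j. t \<in> slab 2 j \<longleftrightarrow> j = k" by auto
      have "t \<in> slab 2 k" using k by blast
      then have tk: "2 powr k \<le> t" "t \<le> 2 powr real_of_int (k + 1)"
        by (simp_all add: slab_def)
      have le: "2 powr (-\<theta>) * 2 powr (- \<theta> * k) \<le> t powr (-\<theta>)"
      proof -
        have "2 powr (-\<theta>) * 2 powr (- \<theta> * k) = (2 powr real_of_int (k + 1)) powr (-\<theta>)"
          by (simp add: powr_powr powr_add[symmetric] algebra_simps)
        also have "\<dots> \<le> t powr (-\<theta>)"
          by (rule powr_mono2') (use tk th True in auto)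
        finally show ?thesis .
      qed
      have "ennreal ?c * S k = epow (ennreal (2 powr (-\<theta>) * 2 powr (- \<theta> * k)) * K (2 powr k)) a"
        unfolding S_def by (simp add: ennreal_mult epow_mult epow_ennreal powr_powr mult.assoc)
      also have "\<dots> \<le> ?F t"
        by (intro epow_mono a mult_mono K tk ennreal_leI le) auto
      finally have "ennreal ?c * S k / ennreal t \<le> ?F t / ennreal t"
        by (rule divide_right_mono_ennreal)
      moreover have "ennreal ?c * S k / ennreal t = ?G t"
        by (subst isum_single[of k]) (use k in \<open>auto simp: indicator_def\<close>)
      ultimately show ?thesis using True by simp
    next
      case False
      then have "t \<notin> slab 2 k" for k using slab_pos[of 2 t k] by auto
      then show ?thesis by simp
    qed
  qed
  also have "(\<integral>\<^sup>+t. ?G t \<partial>lborel)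
     = ennreal (ln 2) * (ennreal ?c * (\<Sum>\<^sub>\<int>k. S k))"
    by (subst nn_integral_slabs_real) (auto simp: nn_integral_cmult)
  finally have *: "ennreal (2 powr (\<theta> * a) / ln 2) * (ennreal (ln 2) * (ennreal ?c * (\<Sum>\<^sub>\<int>k. S k)))
     \<le> ennreal (2 powr (\<theta> * a) / ln 2) * (\<integral>\<^sup>+ t\<in>{0<..}. ?F t / ennreal t \<partial>lborel)"
    by (rule mult_left_mono) simp
  have "2 powr (\<theta> * a) / ln 2 * ln 2 * ?c = 1" by (simp add: powr_add[symmetric])
  then have "ennreal (2 powr (\<theta> * a) / ln 2) * (ennreal (ln 2) * (ennreal ?c * (\<Sum>\<^sub>\<int>k. S k))) = (\<Sum>\<^sub>\<int>k. S k)"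
    by (simp add: mult.assoc[symmetric] ennreal_mult[symmetric])
  with * show ?thesis unfolding S_def by simp
qed

section \<open>The K-functional and the interpolation weights\<close>

lemma K_fun_le:
  assumes "f0 \<in> borel_measurable lborel2" "f1 \<in> borel_measurable lborel2"
    "\<And>z. f z = f0 z + f1 z"
  shows "K_fun N0 N1 t f \<le> N0 f0 + ennreal t * N1 f1"
  unfolding K_fun_def by (rule INF_lower2[of "(f0, f1)"]) (use assms in auto)

lemma K_fun_mono: "t \<le> t' \<Longrightarrow> K_fun N0 N1 t f \<le> K_fun N0 N1 t' f"
  unfolding K_fun_def by (rule INF_superset_mono) (auto intro!: add_left_mono mult_right_mono ennreal_leI)

lemma K_fun_approx:
  assumes "K_fun N0 N1 t f < y"
  obtains f0 f1 where "f0 \<in> borel_measurable lborel2" "f1 \<in> borel_measurable lborel2"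
    "\<And>z. f z = f0 z + f1 z" "N0 f0 + ennreal t * N1 f1 < y"
  using assms unfolding K_fun_def by (auto simp: INF_less_iff)

text \<open>With \<open>\<eta> = \<theta> * a / p1\<close> both left sides simplify to
  \<open>b0 powr (p0 * (1 - \<eta>)) * b1 powr (p1 * \<eta>)\<close>. These exponents are
  \<open>(1 - \<theta>) * a\<close> and \<open>\<theta> * a\<close>, for which the powers of
  \<open>exp x\<close> cancel.\<close>

lemma interpolation_weight_identity:
  fixes g x :: real
  assumes p: "0 < p0" "0 < p1" and a: "0 < a" "1 / a = (1 - \<theta>) / p0 + \<theta> / p1" and g: "0 < g"
  defines "b0 \<equiv> exp (- \<theta> * x) * g" and "b1 \<equiv> exp ((1 - \<theta>) * x) * g"
  shows "b0 powr p0 * (b0 powr p0 / b1 powr p1) powr (- (\<theta> * a / p1)) = g powr a"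
    and "b1 powr p1 * (b0 powr p0 / b1 powr p1) powr (1 - \<theta> * a / p1) = g powr a"
proof -
  have eta: "(1 - \<theta>) * a / p0 = 1 - \<theta> * a / p1"
    by (rule interpolation_exponent[OF a])
  have b: "b0 powr p0 = exp (p0 * (ln g - \<theta> * x))" "b1 powr p1 = exp (p1 * (ln g + (1 - \<theta>) * x))"
    unfolding b0_def b1_def using g by (auto simp: powr_def ln_mult algebra_simps)
  let ?l = "p0 * (ln g - \<theta> * x) - p1 * (ln g + (1 - \<theta>) * x)"
  have U: "b0 powr p0 / b1 powr p1 = exp ?l" unfolding b exp_diff ..
  have pow: "exp L powr m = exp (m * L)" for L m :: real by (simp add: powr_def)
  have 0: "p0 * (1 - \<theta> * a / p1) = (1 - \<theta>) * a" unfolding eta[symmetric] using p by simp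
  have 1: "p1 * (\<theta> * a / p1) = \<theta> * a" using p by simp
  have "p0 * (ln g - \<theta> * x) - (\<theta> * a / p1) * ?l = (p0 * (1 - \<theta> * a / p1)) * (ln g - \<theta> * x) + (p1 * (\<theta> * a / p1)) * (ln g + (1 - \<theta>) * x)"
    by (simp only: algebra_simps)
  also have "\<dots> = a * ln g" unfolding 0 1 by (simp add: algebra_simps)
  finally have e: "p0 * (ln g - \<theta> * x) - (\<theta> * a / p1) * ?l = a * ln g" .
  have g': "g powr a = exp (a * ln g)" using g by (simp add: powr_def)
  show *: "b0 powr p0 * (b0 powr p0 / b1 powr p1) powr (- (\<theta> * a / p1)) = g powr a"
    unfolding U pow unfolding b(1) g' e[symmetric] exp_add[symmetric] by simp
  have "b1 powr p1 * (b0 powr p0 / b1 powr p1) powr (1 - \<theta> * a / p1)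
     = b1 powr p1 * (exp ?l * (b0 powr p0 / b1 powr p1) powr (- (\<theta> * a / p1)))"
    unfolding U pow exp_add[symmetric] by (simp add: left_diff_distrib)
  also have "b1 powr p1 * (exp ?l * (b0 powr p0 / b1 powr p1) powr (- (\<theta> * a / p1)))
     = (b1 powr p1 * exp ?l) * (b0 powr p0 / b1 powr p1) powr (- (\<theta> * a / p1))" by simp
  also have "b1 powr p1 * exp ?l = b0 powr p0" unfolding b exp_add[symmetric] by simp
  finally show "b1 powr p1 * (b0 powr p0 / b1 powr p1) powr (1 - \<theta> * a / p1) = g powr a" using * by simp
qed

section \<open>Cutting along level sets\<close>

text \<open>The left sides are \<open>J powr \<eta> * (U / J) powr (\<eta> - e)\<close> and
  \<open>J powr (\<eta> - 1) * (J / U) powr (1 - \<eta> - e)\<close>. With \<open>e\<close> below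
  \<open>\<eta>\<close> and \<open>1 - \<eta>\<close>, cells far from the level contribute with
  geometric decay on either side.\<close>

lemma cut_weight_le:
  fixes U J \<eta> e \<delta> :: real
  assumes U: "0 < U" and J: "0 < J" and \<delta>: "0 \<le> \<delta>"
  shows "U \<le> J \<Longrightarrow> \<delta> \<le> \<eta> - e \<Longrightarrow> U powr \<eta> * (U / J) powr (-e) \<le> J powr \<eta> * exp (- \<bar>\<delta> * ln J - \<delta> * ln U\<bar>)"
    and "J < U \<Longrightarrow> \<delta> \<le> 1 - \<eta> - e \<Longrightarrow>
      U powr (\<eta> - 1) * (J / U) powr (-e) \<le> J powr (\<eta> - 1) * exp (- \<bar>\<delta> * ln J - \<delta> * ln U\<bar>)"
proof -
  define m where "m = ln J - ln U"
  have abs: "\<bar>\<delta> * ln J - \<delta> * ln U\<bar> = \<delta> * \<bar>m\<bar>"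
    unfolding m_def right_diff_distrib[symmetric] abs_mult using \<delta> by simp
  show "U powr \<eta> * (U / J) powr (-e) \<le> J powr \<eta> * exp (- \<bar>\<delta> * ln J - \<delta> * ln U\<bar>)"
    if "U \<le> J" "\<delta> \<le> \<eta> - e"
  proof -
    have m: "0 \<le> m" using that(1) U J by (simp add: m_def)
    have "\<delta> * m \<le> (\<eta> - e) * m" by (rule mult_right_mono[OF that(2) m])
    then have "\<eta> * ln U + - e * (ln U - ln J) \<le> \<eta> * ln J + - (\<delta> * m)"
      by (simp add: m_def algebra_simps)
    then have "exp (\<eta> * ln U + - e * (ln U - ln J)) \<le> exp (\<eta> * ln J + - (\<delta> * m))" by simp
    then show ?thesis unfolding abs exp_add using U J m by (simp add: powr_def ln_div)
  qed
  show "U powr (\<eta> - 1) * (J / U) powr (-e) \<le> J powr (\<eta> - 1) * exp (- \<bar>\<delta> * ln J - \<delta> * ln U\<bar>)"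
    if "J < U" "\<delta> \<le> 1 - \<eta> - e"
  proof -
    have m: "m < 0" using that(1) U J by (simp add: m_def)
    have "\<delta> * (- m) \<le> (1 - \<eta> - e) * (- m)" using m by (intro mult_right_mono that(2)) simp
    then have "(\<eta> - 1) * ln U + - e * (ln J - ln U) \<le> (\<eta> - 1) * ln J + - (\<delta> * (- m))"
      by (simp add: m_def algebra_simps)
    then have "exp ((\<eta> - 1) * ln U + - e * (ln J - ln U)) \<le> exp ((\<eta> - 1) * ln J + - (\<delta> * (- m)))" by simp
    then show ?thesis unfolding abs exp_add using U J m by (simp add: powr_def ln_div)
  qed
qed

context whitney_grid
begin

abbreviation splits_at ::
  "real \<Rightarrow> real \<Rightarrow> real \<Rightarrow> real \<Rightarrow> 'a::euclidean_space hfun \<Rightarrow> real \<Rightarrow> real \<Rightarrow> bool" where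
  "splits_at p0 p1 s0 s1 f M0 M1 \<equiv> \<exists>f0 f1. f0 \<in> bfun \<and> f1 \<in> bfun \<and> (\<forall>z. f z = f0 z + f1 z) \<and>
     tentq p0 s0 f0 \<le> ennreal M0 \<and> tentq p1 s1 f1 \<le> ennreal M1"

text \<open>\<open>2 * D j\<close> bounds the K-functional of the powers with exponents
  \<open>p0\<close>, \<open>p1\<close> at \<open>2 powr j\<close>; the weighted sum corresponds to
  its interpolation norm with parameter \<open>\<eta>\<close> and second index 1.\<close>

abbreviation level_data ::
  "real \<Rightarrow> real \<Rightarrow> real \<Rightarrow> real \<Rightarrow> real \<Rightarrow> ennreal \<Rightarrow> 'a::euclidean_space hfun \<Rightarrow> (int \<Rightarrow> real) \<Rightarrow> bool" where
  "level_data p0 p1 s0 s1 \<eta> Z f D \<equiv> (\<forall>j. 0 \<le> D j) \<and> (\<Sum>\<^sub>\<int>j. ennreal ((2 powr j) powr (-\<eta>) * D j)) \<le> Z \<and>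
     (\<forall>j. splits_at p0 p1 s0 s1 f (D j) (D j / 2 powr j))"

lemma tent_norm_areaq:
  "tent_norm p q s f = epow (tentq p s f) (1/p)"
  unfolding tent_norm_def Aq_areaq epow_epow by simp

lemma Z_norm_Zint: "Z_norm p q s c0 r f = epow (Zint p s c0 f) (1/p)"
  unfolding Z_norm_def Zint_def ..

lemma psi_mono:
  assumes "\<And>z. z \<in> cyl k y \<Longrightarrow> \<bar>f z\<bar> \<le> \<bar>h z\<bar>"
  shows "psi s f k y \<le> psi s h k y"
  unfolding psi_def
proof (rule nn_integral_mono)
  fix z
  show "indicator (cyl k y) z * ennreal (r powr - (k * wexp TYPE('a) s) * \<bar>f z\<bar> powr q)
    \<le> indicator (cyl k y) z * ennreal (r powr - (k * wexp TYPE('a) s) * \<bar>h z\<bar> powr q)"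
    using assms[of z] q
    by (cases "z \<in> cyl k y") (auto intro!: ennreal_leI mult_left_mono powr_mono2)
qed

text \<open>Finite cell means can be replaced by real numbers, whose powers and logarithms the cut
  uses.\<close>

lemma psi_finite:
  fixes f :: "'a::euclidean_space hfun"
  assumes f[measurable]: "f \<in> bfun" and dn: "d * DIM('a) \<le> 1"
    and Z: "Zsum p s f < top"
  shows "psi s f k y < top"
proof -
  define F where "F k y = epow (psi s f k y) (p/q)" for k y
  have Fc: "cellconst k (F k)"
    using cellconst_psi[of k s f] unfolding cellconst_def F_def by metis
  have "F k y \<le> lmean (1 + 1) k (F k) y"
    by (rule le_lmean[OF dn Fc]) (use r in simp)
  also have "\<dots> \<le> ennreal (1 / (d * r powr k) ^ DIM('a)) * (\<integral>\<^sup>+y. F k y \<partial>lborel)"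
    unfolding lmean_def by (intro mult_left_mono nn_integral_mono) (auto split: split_indicator)
  also have "\<dots> \<le> ennreal (1 / (d * r powr k) ^ DIM('a)) * Zsum p s f"
    unfolding Zsum_def F_def[symmetric] by (intro mult_left_mono nn_integral_ge_point) auto
  also have "\<dots> < top" using Z by (simp add: ennreal_mult_less_top)
  finally show ?thesis unfolding F_def by (simp add: less_top[symmetric])
qed

text \<open>At level \<open>J = 2 powr j\<close> a cell goes to \<open>f0\<close> or
  \<open>f1\<close> according to whether its quotient \<open>U\<close> is at most \<open>J\<close>.
  By the weight identities its cut weight is at most \<open>J powr \<eta>\<close>, respectively
  \<open>J powr (\<eta> - 1)\<close>, times \<open>g powr a\<close> times decay in
  \<open>ln J - ln U\<close>. Summing the decay over all levels leaves a multiple of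
  \<open>g powr a\<close>, hence the discrete Z-norm.\<close>

lemma split_at_levels:
  fixes p0 p1 \<theta> a s0 s1 :: real
  assumes p: "0 < p0" "0 < p1" and th: "0 < \<theta>" "\<theta> < 1" and a: "0 < a" "1 / a = (1 - \<theta>) / p0 + \<theta> / p1"
    and s: "s0 \<noteq> s1" and dn: "d * DIM('a::euclidean_space) \<le> 1"
  defines "\<eta> \<equiv> \<theta> * a / p1" and "s\<theta> \<equiv> (1 - \<theta>) * s0 + \<theta> * s1"
  shows "\<exists>C>0. \<forall>f::'a hfun. f \<in> bfun \<longrightarrow> Zsum a s\<theta> f < top \<longrightarrow>
    (\<exists>D::int \<Rightarrow> real. level_data p0 p1 s0 s1 \<eta> (ennreal C * Zsum a s\<theta> f) f D)"
proof -
  let ?N = "real DIM('a)"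
  \<comment> \<open>At scale \<open>k\<close> the weights \<open>V powr (-s1)\<close> and
    \<open>V powr (-s0)\<close> have quotient \<open>exp (\<kappa> * k)\<close> up to a
    constant.\<close>
  define \<kappa> where "\<kappa> = ?N * (s0 - s1) * ln r"
  have kap: "\<kappa> \<noteq> 0" "- \<kappa> \<noteq> 0" unfolding \<kappa>_def using s r by auto
  have eta: "0 < \<eta>" "\<eta> < 1"
  proof -
    have "\<eta> = 1 - (1 - \<theta>) * a / p0" unfolding \<eta>_def interpolation_exponent[OF a] by simp
    moreover have "0 < (1 - \<theta>) * a / p0" using th a p by simp
    ultimately show "\<eta> < 1" by linarith
    show "0 < \<eta>" unfolding \<eta>_def using th a p by simp
  qed
  \<comment> \<open>The first bound leaves half of the smaller of \<open>\<eta>\<close> and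
    \<open>1 - \<eta>\<close> for decay over the levels. The second is what
    \<open>areaq_cut_le\<close> requires for both orders of the exponents, with 1 added to cover
    \<open>p0 = p1\<close>.\<close>
  define e where "e = min (min \<eta> (1 - \<eta>) / 2) (min p0 p1 / (2 * (\<bar>p0 - p1\<bar> + 1)))"
  have e0: "0 < e" unfolding e_def using eta p by (auto intro!: divide_pos_pos add_nonneg_pos)
  have "e * \<bar>p0 - p1\<bar> \<le> (min p0 p1 / (2 * (\<bar>p0 - p1\<bar> + 1))) * (\<bar>p0 - p1\<bar> + 1)"
    by (intro mult_mono) (use p in \<open>auto simp: e_def\<close>)
  also have "\<dots> = min p0 p1 / 2"
  proof -
    have *: "m / (2 * c) * c = m / 2" if "c \<noteq> 0" for m c :: real using that by simp
    show ?thesis by (rule *) linarith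
  qed
  finally have e1: "e * \<bar>p0 - p1\<bar> \<le> p0 / 2" "e * \<bar>p1 - p0\<bar> \<le> p1 / 2"
    by (auto simp: abs_minus_commute)
  define \<delta> where "\<delta> = min \<eta> (1 - \<eta>) - e"
  have "e \<le> min \<eta> (1 - \<eta>) / 2" unfolding e_def by (rule min.cobounded1)
  then have \<delta>: "0 < \<delta>" "\<delta> \<le> \<eta> - e" "\<delta> \<le> 1 - \<eta> - e" unfolding \<delta>_def using eta by auto
  have "\<delta> * ln 2 \<noteq> 0" using \<delta> by simp
  from sum_exp_dist_bounded[OF this] obtain C1 where C1: "0 < C1"
    "exp_sums_le (\<delta> * ln 2) C1" by blast
  obtain CA where CA: "0 < CA" "cut_bound TYPE('a) e p0 p1 \<kappa> s0 CA"
    using areaq_cut_le[OF p e0 e1(1) kap(1) dn, of s0] by blast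
  obtain CB where CB: "0 < CB" "cut_bound TYPE('a) e p1 p0 (- \<kappa>) s1 CB"
    using areaq_cut_le[OF p(2) p(1) e0 e1(2) kap(2) dn, of s1] by blast
  define C where "C = max CA CB"
  have C: "0 < C" "CA \<le> C" "CB \<le> C" unfolding C_def using CA(1) by auto
  have main: "\<exists>D::int \<Rightarrow> real. level_data p0 p1 s0 s1 \<eta> (ennreal (C * C1) * Zsum a s\<theta> f) f D"
    if f[measurable]: "f \<in> bfun" and Z: "Zsum a s\<theta> f < top"
    for f :: "'a hfun"
  proof -
    \<comment> \<open>The L^q cell mean in the intermediate weight; \<open>b0\<close> and
      \<open>b1\<close> are the same mean in the weights of the two tent spaces.\<close>
    define g where "g k y = enn2real (psi s\<theta> f k y) powr (1/q)" for k y
    have g0: "0 \<le> g k y" for k y unfolding g_def by simp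
    have psif: "psi s\<theta> f k y = ennreal (enn2real (psi s\<theta> f k y))" for k y
      using psi_finite[OF f dn Z, of k y] by simp
    have gq: "psi s\<theta> f k y = ennreal (g k y powr q)" for k y
      unfolding g_def using q psif[of k y] by (simp add: powr_powr)
    have ga: "epow (psi s\<theta> f k y) (a/q) = ennreal (g k y powr a)" for k y
      unfolding gq using q by (subst epow_ennreal) (auto simp: powr_powr)
    have gm[measurable]: "g k \<in> borel_measurable borel" for k
      unfolding g_def by measurable
    have gc: "g k x = g k y" if "same_cell (d * r powr k) x y" for k x y
      using cellconst_psi[of k s\<theta> f] that unfolding cellconst_def g_def by metis
    define b0 where "b0 k y = exp (- \<theta> * (\<kappa> * k)) * g k y" for k y
    define b1 where "b1 k y = exp ((1 - \<theta>) * (\<kappa> * k)) * g k y" for k y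
    have [measurable]: "b0 k \<in> borel_measurable borel" "b1 k \<in> borel_measurable borel" for k
      unfolding b0_def b1_def by measurable
    have b01: "0 \<le> b0 k y" "0 \<le> b1 k y" for k y unfolding b0_def b1_def using g0 by auto
    have b10: "b0 k y * exp (\<kappa> * k) = b1 k y" "b1 k y * exp (- \<kappa> * k) = b0 k y" for k y
    proof -
      have "exp (- \<theta> * (\<kappa> * k)) * exp (\<kappa> * k) = exp ((1 - \<theta>) * (\<kappa> * k))"
        unfolding mult_exp_exp by (simp add: algebra_simps)
      then show "b0 k y * exp (\<kappa> * k) = b1 k y" unfolding b0_def b1_def by (simp add: mult_ac)
      have "exp ((1 - \<theta>) * (\<kappa> * k)) * exp (- \<kappa> * k) = exp (- \<theta> * (\<kappa> * k))"
        unfolding mult_exp_exp by (simp add: algebra_simps)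
      then show "b1 k y * exp (- \<kappa> * k) = b0 k y" unfolding b0_def b1_def by (simp add: mult_ac)
    qed
    have psi0: "psi s0 f k y = ennreal (b0 k y powr q)" for k y
    proof -
      have "b0 k y powr q = r powr (k * (?N * (s\<theta> - s0) * q)) * g k y powr q"
        unfolding b0_def using g0 r by (simp add: powr_mult) (simp add: powr_def s\<theta>_def \<kappa>_def algebra_simps)
      then show ?thesis unfolding psi_change_weight[OF f, of s0 k y s\<theta>] gq by (simp add: ennreal_mult)
    qed
    have psi1: "psi s1 f k y = ennreal (b1 k y powr q)" for k y
    proof -
      have "b1 k y powr q = r powr (k * (?N * (s\<theta> - s1) * q)) * g k y powr q"
        unfolding b1_def using g0 r by (simp add: powr_mult) (simp add: powr_def s\<theta>_def \<kappa>_def algebra_simps)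
      then show ?thesis unfolding psi_change_weight[OF f, of s1 k y s\<theta>] gq by (simp add: ennreal_mult)
    qed
    \<comment> \<open>Where \<open>g = 0\<close> this is 0 divided by 0, hence 0; the factor
      \<open>g powr a\<close> makes \<open>h\<close> vanish there.\<close>
    define U where "U k y = b0 k y powr p0 / b1 k y powr p1" for k y
    have [measurable]: "U k \<in> borel_measurable borel" for k unfolding U_def by measurable
    define h where "h j k y = g k y powr a * exp (- \<bar>\<delta> * ln 2 * j - \<delta> * ln (U k y)\<bar>)" for j :: int and k y
    have h0: "0 \<le> h j k y" for j k y unfolding h_def by simp
    have [measurable]: "h j k \<in> borel_measurable borel" for j k unfolding h_def by measurable
    define Q where "Q j = (\<Sum>\<^sub>\<int>k. (\<integral>\<^sup>+y. ennreal (h j k y) \<partial>lborel))" for j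
    have sumQ: "(\<Sum>\<^sub>\<int>j. Q j) \<le> ennreal C1 * Zsum a s\<theta> f"
    proof -
      have "(\<Sum>\<^sub>\<int>j. Q j)
        = (\<Sum>\<^sub>\<int>k. (\<Sum>\<^sub>\<int>j. (\<integral>\<^sup>+y. ennreal (h j k y) \<partial>lborel)))"
        unfolding Q_def by (rule nn_integral_count_space_nn_integral) auto
      also have "\<dots> = (\<Sum>\<^sub>\<int>k. (\<integral>\<^sup>+y. (\<Sum>\<^sub>\<int>j. ennreal (h j k y)) \<partial>lborel))"
        by (intro nn_integral_cong nn_integral_count_space_nn_integral[symmetric]) auto
      also have "\<dots> \<le> (\<Sum>\<^sub>\<int>k. (\<integral>\<^sup>+y. ennreal C1 * epow (psi s\<theta> f k y) (a/q) \<partial>lborel))"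
      proof (intro nn_integral_mono)
        fix k :: int and y :: 'a
        have "(\<Sum>\<^sub>\<int>j. ennreal (h j k y)) = ennreal (g k y powr a) *
          (\<Sum>\<^sub>\<int>j. ennreal (exp (- \<bar>\<delta> * ln 2 * j - \<delta> * ln (U k y)\<bar>)))"
          unfolding h_def by (simp add: ennreal_mult' nn_integral_cmult)
        also have "\<dots> \<le> ennreal (g k y powr a) * ennreal C1" by (intro mult_left_mono C1(2)[rule_format]) simp
        finally show "(\<Sum>\<^sub>\<int>j. ennreal (h j k y)) \<le> ennreal C1 * epow (psi s\<theta> f k y) (a/q)"
          unfolding ga by (simp add: mult.commute)
      qed
      also have "\<dots> = ennreal C1 * Zsum a s\<theta> f"
        unfolding Zsum_def by (simp add: nn_integral_cmult)
      finally show ?thesis .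
    qed
    have Qfin: "Q j < top" for j
    proof -
      have "Q j \<le> (\<Sum>\<^sub>\<int>j. Q j)" by (rule nn_integral_ge_point) simp
      also have "\<dots> \<le> ennreal C1 * Zsum a s\<theta> f" by (rule sumQ)
      also have "\<dots> < top" using Z by (simp add: ennreal_mult_less_top)
      finally show ?thesis .
    qed
    \<comment> \<open>One sequence serves both parts: their bounds are multiples of
      \<open>J powr \<eta> * Q j\<close> and \<open>J powr (\<eta> - 1) * Q j\<close> with
      \<open>J = 2 powr j\<close>, which differ by the factor \<open>J\<close>.\<close>
    define D where "D j = C * (2 powr j) powr \<eta> * enn2real (Q j)" for j
    have Dj: "ennreal C * (ennreal ((2 powr j) powr \<eta>) * Q j) = ennreal (D j)" for j
      unfolding D_def using C Qfin[of j] by (simp add: ennreal_mult mult.assoc)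
    have Dj': "ennreal C * (ennreal ((2 powr j) powr (\<eta> - 1)) * Q j) = ennreal (D j / 2 powr j)" for j
    proof -
      have "D j / 2 powr j = C * (2 powr j) powr (\<eta> - 1) * enn2real (Q j)"
        unfolding D_def by (simp add: powr_diff)
      then show ?thesis using C Qfin[of j] by (simp add: ennreal_mult mult.assoc)
    qed
    show ?thesis
    proof (intro exI[of _ D] conjI allI)
      show "0 \<le> D j" for j unfolding D_def using C by simp
      have "(\<Sum>\<^sub>\<int>j. ennreal ((2 powr j) powr (-\<eta>) * D j)) = (\<Sum>\<^sub>\<int>j. ennreal C * Q j)"
      proof (rule nn_integral_cong)
        fix j :: int
        have "(2 powr j) powr (-\<eta>) * D j = C * enn2real (Q j)"
          unfolding D_def by (simp add: powr_minus)
        then show "ennreal ((2 powr j) powr (-\<eta>) * D j) = ennreal C * Q j"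
          using C Qfin[of j] by (simp add: ennreal_mult)
      qed
      also have "\<dots> = ennreal C * (\<Sum>\<^sub>\<int>j. Q j)" by (rule nn_integral_cmult) simp
      also have "\<dots> \<le> ennreal C * (ennreal C1 * Zsum a s\<theta> f)" by (intro mult_left_mono sumQ) simp
      finally show "(\<Sum>\<^sub>\<int>j. ennreal ((2 powr j) powr (-\<eta>) * D j)) \<le> ennreal (C * C1) * Zsum a s\<theta> f"
        using C C1 by (simp add: ennreal_mult mult.assoc)
    next
      fix j :: int
      define J where "J = (2::real) powr j"
      have J: "0 < J" and lnJ: "ln J = ln 2 * j" unfolding J_def by (auto simp: ln_powr)
      \<comment> \<open>Multiplied out, the condition avoids division where \<open>b1\<close>
        vanishes; where \<open>g\<close> is positive it means \<open>U \<le> J\<close>.\<close>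
      define Cond where "Cond k y \<longleftrightarrow> b0 k y powr p0 \<le> J * b1 k y powr p1" for k y
      have Condc: "Cond k x \<longleftrightarrow> Cond k y" if "same_cell (d * r powr k) x y" for k x y
        unfolding Cond_def b0_def b1_def gc[OF that] ..
      have [measurable]: "Measurable.pred borel (Cond k)" for k unfolding Cond_def by measurable
      \<comment> \<open>Constant on every Whitney cell. Points of height at most 0 lie in no slab
        and go to \<open>f1\<close>, but cones do not contain them.\<close>
      define E where "E z \<longleftrightarrow> (\<exists>k. snd z \<in> slab r k \<and> Cond k (fst z))" for z :: "'a \<times> real"
      have [measurable]: "Measurable.pred borel2 E" unfolding E_def by measurable
      have Ecyl: "E z \<longleftrightarrow> Cond k y" if "z \<in> cyl k y" for z k y
      proof -
        have z: "same_cell (d * r powr k) y (fst z)" "snd z \<in> slab r k" using that by (auto simp: cyl_def)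
        from slab_ex1[OF r slab_pos[OF r z(2)]] have "snd z \<in> slab r j \<longleftrightarrow> j = k" for j using z(2) by metis
        then have "E z \<longleftrightarrow> Cond k (fst z)" unfolding E_def by simp
        then show ?thesis using Condc[OF z(1)] by simp
      qed
      define f0 where "f0 = (\<lambda>z. (if E z then f z else 0))"
      define f1 where "f1 = (\<lambda>z. (if \<not> E z then f z else 0))"
      have f01[measurable]: "f0 \<in> bfun" "f1 \<in> bfun"
        unfolding f0_def f1_def by measurable
      define B0 where "B0 k y = (if Cond k y then b0 k y else 0)" for k y
      define B1 where "B1 k y = (if Cond k y then 0 else b1 k y)" for k y
      have Bm[measurable]: "B0 k \<in> borel_measurable borel" "B1 k \<in> borel_measurable borel" for k
        unfolding B0_def B1_def by measurable
      have B01: "0 \<le> B0 k y" "0 \<le> B1 k y" for k y unfolding B0_def B1_def using b01 by auto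
      have Bc: "cellconst k (B0 k)" "cellconst k (B1 k)" for k
        unfolding cellconst_def B0_def B1_def using Condc gc by (simp_all add: b0_def b1_def)
      have psi_if: "psi s (\<lambda>z. if R z then f z else 0) k y \<le> (if c then psi s f k y else 0)"
        if "\<And>z. z \<in> cyl k y \<Longrightarrow> R z \<longleftrightarrow> c" for s R c k y
      proof -
        have "psi s (\<lambda>z::'a \<times> real. 0) k y = 0" unfolding psi_def using q by simp
        moreover have "psi s (\<lambda>z. if R z then f z else 0) k y \<le> psi s (\<lambda>z. if c then f z else 0) k y"
          by (rule psi_mono) (use that in auto)
        ultimately show ?thesis by (cases c) auto
      qed
      have psiB0: "psi s0 f0 k y \<le> ennreal (B0 k y powr q)" for k y
        using psi_if[of k y E "Cond k y" s0] Ecyl q by (auto simp: f0_def B0_def psi0 split: if_splits)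
      have psiB1: "psi s1 f1 k y \<le> ennreal (B1 k y powr q)" for k y
        using psi_if[of k y "\<lambda>z. \<not> E z" "\<not> Cond k y" s1] Ecyl q by (auto simp: f1_def B1_def psi1 split: if_splits)
      have pos: "0 < b0 k y" "0 < b1 k y" "0 < U k y" if "0 < g k y" for k y
        using that by (auto simp: b0_def b1_def U_def)
      have U1: "b0 k y powr p0 = g k y powr a * U k y powr \<eta>"
        and U2: "b1 k y powr p1 = g k y powr a * U k y powr (\<eta> - 1)" if gp: "0 < g k y" for k y
      proof -
        note id = interpolation_weight_identity[OF p a gp, of "\<kappa> * k", folded b0_def b1_def, folded U_def, folded \<eta>_def]
        have "b0 k y powr p0 * (U k y powr (- \<eta>) * U k y powr \<eta>) = g k y powr a * U k y powr \<eta>"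
          unfolding mult.assoc[symmetric] id(1) ..
        then show "b0 k y powr p0 = g k y powr a * U k y powr \<eta>"
          using pos[OF gp] by (simp add: powr_add[symmetric])
        have "b1 k y powr p1 * (U k y powr (1 - \<eta>) * U k y powr (\<eta> - 1)) = g k y powr a * U k y powr (\<eta> - 1)"
          unfolding mult.assoc[symmetric] id(2) ..
        then show "b1 k y powr p1 = g k y powr a * U k y powr (\<eta> - 1)"
          using pos[OF gp] by (simp add: powr_add[symmetric])
      qed
      have CondU: "Cond k y \<longleftrightarrow> U k y \<le> J" if "0 < g k y" for k y
        unfolding Cond_def U_def using pos[OF that] by (simp add: field_simps)
      have F0: "cutw e p0 p1 (\<kappa> * k) J (B0 k y)
          \<le> J powr \<eta> * h j k y" for k y
      proof (cases "0 < g k y \<and> Cond k y")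
        case True
        then have gp: "0 < g k y" by simp
        have UJ: "U k y \<le> J" using True CondU[OF gp] by simp
        have "cutw e p0 p1 (\<kappa> * k) J (B0 k y)
           = b0 k y powr p0 * (U k y / J) powr (-e)"
          using True by (simp add: B0_def b10 U_def mult.commute)
        also have "\<dots> = g k y powr a * (U k y powr \<eta> * (U k y / J) powr (-e))" unfolding U1[OF gp] by simp
        also have "\<dots> \<le> g k y powr a * (J powr \<eta> * exp (- \<bar>\<delta> * ln J - \<delta> * ln (U k y)\<bar>))"
          by (intro mult_left_mono cut_weight_le(1) pos J UJ gp \<delta>) (use \<delta> in auto)
        also have "\<dots> = J powr \<eta> * h j k y" unfolding h_def lnJ by (simp add: mult_ac)
        finally show ?thesis .
      next
        case False
        then have "B0 k y = 0" using g0[of k y] by (auto simp: B0_def b0_def)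
        then show ?thesis using h0 by simp
      qed
      \<comment> \<open>In the second part the roles are exchanged: exponents swapped,
        \<open>\<kappa>\<close> negated, level \<open>1 / J\<close>, so that the cut quotient
        becomes \<open>J / U\<close>.\<close>
      have F1: "cutw e p1 p0 (- \<kappa> * k) (1 / J) (B1 k y)
          \<le> J powr (\<eta> - 1) * h j k y" for k y
      proof (cases "0 < g k y \<and> \<not> Cond k y")
        case True
        then have gp: "0 < g k y" by simp
        have UJ: "J < U k y" using True CondU[OF gp] by simp
        have "cutw e p1 p0 (- \<kappa> * k) (1 / J) (B1 k y)
           = b1 k y powr p1 * (b1 k y powr p1 / (1 / J * b0 k y powr p0)) powr (-e)"
          using True by (simp only: B1_def b10 if_False)
        also have "b1 k y powr p1 / (1 / J * b0 k y powr p0) = J / U k y"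
          unfolding U_def using pos[OF gp] by simp
        also have "b1 k y powr p1 * (J / U k y) powr (-e) = g k y powr a * (U k y powr (\<eta> - 1) * (J / U k y) powr (-e))"
          unfolding U2[OF gp] by simp
        also have "\<dots> \<le> g k y powr a * (J powr (\<eta> - 1) * exp (- \<bar>\<delta> * ln J - \<delta> * ln (U k y)\<bar>))"
          by (intro mult_left_mono cut_weight_le(2) pos J UJ gp \<delta>) (use \<delta> in auto)
        also have "\<dots> = J powr (\<eta> - 1) * h j k y" unfolding h_def lnJ by (simp add: mult_ac)
        finally show ?thesis .
      next
        case False
        then have "B1 k y = 0" using g0[of k y] by (auto simp: B1_def b1_def)
        then show ?thesis using h0 by simp
      qed
      have int: "(\<Sum>\<^sub>\<int>k. (\<integral>\<^sup>+y. ennreal (\<Phi> k y) \<partial>lborel)) \<le> ennreal w * Q j"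
        if "\<And>k y. \<Phi> k y \<le> w * h j k y" and "0 \<le> w" for \<Phi> :: "int \<Rightarrow> 'a \<Rightarrow> real" and w
      proof -
        have "(\<Sum>\<^sub>\<int>k. (\<integral>\<^sup>+y. ennreal (\<Phi> k y) \<partial>lborel))
          \<le> (\<Sum>\<^sub>\<int>k. (\<integral>\<^sup>+y. ennreal w * ennreal (h j k y) \<partial>lborel))"
          by (intro nn_integral_mono) (use that h0 in \<open>simp add: ennreal_leI flip: ennreal_mult\<close>)
        also have "\<dots> = ennreal w * Q j" unfolding Q_def by (simp add: nn_integral_cmult)
        finally show ?thesis .
      qed
      have I0: "tentq p0 s0 f0 \<le> ennreal (D j)"
      proof -
        have "tentq p0 s0 f0 \<le> ennreal CA * (\<Sum>\<^sub>\<int>k. (\<integral>\<^sup>+y. ennreal (cutw e p0 p1 (\<kappa> * k) J (B0 k y)) \<partial>lborel))"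
        proof (rule CA(2)[rule_format, OF f01(1)])
          show "B0 k y powr p0 \<le> J * (B0 k y * exp (\<kappa> * k)) powr p1" for k y
            using p by (auto simp: B0_def Cond_def b10)
        qed (use J Bc Bm psiB0 B01 in auto)
        also have "\<dots> \<le> ennreal C * (ennreal (J powr \<eta>) * Q j)"
          by (intro mult_mono int F0 ennreal_leI C) auto
        finally show ?thesis using Dj[of j] unfolding J_def by simp
      qed
      have I1: "tentq p1 s1 f1 \<le> ennreal (D j / 2 powr j)"
      proof -
        have "tentq p1 s1 f1 \<le> ennreal CB * (\<Sum>\<^sub>\<int>k. (\<integral>\<^sup>+y. ennreal (cutw e p1 p0 (- \<kappa> * k) (1 / J) (B1 k y)) \<partial>lborel))"
        proof (rule CB(2)[rule_format, OF f01(2)])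
          show "B1 k y powr p1 \<le> 1 / J * (B1 k y * exp (- \<kappa> * k)) powr p0" for k y
          proof (cases "Cond k y")
            case False
            then have "b1 k y powr p1 \<le> 1 / J * b0 k y powr p0"
              unfolding Cond_def using J by (simp add: field_simps)
            then show ?thesis using False by (simp only: B1_def b10 if_False)
          qed (simp add: B1_def)
        qed (use J Bc Bm psiB1 B01 in auto)
        also have "\<dots> \<le> ennreal C * (ennreal (J powr (\<eta> - 1)) * Q j)"
          by (intro mult_mono int F1 ennreal_leI C) auto
        finally show ?thesis using Dj'[of j] unfolding J_def by simp
      qed
      show "splits_at p0 p1 s0 s1 f (D j) (D j / 2 powr j)"
        by (intro exI[of _ f0] exI[of _ f1] conjI f01 I0 I1) (auto simp: f0_def f1_def)
    qed
  qed
  show ?thesis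
    by (intro exI[of _ "C * C1"] conjI allI impI main) (use C C1 in auto)
qed

end

section \<open>Upper bound for the interpolation norm\<close>

lemma K_fun_scale:
  assumes c: "1 \<le> c" and t: "0 \<le> t"
  shows "K_fun N0 N1 (c * t) f \<le> ennreal c * K_fun N0 N1 t f"
proof -
  have "ennreal (1 / c) * K_fun N0 N1 (c * t) f \<le> K_fun N0 N1 t f"
    unfolding K_fun_def[of N0 N1 t f]
  proof (rule INF_greatest)
    fix p assume "p \<in> {(f0, f1). f0 \<in> borel_measurable lborel2 \<and>
        f1 \<in> borel_measurable lborel2 \<and> (\<forall>z. f z = f0 z + f1 z)}"
    then obtain f0 f1 where p: "p = (f0, f1)" "f0 \<in> borel_measurable lborel2"
      "f1 \<in> borel_measurable lborel2" "\<And>z. f z = f0 z + f1 z" by auto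
    have "K_fun N0 N1 (c * t) f \<le> N0 f0 + ennreal (c * t) * N1 f1" by (rule K_fun_le[OF p(2-4)])
    also have "\<dots> \<le> ennreal c * N0 f0 + ennreal c * (ennreal t * N1 f1)"
    proof (rule add_mono)
      have "1 * N0 f0 \<le> ennreal c * N0 f0" using c by (intro mult_right_mono) auto
      then show "N0 f0 \<le> ennreal c * N0 f0" by simp
      show "ennreal (c * t) * N1 f1 \<le> ennreal c * (ennreal t * N1 f1)"
        using c t by (simp add: ennreal_mult mult.assoc)
    qed
    also have "\<dots> = ennreal c * (N0 f0 + ennreal t * N1 f1)" by (simp add: distrib_left)
    finally have "ennreal (1 / c) * K_fun N0 N1 (c * t) f \<le> ennreal (1 / c) * (ennreal c * (N0 f0 + ennreal t * N1 f1))"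
      by (rule mult_left_mono) simp
    also have "\<dots> = N0 f0 + ennreal t * N1 f1"
      using c by (simp add: mult.assoc[symmetric] ennreal_mult[symmetric])
    finally show "ennreal (1 / c) * K_fun N0 N1 (c * t) f \<le> (case p of (f0, f1) \<Rightarrow> N0 f0 + ennreal t * N1 f1)"
      by (simp add: p)
  qed
  then have "ennreal c * (ennreal (1 / c) * K_fun N0 N1 (c * t) f) \<le> ennreal c * K_fun N0 N1 t f"
    by (rule mult_left_mono) simp
  then show ?thesis using c by (simp add: mult.assoc[symmetric] ennreal_mult[symmetric])
qed

lemma add_powr_le:
  fixes x y :: real
  assumes "0 \<le> x" "0 \<le> y" "0 \<le> q"
  shows "(x + y) powr q \<le> 2 powr q * (x powr q + y powr q)" "x powr q + y powr q \<le> 2 * (x + y) powr q"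
proof -
  have *: "(x + y) powr q \<le> 2 powr q * (x powr q + y powr q)" if "0 \<le> x" "x \<le> y" for x y
  proof -
    have "(x + y) powr q \<le> (2 * y) powr q" using that assms(3) by (intro powr_mono2) auto
    also have "\<dots> = 2 powr q * y powr q" using that by (simp add: powr_mult)
    also have "\<dots> \<le> 2 powr q * (x powr q + y powr q)" by simp
    finally show ?thesis .
  qed
  show "(x + y) powr q \<le> 2 powr q * (x powr q + y powr q)"
    using *[of x y] *[of y x] assms by (cases "x \<le> y") (auto simp: add.commute)
  have "x powr q \<le> (x + y) powr q" "y powr q \<le> (x + y) powr q"
    using assms by (auto intro!: powr_mono2)
  then show "x powr q + y powr q \<le> 2 * (x + y) powr q" by simp
qed

context whitney_grid
begin

definition interp_int :: "real \<Rightarrow> real \<Rightarrow> real \<Rightarrow> real \<Rightarrow> real \<Rightarrow> real \<Rightarrow> 'a::euclidean_space hfun \<Rightarrow> ennreal" where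
  "interp_int p0 p1 s0 s1 \<theta> a f = (\<integral>\<^sup>+ t\<in>{0<..}.
       epow (ennreal (t powr (-\<theta>)) * K_fun (tent_norm p0 q s0) (tent_norm p1 q s1) t f) a / ennreal t \<partial>lborel)"

lemma interp_norm_interp_int:
  "interp_norm (tent_norm p0 q s0) (tent_norm p1 q s1) \<theta> a f = epow (interp_int p0 p1 s0 s1 \<theta> a f) (1/a)"
  unfolding interp_norm_def interp_int_def ..

text \<open>Every level from \<open>split_at_levels\<close> is a decomposition of \<open>f\<close>,
  hence \<open>K t \<le> D j powr (1/p0) + t * (D j / 2 powr j) powr (1/p1)\<close> for all
  \<open>t\<close> and \<open>j\<close>. This is the hypothesis of the discrete power theorem with
  \<open>u j = 2 powr j\<close> and \<open>\<kappa> = ln 2\<close>.\<close>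

lemma interp_int_le_Zsum:
  fixes p0 p1 \<theta> a s0 s1 :: real
  assumes p: "0 < p0" "0 < p1" and th: "0 < \<theta>" "\<theta> < 1" and a: "0 < a" "1 / a = (1 - \<theta>) / p0 + \<theta> / p1"
    and s: "s0 \<noteq> s1" and dn: "d * DIM('a::euclidean_space) \<le> 1"
  shows "\<exists>C>0. \<forall>f::'a hfun. f \<in> bfun \<longrightarrow>
    interp_int p0 p1 s0 s1 \<theta> a f \<le> ennreal C * Zsum a ((1 - \<theta>) * s0 + \<theta> * s1) f"
proof -
  let ?s = "(1 - \<theta>) * s0 + \<theta> * s1" and ?\<eta> = "\<theta> * a / p1"
  obtain C1 where C1: "0 < C1" "\<And>f::'a hfun. f \<in> bfun \<Longrightarrow> Zsum a ?s f < top \<Longrightarrow>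
    \<exists>D::int \<Rightarrow> real. level_data p0 p1 s0 s1 ?\<eta> (ennreal C1 * Zsum a ?s f) f D"
    using split_at_levels[OF p th a s dn] by blast
  have "(1::real) < 2" "ln 2 \<noteq> (0::real)" by auto
  from power_theorem_discrete[OF p th a this, of 2] obtain C2 where C2: "0 < C2"
    "power_bound p0 p1 \<theta> a (ln 2) 2 2 C2" by blast
  let ?C = "2 powr (\<theta> * a) * ln 2 * (C2 * C1)"
  have Cp: "0 < ?C" using C1 C2 by simp
  have main: "interp_int p0 p1 s0 s1 \<theta> a f \<le> ennreal ?C * Zsum a ?s f"
    if f: "f \<in> bfun" for f :: "'a hfun"
  proof (cases "Zsum a ?s f < top")
    case False
    then show ?thesis using C1 C2 by (simp add: less_top[symmetric] ennreal_mult_top)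
  next
    case True
    then obtain D :: "int \<Rightarrow> real" where D0: "\<And>j. 0 \<le> D j"
      and Dsum: "(\<Sum>\<^sub>\<int>j. ennreal ((2 powr j) powr (-?\<eta>) * D j)) \<le> ennreal C1 * Zsum a ?s f"
      and Dec: "\<And>j. splits_at p0 p1 s0 s1 f (D j) (D j / 2 powr j)"
      using C1(2)[OF f] by blast
    define K where "K t = K_fun (tent_norm p0 q s0) (tent_norm p1 q s1) t f" for t
    have Kle: "K t \<le> ennreal (D j powr (1/p0) + t * (D j / 2 powr j) powr (1/p1))" if t: "0 \<le> t" for t j
    proof -
      obtain f0 f1 where fm: "f0 \<in> bfun" "f1 \<in> bfun"
         and fe: "\<And>z. f z = f0 z + f1 z"
         and i0: "tentq p0 s0 f0 \<le> ennreal (D j)"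
         and i1: "tentq p1 s1 f1 \<le> ennreal (D j / 2 powr j)"
        using Dec[of j] by blast
      have "tent_norm p0 q s0 f0 \<le> epow (ennreal (D j)) (1/p0)"
        unfolding tent_norm_areaq by (intro epow_mono i0) (use p in simp)
      moreover have "tent_norm p1 q s1 f1 \<le> epow (ennreal (D j / 2 powr j)) (1/p1)"
        unfolding tent_norm_areaq by (intro epow_mono i1) (use p in simp)
      ultimately have n: "tent_norm p0 q s0 f0 \<le> ennreal (D j powr (1/p0))"
          "tent_norm p1 q s1 f1 \<le> ennreal ((D j / 2 powr j) powr (1/p1))"
        using D0[of j] by (auto simp: epow_ennreal)
      have "K t \<le> tent_norm p0 q s0 f0 + ennreal t * tent_norm p1 q s1 f1"
        unfolding K_def by (rule K_fun_le) (use fm fe in \<open>auto simp: borel_measurable_lborel_pair\<close>)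
      also have "\<dots> \<le> ennreal (D j powr (1/p0)) + ennreal t * ennreal ((D j / 2 powr j) powr (1/p1))"
        by (intro add_mono mult_left_mono n) auto
      also have "\<dots> = ennreal (D j powr (1/p0) + t * (D j / 2 powr j) powr (1/p1))"
        using t by (simp add: ennreal_mult)
      finally show ?thesis .
    qed
    define G where "G k = enn2real (K (2 powr k))" for k :: int
    have KG: "K (2 powr k) = ennreal (G k)" for k
    proof -
      have "K (2 powr k) < top"
        by (rule le_less_trans[OF Kle[of _ 0]]) auto
      then show ?thesis unfolding G_def by simp
    qed
    have e2: "exp (ln 2 * k) = 2 powr k" for k :: int
      by (simp add: powr_def mult.commute)
    have e3: "exp (- \<theta> * ln 2 * k) = 2 powr (- \<theta> * k)" for k :: int
      by (simp add: powr_def mult_ac)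
    have "interp_int p0 p1 s0 s1 \<theta> a f \<le> ennreal (2 powr (\<theta> * a) * ln 2) *
      (\<Sum>\<^sub>\<int>k. epow (ennreal (2 powr (- \<theta> * k)) * K (2 powr k)) a)"
      unfolding interp_int_def K_def
      by (rule log_integral_le_dyadic_sum[OF K_fun_mono a(1) th(1)])
    also have "(\<Sum>\<^sub>\<int>k. epow (ennreal (2 powr (- \<theta> * k)) * K (2 powr k)) a)
       = (\<Sum>\<^sub>\<int>k. ennreal ((exp (- \<theta> * ln 2 * k) * G k) powr a))"
      unfolding e3 KG by (intro nn_integral_cong, subst ennreal_mult'[symmetric]) (auto simp: epow_ennreal G_def)
    also have "\<dots> \<le> ennreal C2 * (\<Sum>\<^sub>\<int>j. ennreal ((2 powr j) powr (- ?\<eta>) * D j))"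
    proof (rule C2(2)[rule_format])
      show "G k \<le> D j powr (1/p0) + exp (ln 2 * k) * (D j / 2 powr j) powr (1/p1)" for k j
      proof -
        have "ennreal (G k) \<le> ennreal (D j powr (1/p0) + 2 powr k * (D j / 2 powr j) powr (1/p1))"
          unfolding KG[symmetric] by (rule Kle) simp
        then show "G k \<le> D j powr (1/p0) + exp (ln 2 * k) * (D j / 2 powr j) powr (1/p1)"
          unfolding e2 by (subst (asm) ennreal_le_iff) auto
      qed
    qed (auto simp: G_def D0 powr_add)
    also have "\<dots> \<le> ennreal C2 * (ennreal C1 * Zsum a ?s f)"
      by (intro mult_left_mono Dsum) simp
    finally show ?thesis using C1 C2 by (simp add: ennreal_mult mult.assoc mult_left_mono)
  qed
  show ?thesis by (intro exI[of _ ?C] conjI allI impI main Cp)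
qed

end

section \<open>Lower bound for the interpolation norm\<close>

context whitney_grid
begin

lemma psi_add_le:
  fixes f :: "'a::euclidean_space hfun"
  assumes [measurable]: "f0 \<in> bfun" "f1 \<in> bfun"
    and f: "\<And>z. f z = f0 z + f1 z"
  shows "psi s f k y \<le> ennreal (2 powr q) * (psi s f0 k y + psi s f1 k y)"
proof -
  let ?w = "r powr (- (k * wexp TYPE('a) s))"
  have "psi s f k y \<le> (\<integral>\<^sup>+z. ennreal (2 powr q) * (indicator (cyl k y) z * ennreal (?w * \<bar>f0 z\<bar> powr q) +
      indicator (cyl k y) z * ennreal (?w * \<bar>f1 z\<bar> powr q)) \<partial>lborel2)"
    unfolding psi_def
  proof (rule nn_integral_mono)
    fix z :: "'a \<times> real"
    have "\<bar>f z\<bar> powr q \<le> (\<bar>f0 z\<bar> + \<bar>f1 z\<bar>) powr q"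
      unfolding f using q by (intro powr_mono2) auto
    also have "\<dots> \<le> 2 powr q * (\<bar>f0 z\<bar> powr q + \<bar>f1 z\<bar> powr q)"
      using q by (intro add_powr_le) auto
    finally have "?w * \<bar>f z\<bar> powr q \<le> ?w * (2 powr q * (\<bar>f0 z\<bar> powr q + \<bar>f1 z\<bar> powr q))"
      by (rule mult_left_mono) simp
    also have "\<dots> = 2 powr q * (?w * \<bar>f0 z\<bar> powr q + ?w * \<bar>f1 z\<bar> powr q)" by (simp add: algebra_simps)
    finally have "ennreal (?w * \<bar>f z\<bar> powr q) \<le> ennreal (2 powr q * (?w * \<bar>f0 z\<bar> powr q + ?w * \<bar>f1 z\<bar> powr q))"
      by (rule ennreal_leI)
    also have "\<dots> = ennreal (2 powr q) * (ennreal (?w * \<bar>f0 z\<bar> powr q) + ennreal (?w * \<bar>f1 z\<bar> powr q))"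
      by (simp add: ennreal_mult')
    finally show "indicator (cyl k y) z * ennreal (?w * \<bar>f z\<bar> powr q) \<le>
      ennreal (2 powr q) * (indicator (cyl k y) z * ennreal (?w * \<bar>f0 z\<bar> powr q) + indicator (cyl k y) z * ennreal (?w * \<bar>f1 z\<bar> powr q))"
      by (auto split: split_indicator)
  qed
  also have "\<dots> = ennreal (2 powr q) * (psi s f0 k y + psi s f1 k y)"
    unfolding psi_def by (subst nn_integral_cmult) (auto simp: nn_integral_add)
  finally show ?thesis .
qed

text \<open>The intended decompositions and \<open>u\<close> do not vary with \<open>x\<close>.
  Integrated over \<open>x\<close>, the right side then becomes a weighted sum of tent norms raised
  to the powers \<open>p0\<close> and \<open>p1\<close>.\<close>

abbreviation decomposition_bound ::
  "'a::euclidean_space itself \<Rightarrow> real \<Rightarrow> real \<Rightarrow> real \<Rightarrow> real \<Rightarrow> real \<Rightarrow> real \<Rightarrow> real \<Rightarrow> real \<Rightarrow> real \<Rightarrow> bool" where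
  "decomposition_bound _ p0 p1 s0 s1 \<theta> a R0 R1 C \<equiv> \<forall>(f::'a hfun) f0 f1 (u::int \<Rightarrow> real) x.
    f \<in> bfun \<longrightarrow>
    (\<forall>j. f0 j \<in> bfun) \<longrightarrow> (\<forall>j. f1 j \<in> bfun) \<longrightarrow>
    (\<forall>j z. f z = f0 j z + f1 j z) \<longrightarrow> (\<forall>j. 0 < u j) \<longrightarrow> (\<forall>j. R0 * u j \<le> u (j + 1) \<and> u (j + 1) \<le> R1 * u j) \<longrightarrow>
    (\<Sum>\<^sub>\<int>k. epow (psi ((1 - \<theta>) * s0 + \<theta> * s1) f k x) (a/q)) \<le> ennreal C *
      (\<Sum>\<^sub>\<int>j. ennreal (u j powr (- (\<theta> * a / p1))) * (epow (areaq s0 (f0 j) x) (p0/q) +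
          ennreal (u j) * epow (areaq s1 (f1 j) x) (p1/q)))"

text \<open>The power theorem is applied at a single \<open>x\<close>, with the cell scale in place
  of the interpolation parameter. In the weight \<open>s0\<close> the L^q mean of
  \<open>f1 j\<close> is \<open>exp (\<kappa> * k)\<close> times its mean in the weight
  \<open>s1\<close>. Bounding both means by area functionals at \<open>x\<close> gives an estimate
  of K-functional type.\<close>

lemma psi_sum_le_decompositions:
  fixes p0 p1 \<theta> a s0 s1 R0 R1 :: real
  assumes p: "0 < p0" "0 < p1" and th: "0 < \<theta>" "\<theta> < 1" and a: "0 < a" "1 / a = (1 - \<theta>) / p0 + \<theta> / p1"
    and s: "s0 \<noteq> s1" and dn: "d * DIM('a::euclidean_space) \<le> 1" and rho: "1 < R0"
  shows "\<exists>C>0. decomposition_bound TYPE('a) p0 p1 s0 s1 \<theta> a R0 R1 C"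
proof -
  let ?s = "(1 - \<theta>) * s0 + \<theta> * s1" and ?\<eta> = "\<theta> * a / p1" and ?N = "real DIM('a)"
  \<comment> \<open>The sign is opposite to that in \<open>split_at_levels\<close>: here a bound for
    \<open>psi s1 (f1 j)\<close> is turned into one for \<open>psi s0 (f1 j)\<close>.\<close>
  define \<kappa> where "\<kappa> = ?N * (s1 - s0) * ln r"
  have kap: "\<kappa> \<noteq> 0" unfolding \<kappa>_def using s r by auto
  from power_theorem_discrete[OF p th a rho kap, of R1] obtain C2 where C2: "0 < C2"
    "power_bound p0 p1 \<theta> a \<kappa> R0 R1 C2" by blast
  let ?v = "unit_ball_vol ?N"
  define CF where "CF s = r powr \<bar>wexp TYPE('a) s\<bar> * ?v powr (s * q + 1)" for s
  have CF: "0 < CF s" for s unfolding CF_def using r by simp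
  \<comment> \<open>The larger of the constants for the two weights, times the factor from adding
    two functions. Dividing by \<open>L\<close> then gives the hypothesis of the power theorem with
    constant 1.\<close>
  define M where "M = 2 powr q * max (CF s0) (CF s1)"
  have M: "0 < M" unfolding M_def using CF[of s0] by (simp add: less_max_iff_disj)
  define L where "L = (2 * M) powr (1/q)"
  have L: "0 < L" unfolding L_def using M by simp
  have main: "(\<Sum>\<^sub>\<int>k. epow (psi ?s f k x) (a/q)) \<le> ennreal (L powr a * C2) *
      (\<Sum>\<^sub>\<int>j. ennreal (u j powr (- ?\<eta>)) * (epow (areaq s0 (f0 j) x) (p0/q) +
          ennreal (u j) * epow (areaq s1 (f1 j) x) (p1/q)))"
    if f[measurable]: "f \<in> bfun"
    and f0[measurable]: "\<forall>j. f0 j \<in> bfun"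
    and f1[measurable]: "\<forall>j. f1 j \<in> bfun"
    and fe: "\<forall>j z. f z = f0 j z + f1 j z" and u: "\<forall>j. 0 < u j" and ur: "\<forall>j. R0 * u j \<le> u (j + 1) \<and> u (j + 1) \<le> R1 * u j"
    for f :: "'a hfun" and f0 f1 and u :: "int \<Rightarrow> real" and x
  proof -
    define \<D> where "\<D> j = epow (areaq s0 (f0 j) x) (p0/q) + ennreal (u j) * epow (areaq s1 (f1 j) x) (p1/q)" for j
    show ?thesis
    proof (cases "\<forall>j. \<D> j < top")
      case False
      then obtain j where j: "\<D> j = top" by (auto simp: less_top[symmetric])
      have "ennreal (u j powr (- ?\<eta>)) * \<D> j = top" using u[rule_format, of j] j by (simp add: ennreal_mult_top)
      then have "(\<Sum>\<^sub>\<int>j. ennreal (u j powr (- ?\<eta>)) * \<D> j) = top"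
        using nn_integral_ge_point[of j UNIV "\<lambda>j. ennreal (u j powr (- ?\<eta>)) * \<D> j"] by (simp add: top_unique)
      then show ?thesis using L C2 unfolding \<D>_def by (simp add: ennreal_mult_top)
    next
      case True
      define D where "D j = enn2real (\<D> j)" for j
      have D: "\<D> j = ennreal (D j)" "0 \<le> D j" for j using True unfolding D_def by auto
      have A0: "areaq s0 (f0 j) x \<le> ennreal ((D j powr (1/p0)) powr q)" for j
      proof -
        have "epow (areaq s0 (f0 j) x) (p0/q) \<le> ennreal (D j)" unfolding D(1)[symmetric] \<D>_def by simp
        then have "areaq s0 (f0 j) x \<le> epow (ennreal (D j)) (q/p0)"
          using p q by (subst (asm) epow_le_iff) auto
        then show ?thesis using D(2)[of j] by (simp add: epow_ennreal powr_powr)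
      qed
      have A1: "areaq s1 (f1 j) x \<le> ennreal (((D j / u j) powr (1/p1)) powr q)" for j
      proof -
        have uj: "0 < u j" using u by simp
        have "ennreal (u j) * epow (areaq s1 (f1 j) x) (p1/q) \<le> ennreal (D j)" unfolding D(1)[symmetric] \<D>_def by simp
        then have "epow (areaq s1 (f1 j) x) (p1/q) \<le> ennreal (D j / u j)"
          by (rule le_ennreal_divide[OF uj D(2)])
        then have "areaq s1 (f1 j) x \<le> epow (ennreal (D j / u j)) (q/p1)"
          using p q by (subst (asm) epow_le_iff) auto
        then show ?thesis using D(2)[of j] uj by (simp add: epow_ennreal powr_powr)
      qed
      have exq: "exp (\<kappa> * k) powr q = r powr (k * (?N * (s1 - s0) * q))" for k
        using r by (simp add: powr_def \<kappa>_def mult_ac)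
      let ?b = "\<lambda>j (k::int). D j powr (1/p0) + exp (\<kappa> * k) * (D j / u j) powr (1/p1)"
      have key: "psi s0 f k x \<le> ennreal (2 * M * (?b j k) powr q)" for k j
      proof -
        let ?x = "D j powr (1/p0)" and ?y = "exp (\<kappa> * k) * (D j / u j) powr (1/p1)"
        have fm: "f0 j \<in> bfun" "f1 j \<in> bfun"
          using f0 f1 by auto
        have Mm: "2 powr q * CF s \<le> M" if "s = s0 \<or> s = s1" for s
          using that unfolding M_def by auto
        have "psi s0 (f0 j) k x \<le> ennreal (CF s0) * areaq s0 (f0 j) x"
          unfolding CF_def by (rule psi_le_areaq[OF fm(1) dn])
        also have "\<dots> \<le> ennreal (CF s0) * ennreal (?x powr q)" by (intro mult_left_mono A0) simp
        finally have P0: "psi s0 (f0 j) k x \<le> ennreal (CF s0 * ?x powr q)" using CF[of s0] by (simp add: ennreal_mult)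
        have "psi s1 (f1 j) k x \<le> ennreal (CF s1) * areaq s1 (f1 j) x"
          unfolding CF_def by (rule psi_le_areaq[OF fm(2) dn])
        also have "\<dots> \<le> ennreal (CF s1) * ennreal (((D j / u j) powr (1/p1)) powr q)" by (intro mult_left_mono A1) simp
        finally have "ennreal (exp (\<kappa> * k) powr q) * psi s1 (f1 j) k x
            \<le> ennreal (exp (\<kappa> * k) powr q) * (ennreal (CF s1) * ennreal (((D j / u j) powr (1/p1)) powr q))"
          by (rule mult_left_mono) simp
        moreover have "psi s0 (f1 j) k x = ennreal (exp (\<kappa> * k) powr q) * psi s1 (f1 j) k x"
          unfolding exq by (rule psi_change_weight[OF fm(2)])
        moreover have "CF s1 * ?y powr q = exp (\<kappa> * k) powr q * (CF s1 * ((D j / u j) powr (1/p1)) powr q)"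
          by (simp add: powr_mult mult_ac)
        ultimately have P1: "psi s0 (f1 j) k x \<le> ennreal (CF s1 * ?y powr q)"
          using CF[of s1] by (simp add: ennreal_mult mult_ac)
        have "psi s0 f k x \<le> ennreal (2 powr q) * (psi s0 (f0 j) k x + psi s0 (f1 j) k x)"
          by (rule psi_add_le[OF fm]) (use fe in blast)
        also have "\<dots> \<le> ennreal (2 powr q) * (ennreal (CF s0 * ?x powr q) + ennreal (CF s1 * ?y powr q))"
          by (intro mult_left_mono add_mono P0 P1) simp
        also have "\<dots> = ennreal (2 powr q * CF s0 * ?x powr q + 2 powr q * CF s1 * ?y powr q)"
          using CF[of s0] CF[of s1] by (simp add: ennreal_mult'[symmetric] ennreal_plus[symmetric] algebra_simps del: ennreal_plus)
        also have "\<dots> \<le> ennreal (M * (?x powr q + ?y powr q))"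
          unfolding distrib_left by (intro ennreal_leI add_mono mult_right_mono Mm) auto
        also have "\<dots> \<le> ennreal (M * (2 * (?x + ?y) powr q))"
          using M q u D(2)[of j] by (intro ennreal_leI mult_left_mono add_powr_le) auto
        finally show ?thesis by (simp add: mult_ac)
      qed
      have psif: "psi s0 f k x < top" for k by (rule le_less_trans[OF key[of _ 0]]) simp
      define \<psi> where "\<psi> k = enn2real (psi s0 f k x)" for k
      let ?t = "\<lambda>k::int. exp (- \<theta> * \<kappa> * k)"
      have \<psi>: "psi s0 f k x = ennreal (\<psi> k)" "0 \<le> \<psi> k" for k using psif[of k] unfolding \<psi>_def by auto
      define G where "G k = \<psi> k powr (1/q) / L" for k
      have GD: "G k \<le> ?b j k" for k j
      proof -
        let ?z = "?b j k"
        have z: "0 \<le> ?z" by simp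
        have "\<psi> k \<le> 2 * M * ?z powr q"
          using key[of k j] M unfolding \<psi>(1) by (subst (asm) ennreal_le_iff) auto
        then have "\<psi> k powr (1/q) \<le> (2 * M * ?z powr q) powr (1/q)"
          using \<psi>(2)[of k] q by (intro powr_mono2) auto
        also have "\<dots> = L * ?z" using M z q by (simp add: powr_mult powr_powr L_def)
        finally show ?thesis unfolding G_def using L by (simp add: field_simps)
      qed
      have W: "epow (psi ?s f k x) (a/q) = ennreal (L powr a) * ennreal ((?t k * G k) powr a)" for k
      proof -
        \<comment> \<open>\<open>?t k\<close> converts the weight \<open>s0\<close> into the
          intermediate one, since \<open>s0 - ?s = \<theta> * (s0 - s1)\<close>.\<close>
        have e: "?t k powr q = r powr (k * (?N * (s0 - ?s) * q))"
          using r by (simp add: powr_def \<kappa>_def algebra_simps)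
        have "psi ?s f k x = ennreal (?t k powr q) * ennreal (\<psi> k)"
          unfolding e \<psi>(1)[symmetric] by (rule psi_change_weight[OF f])
        then have "epow (psi ?s f k x) (a/q) = ennreal ((?t k powr q * \<psi> k) powr (a/q))"
          using \<psi>(2)[of k] by (simp add: ennreal_mult[symmetric] epow_ennreal)
        also have "(?t k powr q * \<psi> k) powr (a/q) = (?t k * \<psi> k powr (1/q)) powr a"
          using \<psi>(2)[of k] q by (simp add: powr_mult powr_powr)
        also have "?t k * \<psi> k powr (1/q) = L * (?t k * G k)"
          unfolding G_def using L by simp
        also have "(L * (?t k * G k)) powr a = L powr a * (?t k * G k) powr a"
          by (rule powr_mult)
        finally show ?thesis by (simp add: ennreal_mult)
      qed
      have "(\<Sum>\<^sub>\<int>k. epow (psi ?s f k x) (a/q)) =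
         ennreal (L powr a) * (\<Sum>\<^sub>\<int>k. ennreal ((?t k * G k) powr a))"
        unfolding W by (rule nn_integral_cmult) simp
      also have "\<dots> \<le> ennreal (L powr a) * (ennreal C2 * (\<Sum>\<^sub>\<int>j. ennreal (u j powr (- ?\<eta>) * D j)))"
        by (intro mult_left_mono C2(2)[rule_format]) (use GD D(2) u ur L in \<open>auto simp: G_def\<close>)
      also have "\<dots> = ennreal (L powr a * C2) * (\<Sum>\<^sub>\<int>j. ennreal (u j powr (- ?\<eta>)) * \<D> j)"
        unfolding D(1) using C2 by (simp add: ennreal_mult' mult.assoc)
      finally show ?thesis unfolding \<D>_def .
    qed
  qed
  show ?thesis by (intro exI[of _ "L powr a * C2"] conjI allI impI main) (use L C2 in auto)
qed


text \<open>Nearly optimal decompositions at \<open>t = 2 powr j\<close>, of size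
  \<open>v j\<close>, are fixed for the whole function. With \<open>u\<close> adapted to
  \<open>v\<close>, both integrated summands are at most \<open>v j powr p0\<close>, and the weights
  combine to \<open>(2 powr (- \<theta> * j) * v j) powr a\<close>. Their sum is the dyadic sum of
  the K-functional up to a constant and an error that tends to 0 with
  \<open>\<epsilon>\<close>.\<close>

lemma Zsum_le_interp_int:
  fixes p0 p1 \<theta> a s0 s1 :: real
  assumes p: "0 < p0" "0 < p1" and th: "0 < \<theta>" "\<theta> < 1" and a: "0 < a" "1 / a = (1 - \<theta>) / p0 + \<theta> / p1"
    and s: "s0 \<noteq> s1" and dn: "d * DIM('a::euclidean_space) \<le> 1"
  shows "\<exists>C>0. \<forall>f::'a hfun. f \<in> bfun \<longrightarrow>
    Zsum a ((1 - \<theta>) * s0 + \<theta> * s1) f \<le> ennreal C * interp_int p0 p1 s0 s1 \<theta> a f"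
proof -
  let ?s = "(1 - \<theta>) * s0 + \<theta> * s1" and ?\<eta> = "\<theta> * a / p1"
  let ?\<rho>0 = "2 powr min p0 p1" and ?\<rho>1 = "2 powr max p0 p1"
  have "1 < ?\<rho>0" using p by simp
  from psi_sum_le_decompositions[OF p th a s dn this, of ?\<rho>1] obtain C1 where C1: "0 < C1"
    "decomposition_bound TYPE('a) p0 p1 s0 s1 \<theta> a ?\<rho>0 ?\<rho>1 C1" by blast
  \<comment> \<open>Decay rate of the error term:
    \<open>2 powr (- \<theta> * j) * min 1 (2 powr j)\<close> is at most
    \<open>2 powr (- (min \<theta> (1 - \<theta>) * \<bar>j\<bar>))\<close>.\<close>
  define \<mu> where "\<mu> = a * min \<theta> (1 - \<theta>) * ln 2"
  let ?m = "min \<theta> (1 - \<theta>)"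
  have "\<mu> \<noteq> 0" unfolding \<mu>_def using a th by auto
  from sum_exp_dist_bounded[OF this] obtain C2 where C2: "0 < C2"
    "exp_sums_le (\<mu>) C2" by blast
  let ?C3 = "2 powr (\<theta> * a) / ln 2"
  let ?A = "C1 * 2 * 2 powr a"
  have A: "0 < ?A" using C1 by simp
  have eta: "(1 - \<theta>) * a / p0 = 1 - ?\<eta>"
    by (rule interpolation_exponent[OF a])
  \<comment> \<open>The exponent of \<open>v j\<close> in
    \<open>u j powr (- ?\<eta>) * v j powr p0\<close>.\<close>
  have expo: "p0 - (p0 - p1) * ?\<eta> = a"
  proof -
    have "p0 * (1 - ?\<eta>) = (1 - \<theta>) * a" unfolding eta[symmetric] using p by simp
    moreover have "p1 * ?\<eta> = \<theta> * a" using p by simp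
    moreover have "p0 - (p0 - p1) * ?\<eta> = p0 * (1 - ?\<eta>) + p1 * ?\<eta>" by (simp only: algebra_simps)
    ultimately show ?thesis by (simp add: algebra_simps)
  qed
  have main: "Zsum a ?s f \<le> ennreal (?A * ?C3) * interp_int p0 p1 s0 s1 \<theta> a f"
    if f: "f \<in> bfun" for f :: "'a hfun"
  proof (cases "interp_int p0 p1 s0 s1 \<theta> a f = top")
    case True
    then show ?thesis using C1 by (simp add: ennreal_mult_top)
  next
    case False
    define K where "K t = K_fun (tent_norm p0 q s0) (tent_norm p1 q s1) t f" for t
    let ?k = "\<lambda>k::int. epow (ennreal (2 powr (- \<theta> * k)) * K (2 powr k)) a"
    define I where "I = interp_int p0 p1 s0 s1 \<theta> a f"
    have KI: "(\<Sum>\<^sub>\<int>k. ?k k) \<le> ennreal ?C3 * I"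
      unfolding I_def interp_int_def K_def by (rule dyadic_sum_le_log_integral[OF K_fun_mono a(1) th(1)])
    have Kfin: "K (2 powr k) < top" for k :: int
    proof -
      have "?k k
         \<le> (\<Sum>\<^sub>\<int>k. ?k k)"
        by (rule nn_integral_ge_point) simp
      also have "\<dots> \<le> ennreal ?C3 * I" by (rule KI)
      also have "\<dots> < top" using False unfolding I_def by (simp add: ennreal_mult_less_top less_top)
      finally have "ennreal (2 powr (- \<theta> * k)) * K (2 powr k) \<noteq> top"
        using epow_eq_top_iff less_irrefl by metis
      then show ?thesis by (auto simp: ennreal_mult_eq_top_iff less_top[symmetric])
    qed
    define w where "w k = enn2real (K (2 powr k))" for k :: int
    have Kw: "K (2 powr k) = ennreal (w k)" "0 \<le> w k" for k
      using Kfin[of k] unfolding w_def by auto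
    have two: "2 powr real_of_int (k + 1) = 2 * 2 powr k" for k :: int
      by (simp add: powr_add)
    have w1: "w k \<le> w (k + 1)" for k
    proof -
      have "ennreal (w k) \<le> ennreal (w (k + 1))" unfolding Kw(1)[symmetric] K_def by (rule K_fun_mono) simp
      then show ?thesis using Kw(2) by simp
    qed
    \<comment> \<open>Doubling and monotonicity of the K-functional keep the growth of
      \<open>u\<close> between two geometric rates.\<close>
    have w2: "w (k + 1) \<le> 2 * w k" for k
    proof -
      have "K (2 * 2 powr k) \<le> ennreal 2 * K (2 powr k)"
        unfolding K_def by (rule K_fun_scale) auto
      then have "ennreal (w (k + 1)) \<le> ennreal (2 * w k)"
        unfolding two[symmetric] Kw(1) by (simp add: ennreal_mult')
      then show ?thesis using Kw(2) by simp
    qed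
    have eps: "Zsum a ?s f \<le> ennreal ?A * (ennreal ?C3 * I + ennreal (\<epsilon> powr a * C2))" if \<epsilon>: "0 < \<epsilon>" for \<epsilon>
    proof -
      \<comment> \<open>The K-functional may vanish and its infimum need not be attained. The added
        term makes \<open>v\<close> positive and strictly larger, preserves monotonicity and
        doubling, and is summable in the interpolation weight at both ends.\<close>
      define v where "v k = w k + \<epsilon> * min 1 (2 powr k)" for k
      have v0: "0 < v k" for k
        unfolding v_def using Kw(2)[of k] \<epsilon> by (intro add_nonneg_pos mult_pos_pos) auto
      have m1: "min 1 (2 powr k) \<le> min 1 (2 powr real_of_int (k + 1))"
        "min 1 (2 powr real_of_int (k + 1)) \<le> 2 * min 1 (2 powr k)" for k :: int
        unfolding two using powr_gt_zero[of 2 "real_of_int k"] by (simp_all add: min_def)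
      have v1: "v k \<le> v (k + 1)" for k
        unfolding v_def using w1[of k] mult_left_mono[OF m1(1)[of k] less_imp_le[OF \<epsilon>]] by (rule add_mono)
      have v2: "v (k + 1) \<le> 2 * v k" for k
        using w2[of k] mult_left_mono[OF m1(2)[of k] less_imp_le[OF \<epsilon>]] unfolding v_def by (simp add: algebra_simps)
      have "\<exists>f0 f1. f0 \<in> bfun \<and> f1 \<in> bfun \<and>
         (\<forall>z. f z = f0 z + f1 z) \<and>
         tent_norm p0 q s0 f0 + ennreal (2 powr j) * tent_norm p1 q s1 f1 \<le> ennreal (v j)" for j
      proof -
        have "w j < v j" unfolding v_def using \<epsilon> by simp
        then have "K_fun (tent_norm p0 q s0) (tent_norm p1 q s1) (2 powr j) f < ennreal (v j)"
          using Kw[of j] v0[of j] unfolding K_def by (simp add: ennreal_lessI)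
        then obtain f0 f1 where "f0 \<in> borel_measurable lborel2" "f1 \<in> borel_measurable lborel2"
          "\<And>z. f z = f0 z + f1 z" "tent_norm p0 q s0 f0 + ennreal (2 powr j) * tent_norm p1 q s1 f1 < ennreal (v j)"
          by (rule K_fun_approx) blast
        then show ?thesis unfolding borel_measurable_lborel_pair
          by (intro exI[of _ f0] exI[of _ f1]) auto
      qed
      then obtain f0 f1 where f01: "\<And>j. f0 j \<in> bfun" "\<And>j. f1 j \<in> bfun"
         "\<And>j z. f z = f0 j z + f1 j z"
         "\<And>j. tent_norm p0 q s0 (f0 j) + ennreal (2 powr j) * tent_norm p1 q s1 (f1 j) \<le> ennreal (v j)"
        by metis
      have I0: "tentq p0 s0 (f0 j) \<le> ennreal (v j powr p0)" for j
      proof -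
        have "tent_norm p0 q s0 (f0 j) \<le> ennreal (v j)"
          using f01(4)[of j] by (rule order.trans[rotated]) simp
        then show ?thesis unfolding tent_norm_areaq
          using p v0[of j] by (subst (asm) epow_le_iff) (auto simp: epow_ennreal)
      qed
      have I1: "tentq p1 s1 (f1 j) \<le> ennreal ((v j / 2 powr j) powr p1)" for j
      proof -
        have "ennreal (2 powr j) * tent_norm p1 q s1 (f1 j) \<le> ennreal (v j)"
          using f01(4)[of j] by (rule order.trans[rotated]) simp
        then have "tent_norm p1 q s1 (f1 j) \<le> ennreal (v j / 2 powr j)"
          using v0[of j] by (intro le_ennreal_divide) auto
        then show ?thesis unfolding tent_norm_areaq
          using p v0[of j] by (subst (asm) epow_le_iff) (auto simp: epow_ennreal)
      qed
      \<comment> \<open>The solution of \<open>u j * (v j / 2 powr j) powr p1 = v j powr p0\<close>,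
        which balances the bounds for the two summands.\<close>
      define u where "u j = 2 powr (j * p1) * v j powr (p0 - p1)" for j
      let ?T = "\<lambda>j x. ennreal (u j powr (- ?\<eta>)) * (epow (areaq s0 (f0 j) x) (p0/q) + ennreal (u j) * epow (areaq s1 (f1 j) x) (p1/q))"
      let ?e = "\<lambda>j::int. ennreal (\<epsilon> powr a) * ennreal (exp (- \<bar>\<mu> * j - 0\<bar>))"
      let ?w = "\<lambda>j::int. (2 powr (- \<theta> * j) * v j) powr a"
      have u0: "0 < u j" for j unfolding u_def using v0[of j] by simp
      have ur: "?\<rho>0 * u j \<le> u (j + 1)" "u (j + 1) \<le> ?\<rho>1 * u j" for j
      proof -
        \<comment> \<open>The growth factor \<open>2 powr p1 * R powr (p0 - p1)\<close> of
          \<open>u\<close> is monotone in \<open>R\<close>, equal to \<open>2 powr p1\<close> at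
          \<open>R = 1\<close> and to \<open>2 powr p0\<close> at \<open>R = 2\<close>; it lies
          between these for either order of the exponents.\<close>
        define R where "R = v (j + 1) / v j"
        have R: "1 \<le> R" "R \<le> 2" unfolding R_def using v0[of j] v1[of j] v2[of j] by (auto simp: field_simps)
        have uR: "u (j + 1) = (2 powr p1 * R powr (p0 - p1)) * u j"
        proof -
          have "v (j + 1) = R * v j" unfolding R_def using v0[of j] by simp
          then have "v (j + 1) powr (p0 - p1) = R powr (p0 - p1) * v j powr (p0 - p1)"
            by (simp add: powr_mult)
          moreover have "2 powr (real_of_int (j + 1) * p1) = 2 powr p1 * 2 powr (j * p1)"
            by (simp add: powr_add[symmetric] algebra_simps)
          ultimately show ?thesis unfolding u_def by (simp only: mult_ac)
        qed
        have "?\<rho>0 \<le> 2 powr p1 * R powr (p0 - p1) \<and> 2 powr p1 * R powr (p0 - p1) \<le> ?\<rho>1"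
        proof (cases "p1 \<le> p0")
          case True
          have "1 \<le> R powr (p0 - p1)" using R True by (simp add: ge_one_powr_ge_zero)
          moreover have "R powr (p0 - p1) \<le> 2 powr (p0 - p1)" using R True by (intro powr_mono2) auto
          ultimately have "2 powr p1 * 1 \<le> 2 powr p1 * R powr (p0 - p1)" "2 powr p1 * R powr (p0 - p1) \<le> 2 powr p1 * 2 powr (p0 - p1)"
            by (auto intro!: mult_left_mono)
          then show ?thesis using True R by (simp add: powr_add[symmetric] min_def max_def)
        next
          case False
          have "R powr (p0 - p1) \<le> 1 powr (p0 - p1)" using R False by (intro powr_mono2') auto
          moreover have "2 powr (p0 - p1) \<le> R powr (p0 - p1)" using R False by (intro powr_mono2') auto
          ultimately have "2 powr p1 * R powr (p0 - p1) \<le> 2 powr p1 * 1" "2 powr p1 * 2 powr (p0 - p1) \<le> 2 powr p1 * R powr (p0 - p1)"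
            by (auto intro!: mult_left_mono)
          then show ?thesis using False R by (simp add: powr_add[symmetric] min_def max_def)
        qed
        then show "?\<rho>0 * u j \<le> u (j + 1)" "u (j + 1) \<le> ?\<rho>1 * u j"
          unfolding uR using u0[of j] by (auto intro!: mult_right_mono)
      qed
      have uv: "u j powr (- ?\<eta>) * v j powr p0 = ?w j"
        "u j * (v j / 2 powr j) powr p1 = v j powr p0" for j
      proof -
        have "u j powr (- ?\<eta>) = 2 powr (j * p1 * (- ?\<eta>)) * v j powr ((p0 - p1) * (- ?\<eta>))"
          unfolding u_def by (simp add: powr_mult powr_powr)
        also have "real_of_int j * p1 * (- ?\<eta>) = - \<theta> * j * a" using p by simp
        finally have "u j powr (- ?\<eta>) * v j powr p0 = 2 powr (- \<theta> * j * a) * v j powr (p0 - (p0 - p1) * ?\<eta>)"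
          by (simp add: powr_add[symmetric] powr_diff powr_minus divide_inverse)
        then show "u j powr (- ?\<eta>) * v j powr p0 = ?w j"
          unfolding expo by (simp add: powr_mult powr_powr)
        show "u j * (v j / 2 powr j) powr p1 = v j powr p0"
          unfolding u_def using v0[of j] by (simp add: powr_divide powr_powr powr_diff)
      qed
      have [measurable]: "areaq s0 (f0 j) \<in> borel_measurable borel" "areaq s1 (f1 j) \<in> borel_measurable borel" for j
        using f01 by auto
      have epm[measurable]: "(\<lambda>x. epow (areaq s0 (f0 j) x) e) \<in> borel_measurable borel"
         "(\<lambda>x. epow (areaq s1 (f1 j) x) e) \<in> borel_measurable borel" for j e
        by (auto intro!: measurable_compose[OF _ measurable_epow])
      have "Zsum a ?s f = (\<integral>\<^sup>+x. (\<Sum>\<^sub>\<int>k. epow (psi ?s f k x) (a/q)) \<partial>lborel)"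
        unfolding Zsum_def using f by (intro nn_integral_count_space_nn_integral[symmetric]) auto
      also have "\<dots> \<le> (\<integral>\<^sup>+x. ennreal C1 * (\<Sum>\<^sub>\<int>j. ?T j x) \<partial>lborel)"
        by (intro nn_integral_mono C1(2)[rule_format]) (use f f01 u0 ur in auto)
      also have "\<dots> = ennreal C1 * (\<integral>\<^sup>+x. (\<Sum>\<^sub>\<int>j. ?T j x) \<partial>lborel)"
        by (rule nn_integral_cmult) measurable
      also have "(\<integral>\<^sup>+x. (\<Sum>\<^sub>\<int>j. ?T j x) \<partial>lborel)
        = (\<Sum>\<^sub>\<int>j. (\<integral>\<^sup>+x. ?T j x \<partial>lborel))"
        by (rule nn_integral_count_space_nn_integral) auto
      also have "\<dots> \<le> (\<Sum>\<^sub>\<int>j. ennreal 2 * ennreal (?w j))"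
      proof (rule nn_integral_mono)
        fix j
        have "(\<integral>\<^sup>+x. ?T j x \<partial>lborel)
          = ennreal (u j powr (- ?\<eta>)) * ((tentq p0 s0 (f0 j)) +
           ennreal (u j) * (tentq p1 s1 (f1 j)))"
          by (simp add: nn_integral_cmult nn_integral_add)
        also have "\<dots> \<le> ennreal (u j powr (- ?\<eta>)) * (ennreal (v j powr p0) + ennreal (u j) * ennreal ((v j / 2 powr j) powr p1))"
          by (intro mult_left_mono add_mono I0 I1) auto
        also have "\<dots> = ennreal (u j powr (- ?\<eta>) * (v j powr p0 + u j * (v j / 2 powr j) powr p1))"
          using u0[of j] by (simp add: ennreal_mult'')
        also have "u j powr (- ?\<eta>) * (v j powr p0 + u j * (v j / 2 powr j) powr p1) = 2 * ?w j"
          unfolding uv(2) uv(1)[symmetric] by simp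
        finally show "(\<integral>\<^sup>+x. ?T j x \<partial>lborel) \<le> ennreal 2 * ennreal (?w j)"
          by (simp add: ennreal_mult')
      qed
      also have "\<dots> = ennreal 2 * (\<Sum>\<^sub>\<int>j. ennreal (?w j))"
        by (rule nn_integral_cmult) simp
      also have "(\<Sum>\<^sub>\<int>j. ennreal (?w j)) \<le>
        (\<Sum>\<^sub>\<int>j. ennreal (2 powr a) * (?k j +
           ?e j))"
      proof (rule nn_integral_mono)
        fix j :: int
        let ?x = "2 powr (- \<theta> * j) * w j" and ?y = "2 powr (- \<theta> * j) * (\<epsilon> * min 1 (2 powr j))"
        have K: "?k j = ennreal (?x powr a)"
          unfolding Kw(1) using Kw(2)[of j] by (subst ennreal_mult'[symmetric]) (auto simp: epow_ennreal)
        have y: "?y powr a \<le> \<epsilon> powr a * exp (- \<bar>\<mu> * j - 0\<bar>)"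
        proof -
          have "2 powr (- \<theta> * j) * min 1 (2 powr j) \<le> 2 powr (- (?m * \<bar>real_of_int j\<bar>))"
          proof (cases "0 \<le> j")
            case True
            have "?m * j \<le> \<theta> * j" using True by (intro mult_right_mono) auto
            then have "2 powr (- \<theta> * j) \<le> (2::real) powr (- (?m * \<bar>real_of_int j\<bar>))" using True by simp
            moreover have "2 powr (- \<theta> * j) * min 1 (2 powr j) \<le> 2 powr (- \<theta> * j) * 1"
              by (intro mult_left_mono) auto
            ultimately show ?thesis by linarith
          next
            case False
            have "?m * (- real_of_int j) \<le> (1 - \<theta>) * (- real_of_int j)" using False by (intro mult_right_mono) auto
            then have "2 powr ((1 - \<theta>) * j) \<le> (2::real) powr (- (?m * \<bar>real_of_int j\<bar>))" using False by simp
            moreover have "2 powr (- \<theta> * j) * min 1 (2 powr j) \<le> 2 powr (- \<theta> * j) * 2 powr j"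
              by (intro mult_left_mono) auto
            moreover have "2 powr (- \<theta> * j) * 2 powr j = (2::real) powr ((1 - \<theta>) * j)"
              unfolding powr_add[symmetric] by (simp add: algebra_simps)
            ultimately show ?thesis by linarith
          qed
          then have "(2 powr (- \<theta> * j) * min 1 (2 powr j)) powr a \<le> (2 powr (- (?m * \<bar>real_of_int j\<bar>))) powr a"
            using a by (intro powr_mono2) auto
          also have "\<dots> = exp (- \<bar>\<mu> * j - 0\<bar>)"
            using a th by (simp add: powr_powr \<mu>_def abs_mult) (simp add: powr_def mult_ac)
          finally have le: "(2 powr (- \<theta> * j) * min 1 (2 powr j)) powr a \<le> exp (- \<bar>\<mu> * j - 0\<bar>)" .
          have "?y powr a = \<epsilon> powr a * (2 powr (- \<theta> * j) * min 1 (2 powr j)) powr a"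
            by (simp only: powr_mult mult_ac)
          then show ?thesis using mult_left_mono[OF le, of "\<epsilon> powr a"] by simp
        qed
        have "?w j = (?x + ?y) powr a" unfolding v_def by (simp add: distrib_left)
        also have "\<dots> \<le> 2 powr a * (?x powr a + ?y powr a)"
          using Kw(2)[of j] \<epsilon> a by (intro add_powr_le) auto
        also have "\<dots> \<le> 2 powr a * (?x powr a + \<epsilon> powr a * exp (- \<bar>\<mu> * j - 0\<bar>))"
          by (intro mult_left_mono add_left_mono y) simp
        finally have "ennreal (?w j) \<le> ennreal (2 powr a * (?x powr a + \<epsilon> powr a * exp (- \<bar>\<mu> * j - 0\<bar>)))"
          by (rule ennreal_leI)
        then show "ennreal (?w j) \<le> ennreal (2 powr a) * (?k j +
           ?e j)"
          unfolding K by (simp add: ennreal_mult')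
      qed
      also have "(\<Sum>\<^sub>\<int>j. ennreal (2 powr a) * (?k j +
           ?e j))
         = ennreal (2 powr a) * ((\<Sum>\<^sub>\<int>j. ?k j) +
           ennreal (\<epsilon> powr a) * (\<Sum>\<^sub>\<int>j. ennreal (exp (- \<bar>\<mu> * j - 0\<bar>))))"
        by (simp add: nn_integral_cmult nn_integral_add)
      also have "\<dots> \<le> ennreal (2 powr a) * (ennreal ?C3 * I + ennreal (\<epsilon> powr a) * ennreal C2)"
        by (intro mult_left_mono add_mono KI C2(2)[rule_format]) auto
      finally have "Zsum a ?s f \<le> ennreal C1 * (ennreal 2 * (ennreal (2 powr a) * (ennreal ?C3 * I + ennreal (\<epsilon> powr a) * ennreal C2)))"
        by (simp add: mult_left_mono)
      then show ?thesis using C1 by (simp add: ennreal_mult' mult.assoc)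
    qed
    have "Zsum a ?s f \<le> ennreal ?A * (ennreal ?C3 * I)"
    proof (rule ennreal_le_epsilon)
      fix e :: real assume e: "0 < e"
      define B where "B = ?A * C2"
      have B: "0 < B" unfolding B_def using A C2(1) by (rule mult_pos_pos)
      \<comment> \<open>Chosen so that the error term in \<open>eps\<close> is exactly
        \<open>e\<close>.\<close>
      define \<epsilon> where "\<epsilon> = (e / B) powr (1/a)"
      have \<epsilon>: "0 < \<epsilon>" unfolding \<epsilon>_def using e B by simp
      have "\<epsilon> powr a = e / B" unfolding \<epsilon>_def using e B a(1) by (simp add: powr_powr)
      then have "B * \<epsilon> powr a = e" using B by simp
      then have "?A * (\<epsilon> powr a * C2) = e" unfolding B_def by (simp only: mult_ac)
      then have "ennreal ?A * ennreal (\<epsilon> powr a * C2) = ennreal e"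
        by (simp only: ennreal_mult'[OF less_imp_le[OF A], symmetric])
      then show "Zsum a ?s f \<le> ennreal ?A * (ennreal ?C3 * I) + ennreal e"
        using eps[OF \<epsilon>] by (simp add: distrib_left)
    qed
    also have "\<dots> = ennreal (?A * ?C3) * I"
      using A by (subst ennreal_mult) (auto simp: mult.assoc)
    finally show ?thesis unfolding I_def .
  qed
  show ?thesis by (intro exI[of _ "?A * ?C3"] conjI allI impI main) (use A in auto)
qed

end

section \<open>Equivalence of the quasi-norms\<close>

theorem mainTheorem11:
  fixes p0 p1 q s0 s1 \<theta> c0 c1 p\<theta> s\<theta> :: real
  assumes "0 < p0" "0 < p1" "1 \<le> q" "s0 \<noteq> s1" "0 < \<theta>" "\<theta> < 1"
    and "0 < c0" "1 < c1"
    and "1 / p\<theta> = (1 - \<theta>) / p0 + \<theta> / p1"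
    and "s\<theta> = (1 - \<theta>) * s0 + \<theta> * s1"
  shows "\<exists>C::real. 0 < C \<and>
    (\<forall>f :: 'a::euclidean_space \<times> real \<Rightarrow> real. f \<in> borel_measurable lborel2 \<longrightarrow>
       interp_norm (tent_norm p0 q s0) (tent_norm p1 q s1) \<theta> p\<theta> f
         \<le> ennreal C * Z_norm p\<theta> q s\<theta> c0 c1 f \<and>
       Z_norm p\<theta> q s\<theta> c0 c1 f
         \<le> ennreal C * interp_norm (tent_norm p0 q s0) (tent_norm p1 q s1) \<theta> p\<theta> f)"
proof -
  \<comment> \<open>Points in one cell of scale \<open>k\<close> are then closer than
    \<open>c1 powr k\<close>, as needed for cones and local means, and closer than
    \<open>c0 * c1 powr k\<close>, as needed for Whitney regions.\<close>
  define d where "d = min 1 c0 / real DIM('a)"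
  interpret whitney_grid c1 d q
    by unfold_locales (use assms in \<open>auto simp: d_def\<close>)
  have d1: "d * DIM('a) \<le> 1" and d2: "d * DIM('a) \<le> c0" by (auto simp: d_def)
  have "0 < 1 / p\<theta>" unfolding assms(9) using assms(1,2,5,6) by (intro add_pos_pos divide_pos_pos) auto
  then have a: "0 < p\<theta>" by simp
  note pars = assms(1,2,5,6) a assms(9,4) d1
  obtain C1 where C1: "0 < C1" "\<And>f::'a \<times> real \<Rightarrow> real. f \<in> bfun \<Longrightarrow>
    interp_int p0 p1 s0 s1 \<theta> p\<theta> f \<le> ennreal C1 * Zsum p\<theta> s\<theta> f"
    using interp_int_le_Zsum[OF pars] unfolding assms(10)[symmetric] by blast
  obtain C2 where C2: "0 < C2" "\<And>f::'a \<times> real \<Rightarrow> real. f \<in> bfun \<Longrightarrow>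
    Zsum p\<theta> s\<theta> f \<le> ennreal C2 * interp_int p0 p1 s0 s1 \<theta> p\<theta> f"
    using Zsum_le_interp_int[OF pars] unfolding assms(10)[symmetric] by blast
  obtain C3 where C3: "0 < C3" "\<And>f::'a \<times> real \<Rightarrow> real. f \<in> bfun \<Longrightarrow>
    Zsum p\<theta> s\<theta> f \<le> ennreal C3 * Zint p\<theta> s\<theta> c0 f"
    using Zsum_le_Zint[OF a assms(7) d2] by blast
  obtain C4 where C4: "0 < C4" "\<And>f::'a \<times> real \<Rightarrow> real. f \<in> bfun \<Longrightarrow>
    Zint p\<theta> s\<theta> c0 f \<le> ennreal C4 * Zsum p\<theta> s\<theta> f"
    using Zint_le_Zsum[OF a assms(7) d1] by blast
  \<comment> \<open>Both composed estimates compare powers with exponent \<open>p\<theta>\<close>; a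
    common constant is taken before passing to the root.\<close>
  let ?M = "max (C1 * C3) (C4 * C2)"
  define C where "C = ?M powr (1 / p\<theta>)"
  have mx: "0 < ?M" using C1 C3 by (simp add: less_max_iff_disj)
  have root: "epow x (1 / p\<theta>) \<le> ennreal C * epow y (1 / p\<theta>)"
    if "x \<le> ennreal c * y" "c \<le> ?M" for x y c
  proof -
    have "x \<le> ennreal (?M) * y"
      by (rule order.trans[OF that(1) mult_right_mono[OF ennreal_leI[OF that(2)]]]) simp
    then have "epow x (1 / p\<theta>) \<le> epow (ennreal (?M) * y) (1 / p\<theta>)"
      by (rule epow_mono[rotated]) (use a in simp)
    also have "\<dots> = ennreal C * epow y (1 / p\<theta>)"
      unfolding epow_mult C_def using mx by (subst epow_ennreal) auto
    finally show ?thesis .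
  qed
  show ?thesis
  proof (intro exI[of _ C] conjI allI impI)
    show "0 < C" unfolding C_def using mx by simp
    fix f :: "'a \<times> real \<Rightarrow> real"
    assume "f \<in> borel_measurable lborel2"
    then have f: "f \<in> bfun" unfolding borel_measurable_lborel_pair .
    have "interp_int p0 p1 s0 s1 \<theta> p\<theta> f \<le> ennreal C1 * (ennreal C3 * Zint p\<theta> s\<theta> c0 f)"
      using C1(2)[OF f] mult_left_mono[OF C3(2)[OF f], of "ennreal C1"] by (rule order.trans) simp
    then have 1: "interp_int p0 p1 s0 s1 \<theta> p\<theta> f \<le> ennreal (C1 * C3) * Zint p\<theta> s\<theta> c0 f"
      using C1(1) C3(1) by (simp add: ennreal_mult mult.assoc)
    have "Zint p\<theta> s\<theta> c0 f \<le> ennreal C4 * (ennreal C2 * interp_int p0 p1 s0 s1 \<theta> p\<theta> f)"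
      using C4(2)[OF f] mult_left_mono[OF C2(2)[OF f], of "ennreal C4"] by (rule order.trans) simp
    then have 2: "Zint p\<theta> s\<theta> c0 f \<le> ennreal (C4 * C2) * interp_int p0 p1 s0 s1 \<theta> p\<theta> f"
      using C4(1) C2(1) by (simp add: ennreal_mult mult.assoc)
    show "interp_norm (tent_norm p0 q s0) (tent_norm p1 q s1) \<theta> p\<theta> f \<le> ennreal C * Z_norm p\<theta> q s\<theta> c0 c1 f"
      unfolding interp_norm_interp_int Z_norm_Zint by (rule root[OF 1]) simp
    show "Z_norm p\<theta> q s\<theta> c0 c1 f \<le> ennreal C * interp_norm (tent_norm p0 q s0) (tent_norm p1 q s1) \<theta> p\<theta> f"
      unfolding interp_norm_interp_int Z_norm_Zint by (rule root[OF 2]) simp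
  qed
qed

end
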